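(* Let $G$ be any finitely generated subgroup of a triangle-free Artin group $A$. Either $G$ is virtually abelian or it has uniform exponential growth with $w(G)\ge\sqrt[600]{2}$.
   Context: An Artin group is given by a presentation associated to a finite simplicial graph (the defining graph) whose edges are labeled by integers $m\ge 2$: vertices correspond to generators, and an edge labeled $m$ joining vertices $a$ and $b$ corresponds to the relation $\underbrace{aba\cdots}_{m}=\underbrace{bab\cdots}_{m}$. A triangle-free Artin group is one whose defining graph has girth $\ge 4$ (i.e. contains no triangles). For a group $G$ with finite generating set $S$, let $B(n,S)$ be the ball of radius $n$ in the Cayley graph of $G$ with respect to $S$, $w(G,S)=\lim_{n\to\infty}|B(n,S)|^{1/n}$, and $w(G)=\inf\{w(G,S)\mid S \text{ a finite generating set of } G\}$. The group $G$ has uniform exponential growth if $w(G)>1$. *)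

theory Defs
  imports Complex_Main "HOL-Algebra.Generated_Groups"
begin

section \<open>Groups given by generators and relations\<close>

text \<open>A letter \<open>(x, True)\<close> stands for the generator \<open>x\<close> and \<open>(x, False)\<close> for its formal inverse.\<close>

type_synonym 'v word = "('v \<times> bool) list"

definition words_on :: "'v set \<Rightarrow> 'v word set" where
  "words_on X = lists (X \<times> UNIV)"

definition inv_letter :: "'v \<times> bool \<Rightarrow> 'v \<times> bool" where
  "inv_letter l = (fst l, \<not> snd l)"

text \<open>The least congruence on the words over \<open>X\<close> that contains \<open>R\<close> and makes each letter inverse
  to its formal inverse. The set \<open>R\<close> consists of pairs \<open>(u, v)\<close>, meaning the relation \<open>u = v\<close>.\<close>

inductive_set pres_cong :: "'v set \<Rightarrow> ('v word \<times> 'v word) set \<Rightarrow> ('v word \<times> 'v word) set"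
  for X :: "'v set" and R :: "('v word \<times> 'v word) set" where
  refl: "u \<in> words_on X \<Longrightarrow> (u, u) \<in> pres_cong X R"
| sym: "(u, v) \<in> pres_cong X R \<Longrightarrow> (v, u) \<in> pres_cong X R"
| trans: "(u, v) \<in> pres_cong X R \<Longrightarrow> (v, w) \<in> pres_cong X R \<Longrightarrow> (u, w) \<in> pres_cong X R"
| cancel: "p \<in> words_on X \<Longrightarrow> q \<in> words_on X \<Longrightarrow> fst l \<in> X \<Longrightarrow>
    (p @ [l, inv_letter l] @ q, p @ q) \<in> pres_cong X R"
| rel: "p \<in> words_on X \<Longrightarrow> q \<in> words_on X \<Longrightarrow> (u, v) \<in> R \<Longrightarrow>
    u \<in> words_on X \<Longrightarrow> v \<in> words_on X \<Longrightarrow>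
    (p @ u @ q, p @ v @ q) \<in> pres_cong X R"

definition presented_group :: "'v set \<Rightarrow> ('v word \<times> 'v word) set \<Rightarrow> 'v word set monoid" where
  "presented_group X R =
    \<lparr>carrier = words_on X // pres_cong X R,
     mult = (\<lambda>A B. pres_cong X R `` {u @ v | u v. u \<in> A \<and> v \<in> B}),
     one = pres_cong X R `` {[]}\<rparr>"

lemma words_on_append [simp]: "u @ v \<in> words_on X \<longleftrightarrow> u \<in> words_on X \<and> v \<in> words_on X"
  by (auto simp: words_on_def)

lemma words_on_Nil [simp]: "[] \<in> words_on X"
  by (simp add: words_on_def)

lemma words_on_Cons [simp]: "l # u \<in> words_on X \<longleftrightarrow> fst l \<in> X \<and> u \<in> words_on X"
  by (cases l) (auto simp: words_on_def)

lemma fst_inv_letter [simp]: "fst (inv_letter l) = fst l"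
  and inv_letter_inv_letter [simp]: "inv_letter (inv_letter l) = l"
  by (simp_all add: inv_letter_def)

lemma pres_cong_words:
  "(u, v) \<in> pres_cong X R \<Longrightarrow> u \<in> words_on X \<and> v \<in> words_on X"
  by (induction rule: pres_cong.induct) auto

lemma equiv_pres_cong: "equiv (words_on X) (pres_cong X R)"
proof (rule equivI)
  show "pres_cong X R \<subseteq> words_on X \<times> words_on X"
    using pres_cong_words by fastforce
  show "refl_on (words_on X) (pres_cong X R)"
    using pres_cong_words by (auto intro!: refl_onI pres_cong.refl)
  show "Relation.sym (pres_cong X R)"
    by (auto intro: symI pres_cong.sym)
  show "Relation.trans (pres_cong X R)"
    by (meson transI pres_cong.trans)
qed

lemma pres_cong_ctxt:
  assumes "(u, v) \<in> pres_cong X R" "p \<in> words_on X" "q \<in> words_on X"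
  shows "(p @ u @ q, p @ v @ q) \<in> pres_cong X R"
  using assms
proof (induction rule: pres_cong.induct)
  case (refl u)
  then show ?case by (intro pres_cong.refl) auto
next
  case (sym u v)
  then show ?case by (blast intro: pres_cong.sym)
next
  case (trans u v w)
  then show ?case by (blast intro: pres_cong.trans)
next
  case (cancel p' q' l)
  then show ?case using pres_cong.cancel[of "p @ p'" X "q' @ q" l R] by simp
next
  case (rel p' q' u v)
  then show ?case using pres_cong.rel[of "p @ p'" X "q' @ q" u v R] by simp
qed

lemma pres_cong_append:
  assumes "(u, u') \<in> pres_cong X R" "(v, v') \<in> pres_cong X R"
  shows "(u @ v, u' @ v') \<in> pres_cong X R"
  using pres_cong_ctxt[OF assms(1), of "[]" v] pres_cong_ctxt[OF assms(2), of u' "[]"]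
    pres_cong_words[OF assms(1)] pres_cong_words[OF assms(2)]
  by (auto intro: pres_cong.trans)

lemma pres_cong_inverse:
  "u \<in> words_on X \<Longrightarrow> (u @ map inv_letter (rev u), []) \<in> pres_cong X R"
proof (induction u)
  case Nil
  then show ?case by (simp add: pres_cong.refl)
next
  case (Cons l u)
  then have "([l] @ (u @ map inv_letter (rev u)) @ [inv_letter l], [l] @ [] @ [inv_letter l])
      \<in> pres_cong X R"
    by (intro pres_cong_ctxt) auto
  moreover have "([l] @ [] @ [inv_letter l], []) \<in> pres_cong X R"
    using Cons.prems pres_cong.cancel[of "[]" X "[]" l R] by simp
  ultimately show ?case by (auto intro: pres_cong.trans)
qed

lemma words_on_inverse: "u \<in> words_on X \<Longrightarrow> map inv_letter (rev u) \<in> words_on X"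
  by (induction u) auto

lemma presented_group_mult:
  assumes "u \<in> words_on X" "v \<in> words_on X"
  shows "pres_cong X R `` {u} \<otimes>\<^bsub>presented_group X R\<^esub> pres_cong X R `` {v}
    = pres_cong X R `` {u @ v}"
proof -
  have "(u @ v, x) \<in> pres_cong X R"
    if "(u, u') \<in> pres_cong X R" "(v, v') \<in> pres_cong X R" "(u' @ v', x) \<in> pres_cong X R"
    for u' v' x
    using that by (blast intro: pres_cong.trans pres_cong_append)
  moreover have "(u, u) \<in> pres_cong X R" "(v, v) \<in> pres_cong X R"
    using assms by (auto intro: pres_cong.refl)
  ultimately show ?thesis
    unfolding presented_group_def by (simp add: set_eq_iff Image_iff) blast
qed

lemma presented_group_carrierE:
  assumes "A \<in> carrier (presented_group X R)"
  obtains u where "u \<in> words_on X" "A = pres_cong X R `` {u}"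
  using assms by (auto simp: presented_group_def elim: quotientE)

lemma presented_group_carrierI:
  "u \<in> words_on X \<Longrightarrow> pres_cong X R `` {u} \<in> carrier (presented_group X R)"
  by (simp add: presented_group_def quotientI)

lemma presented_group_one: "\<one>\<^bsub>presented_group X R\<^esub> = pres_cong X R `` {[]}"
  by (simp add: presented_group_def)

theorem group_presented_group: "group (presented_group X R)"
proof (rule groupI)
  fix A B C
  assume A: "A \<in> carrier (presented_group X R)"
  then obtain u where u: "u \<in> words_on X" "A = pres_cong X R `` {u}"
    by (rule presented_group_carrierE)
  show "\<one>\<^bsub>presented_group X R\<^esub> \<otimes>\<^bsub>presented_group X R\<^esub> A = A"
    using u by (simp add: presented_group_one presented_group_mult)
  let ?v = "map inv_letter (rev u)"
  have "(?v @ map inv_letter (rev ?v), []) \<in> pres_cong X R"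
    by (rule pres_cong_inverse[OF words_on_inverse[OF u(1)]])
  then have "(?v @ u, []) \<in> pres_cong X R"
    by (simp add: rev_map o_def)
  then have "pres_cong X R `` {?v @ u} = pres_cong X R `` {[]}"
    by (rule equiv_class_eq[OF equiv_pres_cong])
  then show "\<exists>B\<in>carrier (presented_group X R). B \<otimes>\<^bsub>presented_group X R\<^esub> A = \<one>\<^bsub>presented_group X R\<^esub>"
    using u words_on_inverse[OF u(1)]
    by (metis presented_group_mult presented_group_one presented_group_carrierI)
  assume B: "B \<in> carrier (presented_group X R)"
  then obtain v where v: "v \<in> words_on X" "B = pres_cong X R `` {v}"
    by (rule presented_group_carrierE)
  show "A \<otimes>\<^bsub>presented_group X R\<^esub> B \<in> carrier (presented_group X R)"
    using u v by (simp add: presented_group_mult presented_group_carrierI)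
  assume "C \<in> carrier (presented_group X R)"
  then obtain w where w: "w \<in> words_on X" "C = pres_cong X R `` {w}"
    by (rule presented_group_carrierE)
  show "A \<otimes>\<^bsub>presented_group X R\<^esub> B \<otimes>\<^bsub>presented_group X R\<^esub> C
      = A \<otimes>\<^bsub>presented_group X R\<^esub> (B \<otimes>\<^bsub>presented_group X R\<^esub> C)"
    using u v w by (simp add: presented_group_mult)
next
  show "\<one>\<^bsub>presented_group X R\<^esub> \<in> carrier (presented_group X R)"
    by (simp add: presented_group_one presented_group_carrierI)
qed


section \<open>Artin groups\<close>

text \<open>Edges are two-element sets of vertices, so that the graph has neither loops nor multiple
  edges. The label of an edge \<open>e\<close> is \<open>m e\<close>; values of \<open>m\<close> outside \<open>E\<close> are irrelevant.\<close>

definition defining_graph :: "'v set \<Rightarrow> 'v set set \<Rightarrow> ('v set \<Rightarrow> nat) \<Rightarrow> bool" where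
  "defining_graph V E m \<longleftrightarrow>
    finite V \<and> (\<forall>e\<in>E. e \<subseteq> V \<and> card e = 2) \<and> (\<forall>e\<in>E. 2 \<le> m e)"

definition triangle_free :: "'v set set \<Rightarrow> bool" where
  "triangle_free E \<longleftrightarrow>
    \<not> (\<exists>a b c. a \<noteq> b \<and> b \<noteq> c \<and> a \<noteq> c \<and> {a, b} \<in> E \<and> {b, c} \<in> E \<and> {a, c} \<in> E)"

text \<open>The alternating word \<open>a b a \<dots>\<close> with \<open>n\<close> letters.\<close>

fun alt_word :: "'v \<Rightarrow> 'v \<Rightarrow> nat \<Rightarrow> 'v word" where
  "alt_word a b 0 = []"
| "alt_word a b (Suc n) = (a, True) # alt_word b a n"

definition artin_relations :: "'v set set \<Rightarrow> ('v set \<Rightarrow> nat) \<Rightarrow> ('v word \<times> 'v word) set" where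
  "artin_relations E m =
    {(alt_word a b (m {a, b}), alt_word b a (m {a, b})) | a b. {a, b} \<in> E}"

definition artin_group :: "'v set \<Rightarrow> 'v set set \<Rightarrow> ('v set \<Rightarrow> nat) \<Rightarrow> 'v word set monoid" where
  "artin_group V E m = presented_group V (artin_relations E m)"


section \<open>Virtually abelian groups and exponential growth\<close>

definition finite_generating_set :: "('a, 'b) monoid_scheme \<Rightarrow> 'a set \<Rightarrow> bool" where
  "finite_generating_set G S \<longleftrightarrow> finite S \<and> S \<subseteq> carrier G \<and> generate G S = carrier G"

definition finitely_generated :: "('a, 'b) monoid_scheme \<Rightarrow> bool" where
  "finitely_generated G \<longleftrightarrow> (\<exists>S. finite_generating_set G S)"

definition virtually_abelian :: "('a, 'b) monoid_scheme \<Rightarrow> bool" where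
  "virtually_abelian G \<longleftrightarrow>
    (\<exists>K. subgroup K G \<and> finite (rcosets\<^bsub>G\<^esub> K) \<and> comm_group (G\<lparr>carrier := K\<rparr>))"

text \<open>The Cayley graph is undirected: edges may be traversed in both directions, so the ball below
  consists of the products of at most \<open>n\<close> elements of \<open>S\<close> and their inverses.\<close>

definition cayley_edges :: "('a, 'b) monoid_scheme \<Rightarrow> 'a set \<Rightarrow> ('a \<times> 'a) set" where
  "cayley_edges G S =
    {(g, h). g \<in> carrier G \<and> h \<in> carrier G \<and>
      (\<exists>s\<in>S. h = g \<otimes>\<^bsub>G\<^esub> s \<or> g = h \<otimes>\<^bsub>G\<^esub> s)}"

definition cayley_ball :: "('a, 'b) monoid_scheme \<Rightarrow> 'a set \<Rightarrow> nat \<Rightarrow> 'a set" where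
  "cayley_ball G S n = {g. \<exists>k\<le>n. (\<one>\<^bsub>G\<^esub>, g) \<in> cayley_edges G S ^^ k}"

text \<open>The limit exists for every finite \<open>S\<close>, as the ball sizes are submultiplicative in the radius.\<close>

definition growth_rate :: "('a, 'b) monoid_scheme \<Rightarrow> 'a set \<Rightarrow> real" where
  "growth_rate G S = lim (\<lambda>n. root n (real (card (cayley_ball G S n))))"

text \<open>The infimum is over a nonempty set only if \<open>G\<close> is finitely generated.\<close>

definition min_growth_rate :: "('a, 'b) monoid_scheme \<Rightarrow> real" where
  "min_growth_rate G = (INF S\<in>{S. finite_generating_set G S}. growth_rate G S)"

definition uniform_exponential_growth :: "('a, 'b) monoid_scheme \<Rightarrow> bool" where
  "uniform_exponential_growth G \<longleftrightarrow> min_growth_rate G > 1"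

end

theory Submission
  imports Defs "HOL-Library.Product_Plus"
begin

text \<open>
  For a vertex \<open>v\<close>, the Artin group of a triangle-free graph is the amalgamated product of the groups of
  \<open>V - {v}\<close> and of the star of \<open>v\<close> over the free group on the link of \<open>v\<close>; the group of a star is the
  amalgamated product of dihedral Artin groups over the cyclic group of its center; and a dihedral
  Artin group is an amalgamated product of two abelian groups over a cyclic one. It therefore suffices
  to show that the following alternative passes to such products: every finite set \<open>S\<close> either
  generates a virtually abelian group or yields, within its ball of radius 600, two elements that
  freely generate a free semigroup. Let \<open>S\<close> act on the Bass-Serre tree. If it fixes a
  vertex, the alternative holds by induction. Otherwise a word of length at most 2 is hyperbolic, and
  if an element of \<open>S\<close> moves its axis, the hyperbolic element and its conjugate give a
  free semigroup. If the axis is preserved, the kernel of the action on it lies in a free group, in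
  which two short elements either give a free semigroup or force the kernel to be cyclic, so that the
  group is virtually abelian.
\<close>


section \<open>Groups, balls and free pairs\<close>

text \<open>The decomposition may be deep, but a finite set that fixes a vertex is handed on with
  the same radius, so constants do not multiply along the induction. The longest words arise in the
  line case and have length 14 * 6 = 84; 600 is the constant of the claim. The delicate point is
  that the edge groups of the vertex splitting are free groups of possibly large rank. The kernel on
  an axis lies in such a group but comes with no short generators, so a bounded test must decide it:
  one commutator and its conjugates by single generators. \<open>free_like\<close> collects what
  this test needs from free groups, and is itself obtained from the same tree theory, applied to
  Cayley trees. To have amalgams at all, the link of a vertex must span a free group on both sides.
  In the star this holds because the cyclic groups of the two generators of a dihedral Artin group
  meet trivially; on the other side it is an induction over vertex sets. Both rest on a faithful
  model of the amalgam, built from permutations of normal forms, in which the required injectivity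
  can be read off.\<close>

definition subgrp :: "'g::group_add set \<Rightarrow> bool" where
  "subgrp H \<longleftrightarrow> 0 \<in> H \<and> (\<forall>a\<in>H. \<forall>b\<in>H. a + b \<in> H) \<and> (\<forall>a\<in>H. - a \<in> H)"

definition wball :: "'g::group_add set \<Rightarrow> nat \<Rightarrow> 'g set" where
  "wball S n = {sum_list xs | xs. set xs \<subseteq> S \<union> uminus ` S \<and> length xs \<le> n}"

definition gspan :: "'g::group_add set \<Rightarrow> 'g set" where
  "gspan S = {sum_list xs | xs. set xs \<subseteq> S \<union> uminus ` S}"

definition comm :: "'g::group_add \<Rightarrow> 'g \<Rightarrow> bool" where
  "comm a b \<longleftrightarrow> a + b = b + a"

definition conjg :: "'g::group_add \<Rightarrow> 'g \<Rightarrow> 'g" where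
  "conjg x a = x + a - x"

text \<open>Finitely many translates of \<open>K\<close> cover \<open>H\<close>. The translating
  elements may lie outside \<open>H\<close> and may repeat cosets, which saves choosing a
  transversal.\<close>

definition virt_abelian :: "'g::group_add set \<Rightarrow> bool" where
  "virt_abelian H \<longleftrightarrow> (\<exists>K F. subgrp K \<and> K \<subseteq> H \<and> (\<forall>a\<in>K. \<forall>b\<in>K. comm a b) \<and>
     finite F \<and> (\<forall>h\<in>H. \<exists>k\<in>K. \<exists>x\<in>F. h = k + x))"

abbreviation word_val :: "'g::group_add \<Rightarrow> 'g \<Rightarrow> bool list \<Rightarrow> 'g" where
  "word_val a b w \<equiv> sum_list (map (\<lambda>c. if c then a else b) w)"

text \<open>Only positive words are compared, so this is a free monoid of rank two. That already
  gives \<open>2 ^ n\<close> distinct products of \<open>n\<close> factors.\<close>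

definition free_pair :: "'g::group_add \<Rightarrow> 'g \<Rightarrow> bool" where
  "free_pair a b \<longleftrightarrow> inj (word_val a b)"

definition short_free :: "'g::group_add set \<Rightarrow> nat \<Rightarrow> bool" where
  "short_free S n \<longleftrightarrow> (\<exists>u\<in>wball S n. \<exists>v\<in>wball S n. free_pair u v)"

text \<open>All finite subsets are quantified, not only generating sets. The property is therefore
  inherited by arbitrary subsets, in particular by stabilizers and by subgroups.\<close>

definition alternative :: "'g::group_add set \<Rightarrow> bool" where
  "alternative G \<longleftrightarrow> (\<forall>S. finite S \<and> S \<subseteq> G \<longrightarrow> virt_abelian (gspan S) \<or> short_free S 600)"

section \<open>Closure properties of subgroups, spans and balls\<close>

lemma subgrpI:
  "0 \<in> H \<Longrightarrow> (\<And>a b. a \<in> H \<Longrightarrow> b \<in> H \<Longrightarrow> a + b \<in> H) \<Longrightarrow> (\<And>a. a \<in> H \<Longrightarrow> - a \<in> H) \<Longrightarrow> subgrp H"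
  by (simp add: subgrp_def)

lemma subgrp_zero: "subgrp H \<Longrightarrow> 0 \<in> H"
  and subgrp_add: "subgrp H \<Longrightarrow> a \<in> H \<Longrightarrow> b \<in> H \<Longrightarrow> a + b \<in> H"
  and subgrp_minus: "subgrp H \<Longrightarrow> a \<in> H \<Longrightarrow> - a \<in> H"
  by (simp_all add: subgrp_def)

lemma subgrp_diff: "subgrp H \<Longrightarrow> a \<in> H \<Longrightarrow> b \<in> H \<Longrightarrow> a - b \<in> H"
  by (metis diff_conv_add_uminus subgrp_add subgrp_minus)

lemma subgrp_minus_iff: "subgrp H \<Longrightarrow> - a \<in> H \<longleftrightarrow> a \<in> H"
  by (metis minus_minus subgrp_minus)

lemma subgrp_add_left: "subgrp H \<Longrightarrow> a \<in> H \<Longrightarrow> a + b \<in> H \<longleftrightarrow> b \<in> H"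
  by (metis minus_add_cancel subgrp_add subgrp_minus)

lemma subgrp_add_right: "subgrp H \<Longrightarrow> b \<in> H \<Longrightarrow> a + b \<in> H \<longleftrightarrow> a \<in> H"
  by (metis add_diff_cancel subgrp_add subgrp_diff)

lemma subgrp_sum_list: "subgrp H \<Longrightarrow> set xs \<subseteq> H \<Longrightarrow> sum_list xs \<in> H"
  by (induction xs) (auto intro: subgrp_zero subgrp_add)

lemma uminus_sum_list: "- sum_list xs = sum_list (map uminus (rev (xs :: 'g::group_add list)))"
  by (induction xs) (auto simp: minus_add)

lemma set_map_uminus_rev:
  "set xs \<subseteq> S \<union> uminus ` S \<Longrightarrow> set (map uminus (rev (xs :: 'g::group_add list))) \<subseteq> S \<union> uminus ` S"
  by fastforce

lemma wball_add: "a \<in> wball S m \<Longrightarrow> b \<in> wball S n \<Longrightarrow> a + b \<in> wball S (m + n)"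
proof -
  assume "a \<in> wball S m" "b \<in> wball S n"
  then obtain xs ys where "a = sum_list xs" "set xs \<subseteq> S \<union> uminus ` S" "length xs \<le> m"
    "b = sum_list ys" "set ys \<subseteq> S \<union> uminus ` S" "length ys \<le> n"
    by (auto simp: wball_def)
  then show ?thesis unfolding wball_def
    by (intro CollectI exI[of _ "xs @ ys"]) auto
qed

lemma wball_minus: "a \<in> wball S m \<Longrightarrow> - a \<in> wball S m"
proof -
  assume "a \<in> wball S m"
  then obtain xs where "a = sum_list xs" "set xs \<subseteq> S \<union> uminus ` S" "length xs \<le> m"
    by (auto simp: wball_def)
  then show ?thesis unfolding wball_def
    by (intro CollectI exI[of _ "map uminus (rev xs)"]) (use set_map_uminus_rev in \<open>auto simp: uminus_sum_list\<close>)
qed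

lemma wball_diff: "a \<in> wball S m \<Longrightarrow> b \<in> wball S n \<Longrightarrow> a - b \<in> wball S (m + n)"
  by (metis diff_conv_add_uminus wball_add wball_minus)

lemma wball_mono: "m \<le> n \<Longrightarrow> wball S m \<subseteq> wball S n"
  by (fastforce simp: wball_def)

lemma wball_base: "s \<in> S \<Longrightarrow> s \<in> wball S 1"
  unfolding wball_def by (intro CollectI exI[of _ "[s]"]) auto

lemma wball_zero: "0 \<in> wball S n"
  unfolding wball_def by (intro CollectI exI[of _ "[]"]) auto

lemma gspan_eq: "gspan S = (\<Union>n. wball S n)"
  by (auto simp: gspan_def wball_def)

lemma wball_gspan: "wball S n \<subseteq> gspan S"
  by (auto simp: gspan_eq)

lemma gspan_base: "s \<in> S \<Longrightarrow> s \<in> gspan S"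
  using wball_base wball_gspan by blast

lemma subgrp_gspan: "subgrp (gspan S)"
proof (rule subgrpI)
  show "0 \<in> gspan S" using wball_zero wball_gspan by blast
  show "a + b \<in> gspan S" if "a \<in> gspan S" "b \<in> gspan S" for a b
    using that wball_add[of a S _ b] unfolding gspan_eq by blast
  show "- a \<in> gspan S" if "a \<in> gspan S" for a
    using that wball_minus unfolding gspan_eq by blast
qed

lemma gspan_least: "subgrp H \<Longrightarrow> S \<subseteq> H \<Longrightarrow> gspan S \<subseteq> H"
proof
  fix x assume H: "subgrp H" "S \<subseteq> H" and "x \<in> gspan S"
  then obtain xs where "x = sum_list xs" "set xs \<subseteq> S \<union> uminus ` S" by (auto simp: gspan_def)
  moreover have "S \<union> uminus ` S \<subseteq> H" using H by (auto intro: subgrp_minus)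
  ultimately show "x \<in> H" using H subgrp_sum_list by (metis subset_trans)
qed

lemma gspan_mono: "S \<subseteq> T \<Longrightarrow> gspan S \<subseteq> gspan T"
  by (meson gspan_base gspan_least subgrp_gspan subset_iff)

lemma gspan_subgrp: "subgrp H \<Longrightarrow> gspan H = H"
  using gspan_base gspan_least by blast

lemma gspan_right_induct [consumes 1, case_names zero add diff]:
  assumes "x \<in> gspan S" "P 0"
    "\<And>x s. x \<in> gspan S \<Longrightarrow> P x \<Longrightarrow> s \<in> S \<Longrightarrow> P (x + s)"
    "\<And>x s. x \<in> gspan S \<Longrightarrow> P x \<Longrightarrow> s \<in> S \<Longrightarrow> P (x - s)"
  shows "P x"
proof -
  obtain xs where "x = sum_list xs" and "set xs \<subseteq> S \<union> uminus ` S" using assms(1) by (auto simp: gspan_def)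
  moreover have "set xs \<subseteq> S \<union> uminus ` S \<Longrightarrow> sum_list xs \<in> gspan S \<and> P (sum_list xs)" for xs
  proof (induction xs rule: rev_induct)
    case Nil
    then show ?case using assms(2) subgrp_gspan subgrp_zero by auto
  next
    case (snoc y ys)
    then have ys: "sum_list ys \<in> gspan S" "P (sum_list ys)" by auto
    have "y \<in> S \<or> (\<exists>s\<in>S. y = - s)" using snoc.prems by auto
    moreover have "sum_list ys + y \<in> gspan S"
      using ys(1) calculation subgrp_add[OF subgrp_gspan, of "sum_list ys" S y] subgrp_minus[OF subgrp_gspan] gspan_base by blast
    moreover have "P (sum_list ys + y)"
      using calculation(1) assms(3)[OF ys, of y] assms(4)[OF ys] by (metis diff_conv_add_uminus)
    ultimately show ?case by simp
  qed
  ultimately show ?thesis by blast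
qed

lemma gspan_left_induct [consumes 1, case_names zero add minus]:
  assumes "x \<in> gspan S" "P 0"
    "\<And>x s. x \<in> gspan S \<Longrightarrow> P x \<Longrightarrow> s \<in> S \<Longrightarrow> P (s + x)"
    "\<And>x s. x \<in> gspan S \<Longrightarrow> P x \<Longrightarrow> s \<in> S \<Longrightarrow> P (- s + x)"
  shows "P x"
proof -
  obtain xs where "x = sum_list xs" and "set xs \<subseteq> S \<union> uminus ` S" using assms(1) by (auto simp: gspan_def)
  moreover have "set xs \<subseteq> S \<union> uminus ` S \<Longrightarrow> sum_list xs \<in> gspan S \<and> P (sum_list xs)" for xs
  proof (induction xs)
    case Nil
    then show ?case using assms(2) subgrp_gspan subgrp_zero by auto
  next
    case (Cons y ys)
    then have ys: "sum_list ys \<in> gspan S" "P (sum_list ys)" by auto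
    have "y \<in> S \<or> (\<exists>s\<in>S. y = - s)" using Cons.prems by auto
    moreover have "y + sum_list ys \<in> gspan S"
      using ys(1) calculation subgrp_add[OF subgrp_gspan, of y S "sum_list ys"] subgrp_minus[OF subgrp_gspan] gspan_base by blast
    moreover have "P (y + sum_list ys)"
      using calculation(1) assms(3)[OF ys, of y] assms(4)[OF ys] by metis
    ultimately show ?case by simp
  qed
  ultimately show ?thesis by blast
qed

lemma wball_wball:
  assumes "T \<subseteq> wball S m" shows "wball T n \<subseteq> wball S (m * n)"
proof -
  have "sum_list xs \<in> wball S (m * length xs)" if "set xs \<subseteq> T \<union> uminus ` T" for xs
    using that
  proof (induction xs)
    case (Cons x xs)
    then have "x \<in> wball S m" using assms wball_minus by auto
    then show ?case using Cons wball_add[of x S m "sum_list xs" "m * length xs"] by simp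
  qed (simp add: wball_zero)
  moreover have "wball S (m * k) \<subseteq> wball S (m * n)" if "k \<le> n" for k
    using that by (intro wball_mono) simp
  ultimately show ?thesis unfolding wball_def[of T] by blast
qed

lemma wball_finite: "finite S \<Longrightarrow> finite (wball S n)"
proof -
  assume "finite S"
  then have "finite (sum_list ` {xs. set xs \<subseteq> S \<union> uminus ` S \<and> length xs \<le> n})"
    by (intro finite_imageI finite_lists_length_le) auto
  moreover have "wball S n = sum_list ` {xs. set xs \<subseteq> S \<union> uminus ` S \<and> length xs \<le> n}"
    by (auto simp: wball_def)
  ultimately show ?thesis by simp
qed

lemma short_free_mono: "short_free S m \<Longrightarrow> m \<le> n \<Longrightarrow> short_free S n"
  unfolding short_free_def by (meson subsetD wball_mono)

lemma short_free_wball: "short_free T n \<Longrightarrow> T \<subseteq> wball S m \<Longrightarrow> short_free S (m * n)"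
  unfolding short_free_def by (meson subsetD wball_wball)

section \<open>Conjugation and commutation\<close>

lemmas group_norm = diff_conv_add_uminus add.assoc minus_add

lemma conjg_add: "conjg x (a + b) = conjg x a + conjg x b"
  by (simp add: conjg_def group_norm del: add_uminus_conv_diff)
lemma conjg_minus: "conjg x (- a) = - conjg x a"
  by (simp add: conjg_def group_norm del: add_uminus_conv_diff)
lemma conjg_inj [simp]: "conjg x a = conjg x b \<longleftrightarrow> a = b"
  by (simp add: conjg_def group_norm del: add_uminus_conv_diff)
lemma conjg_conjg: "conjg x (conjg y a) = conjg (x + y) a"
  by (simp add: conjg_def group_norm del: add_uminus_conv_diff)
lemma conjg_zero [simp]: "conjg 0 a = a" "conjg x 0 = 0" by (simp_all add: conjg_def)
lemma conjg_cancel [simp]: "conjg (- x) (conjg x a) = a" "conjg x (conjg (- x) a) = a"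
  by (simp_all add: conjg_conjg)

lemma comm_sym: "comm a b \<longleftrightarrow> comm b a" by (auto simp: comm_def)
lemma comm_refl [simp]: "comm a a" by (simp add: comm_def)
lemma comm_zero [simp]: "comm a 0" "comm 0 a" by (simp_all add: comm_def)

lemma comm_iff_conj: "comm a b \<longleftrightarrow> conjg a b = b"
  by (simp add: comm_def conjg_def diff_eq_eq)

lemma comm_add: "comm a x \<Longrightarrow> comm b x \<Longrightarrow> comm (a + b) x"
  unfolding comm_iff_conj by (metis conjg_conjg)
lemma comm_minus: "comm a x \<Longrightarrow> comm (- a) x"
  unfolding comm_iff_conj by (metis conjg_cancel(1))
lemma comm_minus_iff [simp]: "comm (- a) x \<longleftrightarrow> comm a x"
  by (metis comm_minus minus_minus)
lemma comm_diff: "comm a x \<Longrightarrow> comm b x \<Longrightarrow> comm (a - b) x"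
  by (metis comm_add comm_minus diff_conv_add_uminus)

lemma comm_conj: "comm a b \<Longrightarrow> comm (conjg h a) (conjg h b)"
  unfolding comm_def by (simp flip: conjg_add)

lemma comm_conj_iff: "comm (conjg h a) (conjg h b) \<longleftrightarrow> comm a b"
  using comm_conj[of a b h] comm_conj[of "conjg h a" "conjg h b" "- h"] by auto

lemma comm_gspan: "(\<And>s. s \<in> S \<Longrightarrow> comm s x) \<Longrightarrow> h \<in> gspan S \<Longrightarrow> comm h x"
  by (rule gspan_right_induct[of h S]) (auto intro: comm_add comm_diff)

lemma gspan_comm:
  assumes "\<And>s t. s \<in> S \<Longrightarrow> t \<in> S \<Longrightarrow> comm s t" "a \<in> gspan S" "b \<in> gspan S"
  shows "comm a b"
  by (meson assms comm_gspan comm_sym)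

lemma virt_abelian_abelian:
  assumes "subgrp H" "\<And>a b. a \<in> H \<Longrightarrow> b \<in> H \<Longrightarrow> comm a b"
  shows "virt_abelian H"
  unfolding virt_abelian_def
proof (intro exI conjI)
  show "subgrp H" by fact
  show "\<forall>h\<in>H. \<exists>k\<in>H. \<exists>x\<in>{0}. h = k + x" by simp
qed (use assms(2) in simp_all)

lemma alternative_mono: "alternative G \<Longrightarrow> H \<subseteq> G \<Longrightarrow> alternative H"
  by (auto simp: alternative_def)

lemma alternative_abelian:
  assumes "subgrp G" "\<And>a b. a \<in> G \<Longrightarrow> b \<in> G \<Longrightarrow> comm a b"
  shows "alternative G"
  unfolding alternative_def
  using assms virt_abelian_abelian[OF subgrp_gspan] gspan_least by (metis subsetD)

lemma sum_list_hom:
  assumes "\<And>a b. \<phi> (a + b) = \<phi> a + \<phi> (b :: 'g::group_add)" 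
  shows "\<phi> (sum_list xs) = (sum_list (map \<phi> xs) :: 'h::group_add)"
proof -
  have "\<phi> 0 = 0" using assms[of 0 0] by (metis add_0_right add_left_imp_eq)
  then show ?thesis by (induction xs) (auto simp: assms)
qed


lemma gspan_conjg: "gspan (conjg x ` S) = conjg x ` gspan S"
proof -
  have *: "gspan (conjg x ` S) \<subseteq> conjg x ` gspan S" for x and S :: "'a set"
  proof (rule gspan_least)
    show "subgrp (conjg x ` gspan S)"
    proof (rule subgrpI)
      show "0 \<in> conjg x ` gspan S" using subgrp_zero[OF subgrp_gspan]
        by (metis conjg_zero(2) image_eqI)
      show "a + b \<in> conjg x ` gspan S" if "a \<in> conjg x ` gspan S" "b \<in> conjg x ` gspan S" for a b
        using that by (auto simp flip: conjg_add intro!: imageI subgrp_add[OF subgrp_gspan])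
      show "- a \<in> conjg x ` gspan S" if "a \<in> conjg x ` gspan S" for a
        using that by (auto simp flip: conjg_minus intro!: imageI subgrp_minus[OF subgrp_gspan])
    qed
    show "conjg x ` S \<subseteq> conjg x ` gspan S" using gspan_base by blast
  qed
  have "conjg (- x) ` conjg x ` S = S" by (simp add: image_image)
  then have "gspan S \<subseteq> conjg (- x) ` gspan (conjg x ` S)" using *[of "- x" "conjg x ` S"] by simp
  then have "conjg x ` gspan S \<subseteq> conjg x ` conjg (- x) ` gspan (conjg x ` S)" by (rule image_mono)
  then have "conjg x ` gspan S \<subseteq> gspan (conjg x ` S)" by (simp add: image_image)
  then show ?thesis using * by blast
qed

lemma wball_conjg: "a \<in> wball S n \<Longrightarrow> conjg x a \<in> wball (conjg x ` S) n"
proof -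
  assume "a \<in> wball S n"
  then obtain xs where xs: "a = sum_list xs" "set xs \<subseteq> S \<union> uminus ` S" "length xs \<le> n"
    by (auto simp: wball_def)
  have "conjg x a = sum_list (map (conjg x) xs)" unfolding xs(1)
    by (rule sum_list_hom[of "conjg x"]) (rule conjg_add)
  moreover have "set (map (conjg x) xs) \<subseteq> conjg x ` S \<union> uminus ` conjg x ` S"
    using xs(2) conjg_minus[of x] by fastforce
  ultimately show ?thesis unfolding wball_def using xs(3)
    by (intro CollectI exI[of _ "map (conjg x) xs"]) auto
qed

lemma free_pair_conjg: "free_pair a b \<Longrightarrow> free_pair (conjg x a) (conjg x b)"
proof -
  assume f: "free_pair a b"
  have "word_val (conjg x a) (conjg x b) w = conjg x (word_val a b w)" for w
  proof -
    have "conjg x (word_val a b w) = sum_list (map (conjg x) (map (\<lambda>c. if c then a else b) w))"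
      by (rule sum_list_hom[of "conjg x"]) (rule conjg_add)
    also have "map (conjg x) (map (\<lambda>c. if c then a else b) w) = map (\<lambda>c. if c then conjg x a else conjg x b) w"
      by (simp add: if_distrib cong: if_cong)
    finally show ?thesis by simp
  qed
  then show ?thesis using f unfolding free_pair_def inj_def by (simp add: conjg_inj)
qed

lemma short_free_conjg: "short_free S n \<Longrightarrow> short_free (conjg x ` S) n"
  unfolding short_free_def using wball_conjg free_pair_conjg by blast

lemma virt_abelian_conjg: "virt_abelian H \<Longrightarrow> virt_abelian (conjg x ` H)"
proof -
  assume "virt_abelian H"
  then obtain K F where K: "subgrp K" "K \<subseteq> H" "\<And>a b. a \<in> K \<Longrightarrow> b \<in> K \<Longrightarrow> comm a b" 
    and F: "finite F" "\<And>h. h \<in> H \<Longrightarrow> \<exists>k\<in>K. \<exists>y\<in>F. h = k + y"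
    unfolding virt_abelian_def by metis
  have "subgrp (conjg x ` K)" using gspan_conjg[of x K] gspan_subgrp[OF K(1)] subgrp_gspan by metis
  moreover have "comm a b" if "a \<in> conjg x ` K" "b \<in> conjg x ` K" for a b
    using that K(3) comm_conj by blast
  moreover have "\<exists>k\<in>conjg x ` K. \<exists>y\<in>conjg x ` F. h = k + y" if "h \<in> conjg x ` H" for h
    using that F(2) conjg_add[of x] by fast
  ultimately show ?thesis unfolding virt_abelian_def
    using K(2) F(1) by (intro exI[of _ "conjg x ` K"] exI[of _ "conjg x ` F"]) auto
qed

text \<open>Vertex stabilizers in the tree are conjugates of the factors. Conjugation carries balls
  to balls of the same radius, so the constant survives.\<close>

lemma alternative_conjg:
  assumes "alternative G" shows "alternative (conjg x ` G)"
  unfolding alternative_def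
proof (intro allI impI)
  fix S assume S: "finite S \<and> S \<subseteq> conjg x ` G"
  then have "conjg (- x) ` S \<subseteq> conjg (- x) ` conjg x ` G" by blast
  then have "conjg (- x) ` S \<subseteq> G" by (simp add: image_image)
  then have "virt_abelian (gspan (conjg (- x) ` S)) \<or> short_free (conjg (- x) ` S) 600"
    using assms S unfolding alternative_def by blast
  moreover have "conjg x ` conjg (- x) ` S = S" "conjg x ` conjg (- x) ` gspan S = gspan S" 
    by (simp_all add: image_image)
  ultimately show "virt_abelian (gspan S) \<or> short_free S 600"
    using virt_abelian_conjg[of "gspan (conjg (- x) ` S)" x] short_free_conjg[of "conjg (- x) ` S" 600 x]
    unfolding gspan_conjg by metis
qed

text \<open>The facts about a subgroup of a free group that are used for edge groups.\<close>

definition free_like :: "'g::group_add set \<Rightarrow> bool" where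
  "free_like C \<longleftrightarrow>
    (\<forall>a\<in>C. \<forall>b\<in>C. comm a b \<or> short_free {a, b} 6) \<and>
    (\<forall>c\<in>C. \<forall>k\<in>C. c \<noteq> 0 \<and> comm (conjg k c) c \<longrightarrow> comm k c) \<and>
    (\<forall>c\<in>C. \<forall>a\<in>C. \<forall>b\<in>C. c \<noteq> 0 \<and> comm a c \<and> comm b c \<longrightarrow> comm a b) \<and>
    (\<forall>K. subgrp K \<and> K \<subseteq> C \<and> (\<forall>a\<in>K. \<forall>b\<in>K. comm a b) \<longrightarrow>
      (\<exists>\<tau> :: 'g \<Rightarrow> int. inj_on \<tau> K \<and> (\<forall>a\<in>K. \<forall>b\<in>K. \<tau> (a + b) = \<tau> a + \<tau> b)))"

text \<open>The case of a cyclic edge group: once everything commutes, only the embedding into the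
  integers has content.\<close>

lemma free_like_abelian:
  fixes \<tau> :: "'g::group_add \<Rightarrow> int"
  assumes "\<And>a b. a \<in> C \<Longrightarrow> b \<in> C \<Longrightarrow> comm a b" "inj_on \<tau> C"
    "\<And>a b. a \<in> C \<Longrightarrow> b \<in> C \<Longrightarrow> \<tau> (a + b) = \<tau> a + \<tau> b"
  shows "free_like C"
  unfolding free_like_def
proof (intro conjI)
  show "\<forall>K. subgrp K \<and> K \<subseteq> C \<and> (\<forall>a\<in>K. \<forall>b\<in>K. comm a b) \<longrightarrow>
      (\<exists>\<tau> :: 'g \<Rightarrow> int. inj_on \<tau> K \<and> (\<forall>a\<in>K. \<forall>b\<in>K. \<tau> (a + b) = \<tau> a + \<tau> b))"
    using assms(2,3) by (meson inj_on_subset subset_iff)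
next
  show "\<forall>a\<in>C. \<forall>b\<in>C. comm a b \<or> short_free {a, b} 6" using assms(1) by simp
  show "\<forall>c\<in>C. \<forall>k\<in>C. c \<noteq> 0 \<and> comm (conjg k c) c \<longrightarrow> comm k c" using assms(1) by simp
  show "\<forall>c\<in>C. \<forall>a\<in>C. \<forall>b\<in>C. c \<noteq> 0 \<and> comm a c \<and> comm b c \<longrightarrow> comm a b" using assms(1) by simp
qed

lemma free_like_short: "free_like C \<Longrightarrow> a \<in> C \<Longrightarrow> b \<in> C \<Longrightarrow> comm a b \<or> short_free {a, b} 6"
  by (drule free_like_def[THEN iffD1, THEN conjunct1]) blast
lemma free_like_malnormal:
  "free_like C \<Longrightarrow> c \<in> C \<Longrightarrow> k \<in> C \<Longrightarrow> c \<noteq> 0 \<Longrightarrow> comm (conjg k c) c \<Longrightarrow> comm k c"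
  by (drule free_like_def[THEN iffD1, THEN conjunct2, THEN conjunct1]) blast
lemma free_like_trans:
  "free_like C \<Longrightarrow> c \<in> C \<Longrightarrow> a \<in> C \<Longrightarrow> b \<in> C \<Longrightarrow> c \<noteq> 0 \<Longrightarrow> comm a c \<Longrightarrow> comm b c \<Longrightarrow> comm a b"
  by (drule free_like_def[THEN iffD1, THEN conjunct2, THEN conjunct2, THEN conjunct1]) blast
lemma free_like_embed:
  assumes "free_like (C :: 'g::group_add set)" "subgrp K" "K \<subseteq> C" "\<And>a b. a \<in> K \<Longrightarrow> b \<in> K \<Longrightarrow> comm a b"
  obtains \<tau> :: "'g::group_add \<Rightarrow> int" where "inj_on \<tau> K" "\<And>a b. a \<in> K \<Longrightarrow> b \<in> K \<Longrightarrow> \<tau> (a + b) = \<tau> a + \<tau> b"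
proof -
  have "\<exists>\<tau> :: 'g \<Rightarrow> int. inj_on \<tau> K \<and> (\<forall>a\<in>K. \<forall>b\<in>K. \<tau> (a + b) = \<tau> a + \<tau> b)"
    using assms(1)[unfolded free_like_def, THEN conjunct2, THEN conjunct2, THEN conjunct2, rule_format, of K]
      assms(2-4) by simp
  then show ?thesis using that by blast
qed

text \<open>The stabilizer of a translated edge is a conjugate of the edge group.\<close>

lemma free_like_conjg:
  fixes C :: "'g::group_add set"
  assumes "free_like C" shows "free_like (conjg x ` C)"
  unfolding free_like_def
proof (intro conjI)
  show "\<forall>a\<in>conjg x ` C. \<forall>b\<in>conjg x ` C. comm a b \<or> short_free {a, b} 6"
  proof (intro ballI)
    fix a b assume "a \<in> conjg x ` C" "b \<in> conjg x ` C"
    then obtain a' b' where ab: "a' \<in> C" "b' \<in> C" "a = conjg x a'" "b = conjg x b'" by blast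
    then have "comm a' b' \<or> short_free {a', b'} 6" using free_like_short[OF assms] by blast
    then show "comm a b \<or> short_free {a, b} 6"
      using ab comm_conj[of a' b' x] short_free_conjg[of "{a', b'}" 6 x] by auto
  qed
  show "\<forall>c\<in>conjg x ` C. \<forall>k\<in>conjg x ` C. c \<noteq> 0 \<and> comm (conjg k c) c \<longrightarrow> comm k c"
  proof (intro ballI impI)
    fix c k assume "c \<in> conjg x ` C" "k \<in> conjg x ` C" and c: "c \<noteq> 0 \<and> comm (conjg k c) c"
    then obtain c' k' where ab: "c' \<in> C" "k' \<in> C" "c = conjg x c'" "k = conjg x k'" by blast
    moreover have "conjg k c = conjg x (conjg k' c')" 
      using ab by (simp add: conjg_def group_norm del: add_uminus_conv_diff)
    ultimately have "comm (conjg k' c') c'" using c comm_conj_iff by metis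
    moreover have "c' \<noteq> 0" using c ab by auto
    ultimately have "comm k' c'" using free_like_malnormal[OF assms] ab by blast
    then show "comm k c" using ab comm_conj by blast
  qed
  show "\<forall>c\<in>conjg x ` C. \<forall>a\<in>conjg x ` C. \<forall>b\<in>conjg x ` C. c \<noteq> 0 \<and> comm a c \<and> comm b c \<longrightarrow> comm a b"
  proof (intro ballI impI)
    fix c a b assume "c \<in> conjg x ` C" "a \<in> conjg x ` C" "b \<in> conjg x ` C" and c: "c \<noteq> 0 \<and> comm a c \<and> comm b c"
    then obtain c' a' b' where ab: "c' \<in> C" "a' \<in> C" "b' \<in> C" "c = conjg x c'" "a = conjg x a'" "b = conjg x b'" by blast
    then have "comm a' c'" "comm b' c'" using c comm_conj_iff[of x] by auto
    moreover have "c' \<noteq> 0" using c ab by auto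
    ultimately have "comm a' b'" using free_like_trans[OF assms] \<open>comm a' c'\<close> ab by blast
    then show "comm a b" using ab comm_conj by blast
  qed
  show "\<forall>K. subgrp K \<and> K \<subseteq> conjg x ` C \<and> (\<forall>a\<in>K. \<forall>b\<in>K. comm a b) \<longrightarrow>
      (\<exists>\<tau> :: 'g \<Rightarrow> int. inj_on \<tau> K \<and> (\<forall>a\<in>K. \<forall>b\<in>K. \<tau> (a + b) = \<tau> a + \<tau> b))"
  proof (intro allI impI)
    fix K assume K: "subgrp K \<and> K \<subseteq> conjg x ` C \<and> (\<forall>a\<in>K. \<forall>b\<in>K. comm a b)"
    let ?K = "conjg (- x) ` K"
    have "subgrp ?K" using K gspan_conjg[of "- x" K] gspan_subgrp[of K] subgrp_gspan by metis
    moreover have "?K \<subseteq> C" using K by fastforce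
    moreover have "\<And>a b. a \<in> ?K \<Longrightarrow> b \<in> ?K \<Longrightarrow> comm a b" using K comm_conj by blast
    ultimately obtain \<tau> :: "'g \<Rightarrow> int" where \<tau>: "inj_on \<tau> ?K" "\<And>a b. a \<in> ?K \<Longrightarrow> b \<in> ?K \<Longrightarrow> \<tau> (a + b) = \<tau> a + \<tau> b"
      using free_like_embed[OF assms, of ?K] by metis
    have "inj_on (\<tau> \<circ> conjg (- x)) K" using \<tau>(1) 
      by (auto simp: inj_on_def)
    moreover have "\<forall>a\<in>K. \<forall>b\<in>K. (\<tau> \<circ> conjg (- x)) (a + b) = (\<tau> \<circ> conjg (- x)) a + (\<tau> \<circ> conjg (- x)) b"
      using \<tau>(2) conjg_add[of "- x"] by simp
    ultimately show "\<exists>\<tau> :: 'g \<Rightarrow> int. inj_on \<tau> K \<and> (\<forall>a\<in>K. \<forall>b\<in>K. \<tau> (a + b) = \<tau> a + \<tau> b)" by blast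
  qed
qed

section \<open>Trees and their isometries\<close>

text \<open>The vertex set of a simplicial tree with its path metric. \<open>four\<close> is the
  four-point condition of 0-hyperbolicity. \<open>perimeter\<close> excludes odd cycles such as a
  triangle with unit sides, which satisfies the other conditions, and makes medians
  vertices.\<close>

locale metric_tree =
  fixes X :: "'x set" and d :: "'x \<Rightarrow> 'x \<Rightarrow> int"
  assumes d_refl: "x \<in> X \<Longrightarrow> d x x = 0"
    and d_nonneg: "x \<in> X \<Longrightarrow> y \<in> X \<Longrightarrow> 0 \<le> d x y"
    and d_eq: "x \<in> X \<Longrightarrow> y \<in> X \<Longrightarrow> d x y = 0 \<Longrightarrow> x = y"
    and d_sym: "x \<in> X \<Longrightarrow> y \<in> X \<Longrightarrow> d x y = d y x"
    and four: "x \<in> X \<Longrightarrow> y \<in> X \<Longrightarrow> z \<in> X \<Longrightarrow> w \<in> X \<Longrightarrow>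
      d x y + d z w \<le> max (d x z + d y w) (d x w + d y z)"
    and perimeter: "x \<in> X \<Longrightarrow> y \<in> X \<Longrightarrow> z \<in> X \<Longrightarrow> even (d x y + d y z + d x z)"
    and geod: "x \<in> X \<Longrightarrow> y \<in> X \<Longrightarrow> 0 \<le> k \<Longrightarrow> k \<le> d x y \<Longrightarrow>
      \<exists>z\<in>X. d x z = k \<and> d z y = d x y - k"
begin

definition btw :: "'x \<Rightarrow> 'x \<Rightarrow> 'x \<Rightarrow> bool" where
  "btw x y z \<longleftrightarrow> d x z = d x y + d y z"

text \<open>Twice the Gromov product of \<open>x\<close> and \<open>y\<close> based at \<open>p\<close>.\<close>

definition gp :: "'x \<Rightarrow> 'x \<Rightarrow> 'x \<Rightarrow> int" where
  "gp p x y = d x p + d p y - d x y"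

text \<open>The four-point condition with two coinciding points.\<close>

lemma tri: "x \<in> X \<Longrightarrow> y \<in> X \<Longrightarrow> z \<in> X \<Longrightarrow> d x z \<le> d x y + d y z"
  using four[of x z y y] d_refl[of y] d_sym[of z y] by linarith

lemma d_pos: "x \<in> X \<Longrightarrow> y \<in> X \<Longrightarrow> x \<noteq> y \<Longrightarrow> 0 < d x y"
  using d_nonneg d_eq by (metis order_le_less)

lemma gp_nonneg: "p \<in> X \<Longrightarrow> x \<in> X \<Longrightarrow> y \<in> X \<Longrightarrow> 0 \<le> gp p x y"
  using tri[of x p y] by (simp add: gp_def)

lemma gp_even: "p \<in> X \<Longrightarrow> x \<in> X \<Longrightarrow> y \<in> X \<Longrightarrow> even (gp p x y)"
  using perimeter[of x p y] unfolding gp_def by presburger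

lemma gp_sym: "p \<in> X \<Longrightarrow> x \<in> X \<Longrightarrow> y \<in> X \<Longrightarrow> gp p x y = gp p y x"
  using d_sym unfolding gp_def by (metis add.commute)

lemma gp_le: "p \<in> X \<Longrightarrow> x \<in> X \<Longrightarrow> y \<in> X \<Longrightarrow> gp p x y \<le> 2 * d p x"
  using tri[of p x y] d_sym[of x p] by (simp add: gp_def)

lemma gp_ultra:
  "p \<in> X \<Longrightarrow> x \<in> X \<Longrightarrow> y \<in> X \<Longrightarrow> z \<in> X \<Longrightarrow> min (gp p x y) (gp p y z) \<le> gp p x z"
  using four[of x z y p] d_sym[of x p] d_sym[of y p] d_sym[of z p] d_sym[of z y] unfolding gp_def by linarith

text \<open>\<open>0 < gp p x y\<close> means that \<open>x\<close> and \<open>y\<close> lie in the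
  same direction from \<open>p\<close>. The directions at \<open>p\<close> are thus the classes of a
  transitive relation; arguments about branches are carried out in this form.\<close>

lemma gp_pos_trans:
  "p \<in> X \<Longrightarrow> x \<in> X \<Longrightarrow> y \<in> X \<Longrightarrow> z \<in> X \<Longrightarrow> 0 < gp p x y \<Longrightarrow> 0 < gp p y z \<Longrightarrow> 0 < gp p x z"
  using gp_ultra[of p x y z] by linarith

lemma btw_gp: "btw x p y \<longleftrightarrow> gp p x y = 0"
  by (auto simp: btw_def gp_def)

lemma not_btw_gp: "p \<in> X \<Longrightarrow> x \<in> X \<Longrightarrow> y \<in> X \<Longrightarrow> \<not> btw x p y \<longleftrightarrow> 0 < gp p x y"
  using gp_nonneg[of p x y] by (auto simp: btw_gp)

lemma btw_sym: "x \<in> X \<Longrightarrow> y \<in> X \<Longrightarrow> z \<in> X \<Longrightarrow> btw x y z \<longleftrightarrow> btw z y x"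
  using d_sym by (auto simp: btw_def)

lemma btw_refl: "x \<in> X \<Longrightarrow> y \<in> X \<Longrightarrow> btw x x y \<and> btw x y y"
  by (simp add: btw_def d_refl)

text \<open>Local geodesics are global: two geodesics that overlap in the nondegenerate segment from
  \<open>b\<close> to \<open>c\<close> join to one. With \<open>b = c\<close> the two betweenness
  hypotheses would say nothing.\<close>

lemma chain:
  assumes "a \<in> X" "b \<in> X" "c \<in> X" "e \<in> X" "btw a b c" "btw b c e" "b \<noteq> c"
  shows "btw a b e" "btw a c e"
  using assms(5,6) four[OF assms(1,3,2,4)] d_pos[OF assms(2,3,7)] tri[OF assms(1,3,4)] tri[OF assms(2,3,4)]
    d_sym[OF assms(2,3)] tri[OF assms(1,2,4)]
  unfolding btw_def by linarith+

lemma btw_unique: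
  assumes "x \<in> X" "y \<in> X" "u \<in> X" "v \<in> X" "btw x u y" "btw x v y" "d x u = d x v"
  shows "u = v"
  using assms(5-7) four[OF assms(3,4,1,2)] d_eq[OF assms(3,4)] d_nonneg[OF assms(3,4)] d_sym[OF assms(1,3)] d_sym[OF assms(1,4)]
  unfolding btw_def by linarith

lemma btw_exists:
  assumes "x \<in> X" "y \<in> X" "0 \<le> k" "k \<le> d x y"
  obtains z where "z \<in> X" "btw x z y" "d x z = k"
  using geod[OF assms] by (auto simp: btw_def)

text \<open>The center of the tripod is sought on the side from \<open>x\<close> to
  \<open>y\<close>, at the distance from \<open>x\<close> given by the Gromov product.\<close>

lemma median:
  assumes X: "x \<in> X" "y \<in> X" "z \<in> X"
  obtains m where "m \<in> X" "btw x m y" "btw y m z" "btw x m z"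
proof -
  have e: "even (gp x y z)" "0 \<le> gp x y z" "gp x y z \<le> 2 * d x y"
    using X gp_even gp_nonneg gp_le by auto
  \<comment> \<open>Parity makes this division exact.\<close>
  have "0 \<le> gp x y z div 2" "gp x y z div 2 \<le> d x y" using e by linarith+
  then obtain m where m: "m \<in> X" "btw x m y" "d x m = gp x y z div 2"
    using btw_exists[OF X(1,2)] by blast
  then have 2: "2 * d x m = d x y + d x z - d y z" using e(1) d_sym[OF X(1,2)] by (simp add: gp_def)
  have "d m z \<le> d x z - d x m" "d m z \<le> d y z - d y m"
    using four[OF m(1) X(3) X(1,2)] 2 m(2) d_sym[OF X(1) m(1)] d_sym[OF X(2) m(1)] d_sym[OF X(1,3)] d_sym[OF X(2,3)] 
      d_sym[OF X(1,2)] unfolding btw_def by linarith+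
  then have "btw x m z" "btw y m z"
    using tri[OF X(1) m(1) X(3)] tri[OF X(2) m(1) X(3)] unfolding btw_def by linarith+
  then show ?thesis using that m by blast
qed

definition cvx :: "'x set \<Rightarrow> bool" where
  "cvx F \<longleftrightarrow> F \<subseteq> X \<and> (\<forall>x\<in>F. \<forall>y\<in>F. \<forall>z\<in>X. btw x z y \<longrightarrow> z \<in> F)"

lemma cvx_inter: "cvx F \<Longrightarrow> cvx F' \<Longrightarrow> cvx (F \<inter> F')"
  unfolding cvx_def by (metis Int_iff inf.coboundedI1)

text \<open>Pick one point in each pairwise intersection. Each of the three sets contains two of
  these points, hence also their median.\<close>

lemma helly3:
  assumes "cvx A" "cvx B" "cvx C" "A \<inter> B \<noteq> {}" "B \<inter> C \<noteq> {}" "A \<inter> C \<noteq> {}"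
  shows "A \<inter> B \<inter> C \<noteq> {}"
proof -
  obtain x y z where 1: "x \<in> A" "x \<in> B" "y \<in> B" "y \<in> C" "z \<in> A" "z \<in> C" using assms by blast
  then have X: "x \<in> X" "y \<in> X" "z \<in> X" using assms unfolding cvx_def by blast+
  obtain m where "m \<in> X" "btw x m y" "btw y m z" "btw x m z" using median[OF X] .
  then have "m \<in> A" "m \<in> B" "m \<in> C" using assms(1-3) 1 unfolding cvx_def by blast+
  then show ?thesis by blast
qed

text \<open>The additional set \<open>B\<close> absorbs the sets \<open>F i\<close> one at a time;
  \<open>helly3\<close> guarantees that the shrunken \<open>B\<close> still meets the remaining
  ones.\<close>

lemma helly_aux:
  assumes "finite I"
  shows "cvx B \<Longrightarrow> B \<noteq> {} \<Longrightarrow> (\<And>i. i \<in> I \<Longrightarrow> cvx (F i) \<and> B \<inter> F i \<noteq> {}) \<Longrightarrow>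
    (\<And>i j. i \<in> I \<Longrightarrow> j \<in> I \<Longrightarrow> F i \<inter> F j \<noteq> {}) \<Longrightarrow> \<exists>x\<in>B. \<forall>i\<in>I. x \<in> F i"
  using assms
proof (induction I arbitrary: B rule: finite_induct)
  case (insert i I)
  have i: "cvx (F i)" "B \<inter> F i \<noteq> {}" using insert.prems(3)[of i] by auto
  have "\<exists>x\<in>B \<inter> F i. \<forall>i\<in>I. x \<in> F i"
  proof (rule insert.IH)
    show "cvx (B \<inter> F i)" using i insert.prems(1) cvx_inter by blast
    show "B \<inter> F i \<noteq> {}" by fact
    show "cvx (F j) \<and> B \<inter> F i \<inter> F j \<noteq> {}" if "j \<in> I" for j
      using helly3[OF insert.prems(1) i(1), of "F j"] insert.prems(3)[of j] insert.prems(4)[of i j] i(2) that by auto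
    show "F j \<inter> F k \<noteq> {}" if "j \<in> I" "k \<in> I" for j k using insert.prems(4)[of j k] that by auto
  qed
  then show ?case by auto
qed auto

lemma helly:
  assumes "finite I" "I \<noteq> {}" "\<And>i. i \<in> I \<Longrightarrow> cvx (F i)" "\<And>i j. i \<in> I \<Longrightarrow> j \<in> I \<Longrightarrow> F i \<inter> F j \<noteq> {}"
  shows "\<exists>x\<in>X. \<forall>i\<in>I. x \<in> F i"
proof -
  obtain i where i: "i \<in> I" using assms(2) by blast
  have "\<exists>x\<in>F i. \<forall>i\<in>I. x \<in> F i"
    using helly_aux[OF assms(1) assms(3)[OF i], of F] assms(3) assms(4)[of i] assms(4) i by blast
  then show ?thesis using assms(3)[OF i] unfolding cvx_def by blast
qed

end

section \<open>Isometric actions, fixed points and hyperbolic elements\<close>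

locale tree_action = metric_tree X d for X :: "'x set" and d +
  fixes G :: "'g::group_add set" and act :: "'g \<Rightarrow> 'x \<Rightarrow> 'x"
  assumes subG: "subgrp G"
    and act_in [simp]: "g \<in> G \<Longrightarrow> x \<in> X \<Longrightarrow> act g x \<in> X"
    and act_add: "g \<in> G \<Longrightarrow> h \<in> G \<Longrightarrow> x \<in> X \<Longrightarrow> act (g + h) x = act g (act h x)"
    and act_zero [simp]: "x \<in> X \<Longrightarrow> act 0 x = x"
    and act_d [simp]: "g \<in> G \<Longrightarrow> x \<in> X \<Longrightarrow> y \<in> X \<Longrightarrow> d (act g x) (act g y) = d x y"
begin

lemma G_simps [simp]: "0 \<in> G" "g \<in> G \<Longrightarrow> h \<in> G \<Longrightarrow> g + h \<in> G" "- g \<in> G \<longleftrightarrow> g \<in> G"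
  "g \<in> G \<Longrightarrow> h \<in> G \<Longrightarrow> g - h \<in> G" "g \<in> G \<Longrightarrow> h \<in> G \<Longrightarrow> conjg g h \<in> G"
  using subG by (auto simp: subgrp_zero subgrp_add subgrp_minus_iff subgrp_diff conjg_def)

lemma act_minus [simp]: "g \<in> G \<Longrightarrow> x \<in> X \<Longrightarrow> act (- g) (act g x) = x"
  "g \<in> G \<Longrightarrow> x \<in> X \<Longrightarrow> act g (act (- g) x) = x"
  using act_add[of "- g" g x] act_add[of g "- g" x] by auto

lemma act_diff: "g \<in> G \<Longrightarrow> h \<in> G \<Longrightarrow> x \<in> X \<Longrightarrow> act (g - h) x = act g (act (- h) x)"
  using act_add[of g "- h" x] by simp

lemma act_inj [simp]: "g \<in> G \<Longrightarrow> x \<in> X \<Longrightarrow> y \<in> X \<Longrightarrow> act g x = act g y \<longleftrightarrow> x = y"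
  by (metis act_minus(1))

lemma d_act_left: "g \<in> G \<Longrightarrow> x \<in> X \<Longrightarrow> y \<in> X \<Longrightarrow> d (act g x) y = d x (act (- g) y)"
  using act_d[of g x "act (- g) y"] by simp

lemma btw_act [simp]: "g \<in> G \<Longrightarrow> x \<in> X \<Longrightarrow> y \<in> X \<Longrightarrow> z \<in> X \<Longrightarrow> btw (act g x) (act g y) (act g z) \<longleftrightarrow> btw x y z"
  by (simp add: btw_def)

lemma gp_act [simp]: "g \<in> G \<Longrightarrow> x \<in> X \<Longrightarrow> y \<in> X \<Longrightarrow> z \<in> X \<Longrightarrow> gp (act g x) (act g y) (act g z) = gp x y z"
  by (simp add: gp_def)

definition fixpts :: "'g \<Rightarrow> 'x set" where
  "fixpts g = {x\<in>X. act g x = x}"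

text \<open>The path through \<open>x\<close>, \<open>g x\<close> and \<open>g (g x)\<close> does
  not backtrack, so its translates form an invariant line.\<close>

definition hyperbolic :: "'g \<Rightarrow> bool" where
  "hyperbolic g \<longleftrightarrow> (\<exists>x\<in>X. 0 < d x (act g x) \<and> d x (act g (act g x)) = 2 * d x (act g x))"

lemma cvx_fixpts: "g \<in> G \<Longrightarrow> cvx (fixpts g)"
  unfolding cvx_def
proof (intro conjI ballI impI)
  fix x y z assume g: "g \<in> G" and x: "x \<in> fixpts g" and y: "y \<in> fixpts g" and z: "z \<in> X" "btw x z y"
  then have X: "x \<in> X" "y \<in> X" "act g x = x" "act g y = y" by (auto simp: fixpts_def)
  then have "btw x (act g z) y" "d x (act g z) = d x z"
    using btw_act[of g x z y] act_d[of g x z] g z by simp_all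
  then have "act g z = z" using btw_unique[of x y "act g z" z] X z g by simp
  then show "z \<in> fixpts g" using z by (simp add: fixpts_def)
qed (auto simp: fixpts_def)

lemma exists_min:
  assumes "A \<noteq> {}" "\<And>x. x \<in> A \<Longrightarrow> 0 \<le> (f x :: int)"
  shows "\<exists>x\<in>A. \<forall>y\<in>A. f x \<le> f y"
proof -
  obtain x where x: "x \<in> A" "\<forall>y\<in>A. nat (f x) \<le> nat (f y)"
    using assms(1) exists_least_iff[of "\<lambda>n. \<exists>x\<in>A. n = nat (f x)"] by (metis ex_in_conv not_le)
  then show ?thesis using assms(2) by (intro bexI[of _ x]) (auto simp: nat_le_eq_zle)
qed

text \<open>At a point of minimal displacement, backtracking of \<open>x, g x, g\<^sup>2 x\<close> could be shortened,
  unless \<open>g\<close> inverts an edge.\<close>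

lemma fix_or_hyperbolic:
  assumes g: "g \<in> G" and ne: "X \<noteq> {}"
    and inv: "\<And>x. x \<in> X \<Longrightarrow> d x (act g x) = 1 \<Longrightarrow> act g (act g x) = x \<Longrightarrow> False"
  shows "fixpts g \<noteq> {} \<or> hyperbolic g"
proof -
  obtain x where x: "x \<in> X" and min: "\<forall>y\<in>X. d x (act g x) \<le> d y (act g y)"
    using exists_min[of X "\<lambda>x. d x (act g x)"] ne d_nonneg g by auto
  let ?D = "d x (act g x)"
  have gx: "act g x \<in> X" "act g (act g x) \<in> X" using x g by auto
  have d2: "d (act g x) (act g (act g x)) = ?D" using x g by simp
  have t: "d x (act g (act g x)) \<le> 2 * ?D" using tri[of x "act g x" "act g (act g x)"] d2 x gx by simp
  consider "?D = 0" | "0 < ?D" "d x (act g (act g x)) = 2 * ?D" | "0 < ?D" "d x (act g (act g x)) < 2 * ?D"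
    using d_nonneg[OF x gx(1)] t by linarith
  then show ?thesis
  proof cases
    case 1
    then have "x \<in> fixpts g" using d_eq[OF x gx(1)] x by (simp add: fixpts_def)
    then show ?thesis by blast
  next
    case 2
    then show ?thesis using x by (auto simp: hyperbolic_def)
  next
    case 3
    have e: "even (gp (act g x) x (act g (act g x)))" using gp_even x gx by blast
    then have ge: "2 \<le> gp (act g x) x (act g (act g x))" using 3 d2 unfolding gp_def by presburger
    obtain p where p: "p \<in> X" "btw x p (act g x)" "d x p = 1" using btw_exists[of x "act g x" 1] x gx 3 by auto
    have gp: "act g p \<in> X" using p g by simp
    have q: "btw (act g x) (act g p) (act g (act g x))" "d (act g x) (act g p) = 1" using p x g by simp_all
    show ?thesis
    proof (cases "?D = 1")
      case True
      then have "d x (act g (act g x)) = 0" using ge d2 d_nonneg[OF x gx(2)] unfolding gp_def by linarith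
      then have "act g (act g x) = x" using d_eq[OF x gx(2)] by simp
      then show ?thesis using inv x True by blast
    next
      case False
      have 1: "gp (act g x) p x = 2 * ?D - 2"
        using p(2,3) d_sym[OF x p(1)] d_sym[OF x gx(1)] unfolding gp_def btw_def by linarith
      have 2: "gp (act g x) (act g (act g x)) (act g p) = 2"
        using q d2 d_sym[OF gx] d_sym[OF gx(2) gp] unfolding gp_def btw_def by linarith
      have "2 \<le> gp (act g x) p (act g p)"
        using gp_ultra[OF gx(1) p(1) x gx(2)] gp_ultra[OF gx(1) p(1) gx(2) gp] 1 2 ge False 3 by linarith
      then have "d p (act g p) \<le> ?D - 2" using p(2,3) q(2) unfolding gp_def btw_def by linarith
      then show ?thesis using min p(1) by force
    qed
  qed
qed

text \<open>If the geodesics from \<open>y\<close> to \<open>x\<close> and to \<open>t x\<close>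
  shared their first edge, then \<open>t\<close> would fix the far end of that edge, a fixed point
  nearer to \<open>x\<close>.\<close>

lemma fix_perp:
  assumes t: "t \<in> G" and x: "x \<in> X" and y: "y \<in> fixpts t" and min: "\<And>z. z \<in> fixpts t \<Longrightarrow> d x y \<le> d x z"
  shows "btw x y (act t x)"
proof (rule ccontr)
  have yX: "y \<in> X" "act t y = y" using y by (auto simp: fixpts_def)
  have tx: "act t x \<in> X" using t x by simp
  assume "\<not> btw x y (act t x)"
  then have "0 < gp y x (act t x)" using not_btw_gp[OF yX(1) x tx] by simp
  then have ge: "2 \<le> gp y x (act t x)" using gp_even[OF yX(1) x tx] by presburger
  have "d y (act t x) = d y x" using act_d[OF t yX(1) x] yX by simp
  then have "1 \<le> d y x" using ge gp_le[OF yX(1) x tx] by linarith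
  then obtain p where p: "p \<in> X" "btw y p x" "d y p = 1" using btw_exists[OF yX(1) x, of 1] by auto
  have tp: "act t p \<in> X" "btw y (act t p) (act t x)" "d y (act t p) = 1"
    using btw_act[OF t yX(1) p(1) x] act_d[OF t yX(1) p(1)] p t x yX by simp_all
  have "gp y p x = 2" "gp y (act t x) (act t p) = 2"
    using p tp d_sym[OF yX(1) p(1)] d_sym[OF yX(1) x] d_sym[OF p(1) x] d_sym[OF yX(1) tx] d_sym[OF tp(1) tx]
    unfolding gp_def btw_def by linarith+
  then have "2 \<le> gp y p (act t p)"
    using gp_ultra[OF yX(1) p(1) x tx] gp_ultra[OF yX(1) p(1) tx tp(1)] ge by linarith
  then have "d p (act t p) \<le> 0" using p(3) tp(3) d_sym[OF yX(1) p(1)] unfolding gp_def by linarith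
  then have "p \<in> fixpts t" using d_nonneg[OF p(1) tp(1)] d_eq[OF p(1) tp(1)] p by (auto simp: fixpts_def)
  then show False using min[of p] p d_sym[OF yX(1) x] d_sym[OF p(1) x] unfolding btw_def by linarith
qed

text \<open>Join the fixed point sets by a shortest bridge from \<open>x\<close> to
  \<open>y\<close>. By \<open>fix_perp\<close> its translates meet without backtracking at both
  ends, so they line up along an axis of the product.\<close>

lemma fix_pair:
  assumes s: "s \<in> G" and t: "t \<in> G" and ne: "fixpts s \<noteq> {}" "fixpts t \<noteq> {}" and dis: "fixpts s \<inter> fixpts t = {}"
  shows "hyperbolic (s + t)"
proof -
  have "\<exists>p\<in>fixpts s \<times> fixpts t. \<forall>q\<in>fixpts s \<times> fixpts t. (\<lambda>(x, y). d x y) p \<le> (\<lambda>(x, y). d x y) q"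
    using ne by (intro exists_min) (auto simp: fixpts_def intro: d_nonneg)
  then obtain x y where xy: "x \<in> fixpts s" "y \<in> fixpts t" 
    and min: "\<And>x' y'. x' \<in> fixpts s \<Longrightarrow> y' \<in> fixpts t \<Longrightarrow> d x y \<le> d x' y'" by auto
  then have X: "x \<in> X" "y \<in> X" "act s x = x" "act t y = y" "x \<noteq> y" using dis by (auto simp: fixpts_def)
  have b1: "btw x y (act t x)" using fix_perp[OF t X(1) xy(2)] min xy by auto
  have "d y x \<le> d y z" if "z \<in> fixpts s" for z
    using min[OF that xy(2)] that X d_sym[of y x] d_sym[of y z] by (auto simp: fixpts_def)
  then have b2: "btw y x (act s y)" using fix_perp[OF s X(2) xy(1)] by auto
  \<comment> \<open>Since \<open>s\<close> fixes \<open>x\<close> and \<open>t\<close> fixes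
    \<open>y\<close>, the points \<open>x\<close>, \<open>s y\<close>, \<open>u x\<close>,
    \<open>u s y\<close>, \<open>u u x\<close> are joined by translates of the bridge.\<close>
  let ?u = "s + t" and ?sy = "act s y"
  have u: "act ?u x = act s (act t x)" using act_add s t X by simp
  have uX: "act ?u x \<in> X" "?sy \<in> X" "act ?u ?sy \<in> X" using s t X by auto
  have b3: "btw x ?sy (act ?u x)" using btw_act[OF s X(1,2), of "act t x"] b1 u s t X by simp
  have b4: "btw ?sy (act ?u x) (act ?u ?sy)"
  proof -
    have "act ?u y = ?sy" using act_add[OF s t X(2)] X by simp
    then show ?thesis using btw_act[of ?u y x ?sy] b2 X uX s t by simp
  qed
  have b5: "btw (act ?u x) (act ?u ?sy) (act ?u (act ?u x))" using b3 btw_act[of ?u x ?sy "act ?u x"] s t X uX by simp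
  have ne: "?sy \<noteq> act ?u x" "act ?u x \<noteq> act ?u ?sy" 
  proof -
    show "?sy \<noteq> act ?u x" using u act_inj[OF s X(2), of "act t x"] X t by (metis act_in act_inj)
    show "act ?u x \<noteq> act ?u ?sy" using act_inj[of ?u x ?sy] s t X uX by (metis G_simps(2) act_inj)
  qed
  have c1: "btw x (act ?u x) (act ?u ?sy)" 
    using chain[of x ?sy "act ?u x" "act ?u ?sy"] b3 b4 ne X uX by blast
  have c2: "btw x (act ?u x) (act ?u (act ?u x))" 
    using chain[of x "act ?u x" "act ?u ?sy" "act ?u (act ?u x)"] c1 b5 ne X uX s t by simp
  have "x \<noteq> act ?u x"
  proof
    assume "x = act ?u x"
    then have "d x ?sy + d ?sy x = 0" using b3 d_refl[OF X(1)] unfolding btw_def by simp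
    then have "d x ?sy = 0" using d_nonneg[of x ?sy] d_nonneg[of ?sy x] X uX by linarith
    then have "x = ?sy" using d_eq X uX by blast
    then show False using act_inj[OF s X(1,2)] X by simp
  qed
  then have "0 < d x (act ?u x)" using d_pos X uX by blast
  moreover have "d x (act ?u (act ?u x)) = 2 * d x (act ?u x)"
    using c2 act_d[of ?u x "act ?u x"] s t X uX unfolding btw_def by simp
  ultimately show ?thesis unfolding hyperbolic_def using X by blast
qed

text \<open>Serre's criterion: by \<open>fix_pair\<close> the fixed point sets meet pairwise, and
  the Helly property does the rest.\<close>

lemma common_fix:
  assumes S: "finite S" "S \<subseteq> G" and ne: "X \<noteq> {}"
    and s: "\<And>s. s \<in> S \<Longrightarrow> fixpts s \<noteq> {}" and st: "\<And>s t. s \<in> S \<Longrightarrow> t \<in> S \<Longrightarrow> \<not> hyperbolic (s + t)"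
  shows "\<exists>x\<in>X. \<forall>s\<in>S. act s x = x"
proof (cases "S = {}")
  case False
  have "\<exists>x\<in>X. \<forall>s\<in>S. x \<in> fixpts s"
  proof (rule helly[OF S(1) False])
    show "cvx (fixpts s)" if "s \<in> S" for s using cvx_fixpts S that by blast
    show "fixpts s \<inter> fixpts t \<noteq> {}" if "s \<in> S" "t \<in> S" for s t
      using fix_pair[of s t] s st that S(2) by blast
  qed
  then show ?thesis by (auto simp: fixpts_def)
qed (use ne in auto)

end

section \<open>The axis of a hyperbolic element\<close>

context tree_action
begin

text \<open>A local criterion, point by point. That these points realize the minimal displacement
  and form a line is derived from it in \<open>axis_disp_le\<close> and
  \<open>axis_three\<close>.\<close>

definition axis :: "'g \<Rightarrow> 'x set" where
  "axis g = {x\<in>X. 0 < d x (act g x) \<and> d x (act g (act g x)) = 2 * d x (act g x)}"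

lemma axis_X [simp]: "x \<in> axis g \<Longrightarrow> x \<in> X"
  unfolding axis_def by simp

lemma hyperbolic_axis: "hyperbolic g \<longleftrightarrow> axis g \<noteq> {}"
  unfolding hyperbolic_def axis_def by auto

lemma axis_act: "g \<in> G \<Longrightarrow> x \<in> axis g \<Longrightarrow> act g x \<in> axis g"
  unfolding axis_def by simp

lemma axis_btw: "g \<in> G \<Longrightarrow> x \<in> axis g \<Longrightarrow> btw x (act g x) (act g (act g x))"
  unfolding axis_def btw_def by simp

lemma axis_conj: "g \<in> G \<Longrightarrow> t \<in> G \<Longrightarrow> act t x \<in> axis (conjg t g) \<longleftrightarrow> x \<in> axis g" if "x \<in> X"
proof -
  assume g: "g \<in> G" "t \<in> G"
  have *: "act (conjg t g) (act t y) = act t (act g y)" if "y \<in> X" for y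
    using g that unfolding conjg_def by (simp add: act_diff act_add)
  have "act (conjg t g) (act t x) = act t (act g x)"
    "act (conjg t g) (act (conjg t g) (act t x)) = act t (act g (act g x))"
    using * g that by simp_all
  then show ?thesis using g that unfolding axis_def by simp
qed

lemma axis_conj_eq: "g \<in> G \<Longrightarrow> t \<in> G \<Longrightarrow> axis (conjg t g) = act t ` axis g"
proof -
  assume g: "g \<in> G" "t \<in> G"
  have "x \<in> act t ` axis g" if x: "x \<in> axis (conjg t g)" for x
  proof -
    have "act t (act (- t) x) \<in> axis (conjg t g)" using x g by simp
    then have "act (- t) x \<in> axis g" using axis_conj[of "act (- t) x" g t] x g by simp
    moreover have "x = act t (act (- t) x)" using x g by simp
    ultimately show ?thesis by blast
  qed
  then show ?thesis using axis_conj[OF _ g] by fastforce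
qed

lemma axis_act_minus: "g \<in> G \<Longrightarrow> x \<in> axis g \<Longrightarrow> act (- g) x \<in> axis g"
  using axis_conj[of x g "- g"] by (simp add: conjg_def)

lemma axis_disp_minus: "g \<in> G \<Longrightarrow> x \<in> axis g \<Longrightarrow> d (act (- g) x) x = d x (act g x)"
  by (simp add: d_act_left)

text \<open>From \<open>q\<close> to the third translate of \<open>q\<close> runs a geodesic of
  three displacements. A smaller displacement of \<open>u\<close> under \<open>g\<close>, or under
  \<open>g\<close> applied twice, would give a shortcut of it.\<close>

lemma axis_seg:
  assumes g: "g \<in> G" and q: "q \<in> axis g" and u: "u \<in> X" "btw q u (act g q)"
  shows "u \<in> axis g \<and> d u (act g u) = d q (act g q)"
proof -
  let ?D = "d q (act g q)"
  have X: "q \<in> X" "act g q \<in> X" "act g (act g q) \<in> X" "act g (act g (act g q)) \<in> X"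
    "act g u \<in> X" "act g (act g u) \<in> X" using q u g by auto
  have pos: "0 < ?D" and two: "d q (act g (act g q)) = 2 * ?D" using q unfolding axis_def by auto
  have ne: "act g q \<noteq> act g (act g q)" using pos d_refl[OF X(1)] act_inj[OF g X(1,2)] by fastforce
  have "btw q (act g (act g q)) (act g (act g (act g q)))"
    using chain(2)[OF X(1,2,3,4) axis_btw[OF g q] _ ne] btw_act[OF g X(1,2,3)] axis_btw[OF g q] by blast
  then have three: "d q (act g (act g (act g q))) = 3 * ?D"
    using two X g unfolding btw_def by simp
  have s: "d q u + d u (act g q) = ?D" using u(2) by (simp add: btw_def)
  have e: "d (act g q) (act g u) = d q u" "d (act g u) (act g (act g q)) = d u (act g q)"
    "d (act g (act g u)) (act g (act g (act g q))) = d u (act g q)" "d (act g u) (act g (act g u)) = d u (act g u)"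
    using X u g by simp_all
  have 1: "d u (act g u) \<le> ?D" using tri[OF u(1) X(2) X(5)] e s by linarith
  have 2: "2 * ?D \<le> d q u + d u (act g u) + d u (act g q)"
    using tri[OF X(1) u(1) X(3)] tri[OF u(1) X(5) X(3)] two e by linarith
  have 3: "d u (act g u) = ?D" using 1 2 s by linarith
  have 4: "d u (act g (act g u)) \<le> 2 * ?D" using tri[OF u(1) X(5,6)] 3 e by linarith
  have 5: "3 * ?D \<le> d q u + d u (act g (act g u)) + d u (act g q)"
    using tri[OF X(1) u(1) X(4)] tri[OF u(1) X(6) X(4)] three e by linarith
  have "d u (act g (act g u)) = 2 * ?D" using 4 5 s by linarith
  then show ?thesis using 3 pos u unfolding axis_def by simp
qed

text \<open>The geodesics from \<open>q\<close> to \<open>z\<close> and to \<open>r\<close> then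
  share an edge; its far end is the desired point.\<close>

lemma closer_point:
  assumes z: "z \<in> X" and q: "q \<in> X" "r \<in> X" and nb: "\<not> btw z q r"
  obtains u where "u \<in> X" "btw q u r" "d z u < d z q"
proof -
  have ge: "2 \<le> gp q z r" using not_btw_gp[OF q(1) z q(2)] gp_even[OF q(1) z q(2)] nb by presburger
  then have "1 \<le> d q r" using gp_le[OF q(1,2) z] gp_sym[OF q(1,2) z] by linarith
  then obtain u where u: "u \<in> X" "btw q u r" "d q u = 1" using btw_exists[OF q, of 1] by auto
  have "gp q u r = 2" using u d_sym[OF q(1) u(1)] d_sym[OF q] d_sym[OF u(1) q(2)] unfolding gp_def btw_def by linarith
  then have "2 \<le> gp q z u" using gp_ultra[OF q(1) z q(2) u(1)] gp_sym[OF q(1) q(2) u(1)] ge by linarith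
  then have "d z u < d z q" using u(3) unfolding gp_def by linarith
  then show ?thesis using that u by blast
qed

text \<open>A nearest point to \<open>z\<close>, among axis points with the displacement of
  \<open>q0\<close> only: that the displacement is constant on the axis is a later consequence of
  this. By \<open>axis_seg\<close> the segments from the nearest point to its two neighbouring
  translates stay among the competitors, so \<open>closer_point\<close> would contradict
  minimality.\<close>

lemma nearest0:
  assumes g: "g \<in> G" and q0: "q0 \<in> axis g" and z: "z \<in> X"
  shows "\<exists>q\<in>axis g. d q (act g q) = d q0 (act g q0) \<and> btw z q (act g q) \<and> btw z q (act (- g) q)"
proof -
  let ?A = "{q\<in>axis g. d q (act g q) = d q0 (act g q0)}"
  have "\<exists>q\<in>?A. \<forall>y\<in>?A. d z q \<le> d z y"
    using q0 z d_nonneg by (intro exists_min) auto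
  then obtain q where q: "q \<in> axis g" "d q (act g q) = d q0 (act g q0)" and min: "\<And>y. y \<in> ?A \<Longrightarrow> d z q \<le> d z y" by auto
  have qX: "q \<in> X" "act g q \<in> X" "act (- g) q \<in> X" using q g by auto
  have "btw z q (act g q)"
  proof (rule ccontr)
    assume "\<not> ?thesis"
    then obtain u where u: "u \<in> X" "btw q u (act g q)" "d z u < d z q" using closer_point[OF z qX(1,2)] by blast
    then have "u \<in> ?A" using axis_seg[OF g q(1) u(1,2)] q by simp
    then show False using min u(3) by force
  qed
  moreover have "btw z q (act (- g) q)"
  proof (rule ccontr)
    assume "\<not> ?thesis"
    then obtain u where u: "u \<in> X" "btw q u (act (- g) q)" "d z u < d z q" using closer_point[OF z qX(1,3)] by blast
    have p: "act (- g) q \<in> axis g" "act g (act (- g) q) = q" using axis_act_minus[OF g q(1)] g qX by auto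
    have "btw (act (- g) q) u (act g (act (- g) q))" using u(1,2) qX p(2) btw_sym by auto
    then have "u \<in> axis g \<and> d u (act g u) = d (act (- g) q) q" using axis_seg[OF g p(1) u(1)] p(2) by simp
    then have "u \<in> ?A" using axis_disp_minus[OF g q(1)] q by simp
    then show False using min u(3) by force
  qed
  ultimately show ?thesis using q by blast
qed

text \<open>The way from \<open>z\<close> to the axis at \<open>q\<close>, along it to
  \<open>g q\<close> and out again to \<open>g z\<close> does not backtrack.\<close>

lemma disp_eq:
  assumes g: "g \<in> G" and q: "q \<in> axis g" and z: "z \<in> X" and b: "btw z q (act g q)" "btw z q (act (- g) q)"
  shows "d z (act g z) = 2 * d z q + d q (act g q)"
proof -
  have X: "q \<in> X" "act g q \<in> X" "act (- g) q \<in> X" "act g z \<in> X" using q z g by auto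
  have "btw (act (- g) q) q z" using b(2) btw_sym z X by blast
  then have "btw (act g (act (- g) q)) (act g q) (act g z)" using btw_act[OF g X(3,1) z] by simp
  then have b2: "btw q (act g q) (act g z)" using g X by simp
  have ne: "q \<noteq> act g q" using q d_refl[of q] unfolding axis_def by auto
  have "btw z q (act g z)" using chain(1)[OF z X(1,2,4) b(1) b2 ne] .
  then have "d z (act g z) = d z q + (d q (act g q) + d (act g q) (act g z))" using b2 by (simp add: btw_def)
  also have "d (act g q) (act g z) = d z q" using g X z d_sym by simp
  finally show ?thesis by simp
qed

lemma axis_disp_le:
  assumes g: "g \<in> G" and q: "q \<in> axis g" and z: "z \<in> X"
  shows "d q (act g q) \<le> d z (act g z)"
proof -
  obtain r where r: "r \<in> axis g" "d r (act g r) = d q (act g q)" "btw z r (act g r)" "btw z r (act (- g) r)"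
    using nearest0[OF assms] by blast
  then show ?thesis using disp_eq[OF g r(1) z r(3,4)] d_nonneg[of z r] z by simp
qed

lemma axis_const:
  assumes "g \<in> G" "q \<in> axis g" "r \<in> axis g"
  shows "d q (act g q) = d r (act g r)"
  using axis_disp_le[OF assms(1,2), of r] axis_disp_le[OF assms(1,3), of q] assms by simp

text \<open>Used in contrapositive form: from \<open>q\<close>, every other axis point lies in the
  direction of \<open>g q\<close> or of \<open>- g\<close> applied to \<open>q\<close>. Otherwise
  \<open>disp_eq\<close> would give it too large a displacement.\<close>

lemma axis_side:
  assumes g: "g \<in> G" and q: "q \<in> axis g" and y: "y \<in> axis g" and b: "btw y q (act g q)" "btw y q (act (- g) q)"
  shows "y = q"
proof -
  have "d y q = 0" using disp_eq[OF g q axis_X[OF y] b] axis_const[OF g q y] by simp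
  then show ?thesis using d_eq q y by simp
qed

text \<open>\<open>nearest0\<close> controls the directions of the two neighbouring translates of
  \<open>q\<close>, and by \<open>axis_side\<close> these contain the rest of the axis.\<close>

lemma projection:
  assumes g: "g \<in> G" and h: "axis g \<noteq> {}" and z: "z \<in> X"
  obtains q where "q \<in> axis g" "\<And>y. y \<in> axis g \<Longrightarrow> btw z q y"
proof -
  obtain q where q: "q \<in> axis g" "btw z q (act g q)" "btw z q (act (- g) q)"
    using nearest0[OF g _ z] h by blast
  have X: "q \<in> X" "act g q \<in> X" "act (- g) q \<in> X" using q g by auto
  have "btw z q y" if y: "y \<in> axis g" for y
  proof (rule ccontr)
    assume nb: "\<not> btw z q y"
    then have p: "0 < gp q z y" using not_btw_gp X z y by simp
    have "y \<noteq> q" using nb btw_refl z X by blast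
    then have "\<not> btw y q (act g q) \<or> \<not> btw y q (act (- g) q)" using axis_side[OF g q(1) y] by blast
    then have "0 < gp q y (act g q) \<or> 0 < gp q y (act (- g) q)" using not_btw_gp X y by simp
    then have "0 < gp q z (act g q) \<or> 0 < gp q z (act (- g) q)"
      using gp_pos_trans[OF X(1) z axis_X[OF y] _ p] X by blast
    then show False using q(2,3) btw_gp by auto
  qed
  then show ?thesis using that q by blast
qed

text \<open>Ping-pong for positive words. The betweenness hypothesis makes the path of every
  positive word a geodesic, and \<open>lt\<close> makes the geodesics to \<open>a p\<close> and
  \<open>b p\<close> separate before either ends, so the first letter can be read off from the image
  of \<open>p\<close>.\<close>

lemma free_pairI:
  assumes G: "a \<in> G" "b \<in> G" and p: "p \<in> X"
    and b: "\<And>s t. s \<in> {a, b} \<Longrightarrow> t \<in> {a, b} \<Longrightarrow> btw (act (- s) p) p (act t p)"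
    and pos: "0 < d p (act a p)" "0 < d p (act b p)"
    and lt: "gp p (act a p) (act b p) < 2 * d p (act a p)" "gp p (act a p) (act b p) < 2 * d p (act b p)"
  shows "free_pair a b"
proof -
  let ?f = "\<lambda>c. if c then a else b"
  have fG: "?f c \<in> G" "?f c \<in> {a, b}" "0 < d p (act (?f c) p)" for c using G pos by auto
  have vG: "word_val a b w \<in> G" for w
    by (rule subgrp_sum_list[OF subG]) (use G in auto)
  have key: "btw p (act (?f c) p) (act (word_val a b (c # w)) p)" for c w
  proof (induction w arbitrary: c)
    case Nil
    show ?case using fG(1)[of c] p btw_refl[of p "act (?f c) p"] by simp
  next
    case (Cons e w)
    let ?v = "word_val a b (e # w)"
    have "btw (act (- ?f c) p) p (act (?f e) p)" using b fG by blast
    moreover have "btw p (act (?f e) p) (act ?v p)" by (rule Cons.IH)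
    moreover have "p \<noteq> act (?f e) p" using fG(3)[of e] d_refl[OF p] by force
    ultimately have "btw (act (- ?f c) p) p (act ?v p)"
      using chain(1)[of "act (- ?f c) p" p "act (?f e) p" "act ?v p"] p fG(1)[of e] fG(1)[of c] vG[of "e # w"] act_in G_simps(3) by blast
    then have "btw (act (?f c) (act (- ?f c) p)) (act (?f c) p) (act (?f c) (act ?v p))"
      using btw_act[OF fG(1)] p vG[of "e # w"] fG(1)[of c] act_in G_simps(3) by blast
    moreover have "act (?f c) (act (- ?f c) p) = p" using act_minus(2)[OF fG(1) p] .
    moreover have "act (?f c) (act ?v p) = act (?f c + ?v) p" using act_add[OF fG(1) vG p] by metis
    ultimately show ?case by simp
  qed
  have dpos: "0 < d p (act (word_val a b (c # w)) p)" for c w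
    using key[of c w] fG(3)[of c] d_nonneg[of "act (?f c) p" "act (word_val a b (c # w)) p"] fG(1)[of c] vG[of "c # w"] p
    unfolding btw_def using act_in by (metis add_pos_nonneg)
  have "u = v" if "word_val a b u = word_val a b v" for u v
    using that
  proof (induction u arbitrary: v)
    case Nil
    show ?case
    proof (cases v)
      case (Cons c w)
      then have "act (word_val a b (c # w)) p = p" using Nil p by simp
      then show ?thesis using dpos[of c w] d_refl[OF p] by simp
    qed simp
  next
    case (Cons c u)
    show ?case
    proof (cases v)
      case Nil
      then have "act (word_val a b (c # u)) p = p" using Cons.prems p by simp
      then show ?thesis using dpos[of c u] d_refl[OF p] by simp
    next
      case (Cons e w)
      show ?thesis
      proof (cases "e = c")
        case True
        then show ?thesis using Cons.prems Cons.IH[of w] \<open>v = e # w\<close> by simp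
      next
        case False
        let ?z = "act (word_val a b (c # u)) p"
        have z: "?z = act (word_val a b (e # w)) p" "?z \<in> X" using Cons.prems \<open>v = e # w\<close> vG[of "c # u"] p by simp_all
        have k: "btw p (act (?f c) p) ?z" "btw p (act (?f e) p) ?z" using key[of c u] key[of e w] z by metis+
        have X: "act (?f c) p \<in> X" "act (?f e) p \<in> X" using fG(1) p act_in by blast+
        \<comment> \<open>The point \<open>?z\<close> lies beyond both \<open>a p\<close> and
          \<open>b p\<close>, so the geodesics to these would agree along the whole shorter
          one.\<close>
        have "gp p (act (?f c) p) ?z = 2 * d p (act (?f c) p)" "gp p ?z (act (?f e) p) = 2 * d p (act (?f e) p)"
          using k d_sym[OF p X(1)] d_sym[OF p X(2)] d_sym[OF p z(2)] d_sym[OF X(2) z(2)] unfolding gp_def btw_def by linarith+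
        then have "min (2 * d p (act (?f c) p)) (2 * d p (act (?f e) p)) \<le> gp p (act (?f c) p) (act (?f e) p)"
          using gp_ultra[OF p X(1) z(2) X(2)] by linarith
        moreover have "gp p (act (?f c) p) (act (?f e) p) = gp p (act a p) (act b p)"
          using False gp_sym[OF p] G p by (cases c) auto
        ultimately show ?thesis using lt False by (cases c) auto
      qed
    qed
  qed
  then show ?thesis unfolding free_pair_def inj_def by blast
qed

end

section \<open>Free pairs from two axes, and the line structure of one axis\<close>

context tree_action
begin

text \<open>Choose the sign of \<open>g\<close> so that \<open>a q\<close> lies on the side of
  \<open>x\<close>, hence off the axis of \<open>h\<close>. The two directions of that axis at
  \<open>q\<close> differ, so \<open>- a\<close> applied to \<open>q\<close> lies in at most one of
  them; choose the sign of \<open>h\<close> to avoid it. The positive words then play ping-pong at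
  \<open>q\<close>.\<close>

lemma two_axes_meet:
  assumes g: "g \<in> G" and h: "h \<in> G" and x: "x \<in> axis g" and q: "q \<in> axis g" "q \<in> axis h" and ne: "x \<noteq> q"
    and proj: "\<And>y. y \<in> axis h \<Longrightarrow> btw x q y"
  shows "\<exists>a\<in>{g, - g}. \<exists>b\<in>{h, - h}. free_pair a b"
proof -
  have X: "x \<in> X" "q \<in> X" using x q by auto
  have "\<exists>a\<in>{g, - g}. \<not> btw x q (act a q)" using axis_side[OF g q(1) x] ne by auto
  then obtain a where a: "a \<in> {g, - g}" "\<not> btw x q (act a q)" by blast
  have aG: "a \<in> G" "- a \<in> G" using a g by auto
  have aX: "act a q \<in> X" "act (- a) q \<in> X" using aG X by auto
  have hX: "act h q \<in> X" "act (- h) q \<in> X" using h X by auto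
  have aa: "btw (act (- a) q) q (act a q)" "0 < d q (act a q)"
  proof -
    have "btw (act (- g) q) q (act g q)"
      using axis_btw[OF g axis_act_minus[OF g q(1)]] g X by simp
    then show "btw (act (- a) q) q (act a q)" using a g X btw_sym[of "act (- g) q" q "act g q"] by auto
    have "0 < d q (act g q)" using q(1) unfolding axis_def by simp
    then show "0 < d q (act a q)" using a axis_disp_minus[OF g q(1)] d_sym[of q "act (- g) q"] g X by auto
  qed
  have hh: "btw (act (- h) q) q (act h q)" "0 < d q (act h q)" "0 < d q (act (- h) q)"
  proof -
    show "btw (act (- h) q) q (act h q)" using axis_btw[OF h axis_act_minus[OF h q(2)]] h X by simp
    show "0 < d q (act h q)" using q(2) unfolding axis_def by simp
    then show "0 < d q (act (- h) q)" using axis_disp_minus[OF h q(2)] d_sym[of q "act (- h) q"] h X by auto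
  qed
  have p0: "0 < gp q x (act a q)" using a(2) not_btw_gp X aX by blast
  have xh: "gp q x y = 0" if "y \<in> axis h" for y using proj[OF that] btw_gp by blast
  have "btw (act (- a) q) q (act b q)" if "b = h \<or> b = - h" "\<not> 0 < gp q (act (- a) q) (act b q)" for b
    using that not_btw_gp[OF X(2) aX(2), of "act b q"] hX by blast
  moreover have "\<not> (0 < gp q (act (- a) q) (act h q) \<and> 0 < gp q (act (- a) q) (act (- h) q))"
  proof
    assume "0 < gp q (act (- a) q) (act h q) \<and> 0 < gp q (act (- a) q) (act (- h) q)"
    then have "0 < gp q (act (- h) q) (act h q)"
      using gp_pos_trans[OF X(2) hX(2) aX(2) hX(1)] gp_sym[OF X(2) hX(2) aX(2)] by simp
    then show False using hh(1) btw_gp by auto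
  qed
  ultimately obtain b where b: "b \<in> {h, - h}" "btw (act (- a) q) q (act b q)" by blast
  have bG: "b \<in> G" "- b \<in> G" using b h by auto
  have bX: "act b q \<in> X" "act (- b) q \<in> X" using bG X by auto
  have bh: "act b q \<in> axis h" "act (- b) q \<in> axis h" 
    using b axis_act[OF h q(2)] axis_act_minus[OF h q(2)] by auto
  have z: "gp q (act a q) y = 0" if y: "y \<in> axis h" for y
  proof (rule ccontr)
    assume "gp q (act a q) y \<noteq> 0"
    then have "0 < gp q (act a q) y" using gp_nonneg[OF X(2) aX(1) axis_X[OF y]] by linarith
    then have "0 < gp q x y" using gp_pos_trans[OF X(2,1) aX(1) axis_X[OF y] p0] by blast
    then show False using xh[OF y] by simp
  qed
  have bb: "btw (act (- b) q) q (act b q)" "0 < d q (act b q)"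
    using b hh btw_sym[OF hX(2) X(2) hX(1)] by auto
  have ba: "btw (act (- b) q) q (act a q)"
    using z[OF bh(2)] gp_sym[OF X(2) aX(1) bX(2)] btw_gp by simp
  have "free_pair a b"
  proof (rule free_pairI[OF aG(1) bG(1) X(2)])
    show "btw (act (- s) q) q (act t q)" if "s \<in> {a, b}" "t \<in> {a, b}" for s t
      using that aa(1) b(2) bb(1) ba by auto
    show "0 < d q (act a q)" "0 < d q (act b q)" by fact+
    show "gp q (act a q) (act b q) < 2 * d q (act a q)" "gp q (act a q) (act b q) < 2 * d q (act b q)"
      using z[OF bh(1)] aa(2) bb(2) by simp_all
  qed
  then show ?thesis using a b by blast
qed

text \<open>From \<open>q\<close>, the point \<open>p\<close> lies in the direction of
  \<open>x\<close>, so \<open>q\<close> separates it from the same points.\<close>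

lemma axis_proj_gp:
  assumes X: "x \<in> X" "q \<in> X" "p \<in> X" "y \<in> X" and "btw q p x" "q \<noteq> p" "btw x q y"
  shows "btw p q y"
proof (rule ccontr)
  assume "\<not> btw p q y"
  then have 1: "0 < gp q p y" using not_btw_gp X by blast
  have "gp q x p = 2 * d q p"
    using assms(5) d_sym[OF X(1,2)] d_sym[OF X(1,3)] unfolding gp_def btw_def by linarith
  then have "0 < gp q x p" using d_pos[OF X(2,3) assms(6)] by simp
  then have "0 < gp q x y" using gp_pos_trans[OF X(2,1,3,4)] 1 by blast
  then show False using assms(7) btw_gp by simp
qed

text \<open>Both \<open>g + h\<close> and \<open>g - h\<close> first carry the path from
  \<open>p\<close> along one axis to \<open>g p\<close> and over the translated bridge to
  \<open>g q\<close>. There they separate, after a common piece shorter than either path. Their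
  inverses leave \<open>p\<close> over the bridge to \<open>q\<close>, opposite to the direction of
  \<open>g p\<close>. So this one pair works without a choice of signs.\<close>

lemma two_axes_disjoint:
  assumes g: "g \<in> G" and h: "h \<in> G" and p: "p \<in> axis g" and q: "q \<in> axis h" and ne: "q \<noteq> p"
    and pg: "\<And>y. y \<in> axis g \<Longrightarrow> btw q p y" and qh: "\<And>y. y \<in> axis h \<Longrightarrow> btw p q y"
  shows "free_pair (g + h) (g - h)"
proof -
  have X: "p \<in> X" "q \<in> X" using p q by auto
  let ?D = "d p q" and ?lg = "d p (act g p)" and ?lh = "d q (act h q)"
  have gX: "act g p \<in> X" "act (- g) p \<in> X" "act g q \<in> X" "act (- g) q \<in> X" using g X by auto
  have pos: "0 < ?D" "0 < ?lg" "0 < ?lh" using d_pos X ne p q unfolding axis_def by auto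
  have key: "btw p (act g q) (act (g + k) p) \<and> d p (act g q) = ?lg + ?D \<and> d (act g q) (act (g + k) p) = ?lh + ?D
     \<and> btw (act (- k) p) p (act g p) \<and> btw (act (- k) p) q p \<and> d p (act (- k) p) = 2 * ?D + ?lh
     \<and> btw (act (- (g + k)) p) p (act g p) \<and> btw p (act g p) (act (g + k) p)"
    if k: "k = h \<or> k = - h" for k
  proof -
    have kG: "k \<in> G" "- k \<in> G" "g + k \<in> G" using k h g by auto
    have kX: "act k q \<in> X" "act (- k) q \<in> X" "act k p \<in> X" "act (- k) p \<in> X" "act (g + k) p \<in> X" "act (- (g + k)) p \<in> X"
      using kG X by (auto simp del: minus_add)
    have kq: "act k q \<in> axis h" "act (- k) q \<in> axis h" "d q (act k q) = ?lh" "d q (act (- k) q) = ?lh"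
      using k axis_act[OF h q] axis_act_minus[OF h q] axis_disp_minus[OF h q] d_sym[of q "act (- h) q"] X h by auto
    have gp': "act g p \<in> axis g" "act (- g) p \<in> axis g" "d p (act (- g) p) = ?lg"
      using axis_act[OF g p] axis_act_minus[OF g p] axis_disp_minus[OF g p] d_sym[OF X(1) gX(2)] by auto
    have 1: "btw p q (act k q)" "btw p q (act (- k) q)" using qh kq by auto
    have ne': "q \<noteq> act k q" "q \<noteq> act (- k) q" "act g q \<noteq> act g p" "act g p \<noteq> p" "p \<noteq> act (- g) p" 
      using pos kq gp' d_refl[OF X(1)] d_refl[OF X(2)] act_inj[OF g X(2,1)] ne by auto
    have 2: "btw q (act k q) (act k p)" 
      using btw_act[OF kG(1) kX(2) X(2) X(1)] 1(2) btw_sym[OF kX(2) X(2) X(1)] kG X by simp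
    have b2: "btw q (act (- k) q) (act (- k) p)" 
      using btw_act[OF kG(2) kX(1) X(2) X(1)] 1(1) btw_sym[OF kX(1) X(2) X(1)] kG X by simp
    have 3: "btw p q (act k p)" using chain(1)[OF X(1,2) kX(1,3) 1(1) 2 ne'(1)] .
    have b3: "btw p q (act (- k) p)" using chain(1)[OF X(1,2) kX(2,4) 1(2) b2 ne'(2)] .
    have dq: "d q (act k p) = ?lh + ?D" "d q (act (- k) p) = ?lh + ?D" 
      using 2 b2 kq act_d[OF kG(1) X(2,1)] act_d[OF kG(2) X(2,1)] d_sym[OF X] unfolding btw_def by auto
    have gk: "act (g + k) p = act g (act k p)" using act_add g kG X by blast
    have 4: "btw (act g p) (act g q) (act (g + k) p)" using 3 gk btw_act[OF g X kX(3)] by simp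
    have 5: "btw p (act g p) (act g q)" 
      using pg[OF gp'(2)] btw_sym[OF X(2,1) gX(2)] btw_act[OF g gX(2) X] g X by simp
    have 6: "btw p (act g q) (act (g + k) p)" "btw p (act g p) (act (g + k) p)"
      using chain[OF X(1) gX(1,3) kX(5) 5 4] ne' by auto
    have dg: "d p (act g q) = ?lg + ?D" using 5 act_d[OF g X] unfolding btw_def by simp
    have dgk: "d (act g q) (act (g + k) p) = ?lh + ?D" using gk dq act_d[OF g X(2) kX(3)] by simp
    have 7: "btw q p (act g p)" using pg gp' by auto
    have 8: "btw (act (- k) p) q p" using b3 btw_sym[OF X kX(4)] by simp
    have 9: "btw (act (- k) p) p (act g p)" using chain(2)[OF kX(4) X(2,1) gX(1) 8 7 ne] .
    have 10: "d p (act (- k) p) = 2 * ?D + ?lh" using b3 dq unfolding btw_def by simp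
    have gk': "act (- (g + k)) p = act (- k) (act (- g) p)"
      using act_add[of "- k" "- g" p] kG g X minus_add[of g k] by (simp add: minus_add del: add_uminus_conv_diff)
    have 11: "btw (act (- k) (act (- g) p)) (act (- k) p) q"
    proof -
      have "btw (act (- g) p) p q" using pg[OF gp'(2)] btw_sym[OF X(2,1) gX(2)] by simp
      then have "btw (act (- k) (act (- g) p)) (act (- k) p) (act (- k) q)" using btw_act[OF kG(2) gX(2) X] by simp
      moreover have "btw (act (- k) p) (act (- k) q) q" using b2 btw_sym[OF X(2) kX(2,4)] by simp
      moreover have "act (- k) p \<noteq> act (- k) q" using act_inj[OF kG(2) X] ne by simp
      ultimately show ?thesis using chain(1)[of "act (- k) (act (- g) p)" "act (- k) p" "act (- k) q" q] kX X gX kG act_in by blast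
    qed
    have "act (- k) p \<noteq> q"
    proof
      assume "act (- k) p = q"
      then have "d q (act (- k) p) = 0" using d_refl[OF X(2)] by simp
      then show False using dq pos by simp
    qed
    then have "btw (act (- (g + k)) p) q p"
      using chain(2)[of "act (- k) (act (- g) p)" "act (- k) p" q p] 11 8 kX X gX kG act_in gk' by metis
    then have 12: "btw (act (- (g + k)) p) p (act g p)"
      using chain(2)[OF kX(6) X(2,1) gX(1) _ 7 ne] by blast
    show ?thesis using 6 dg dgk 9 8 10 12 by blast
  qed
  have kh: "g - h = g + - h" "g + h = g + h" by simp_all
  note k1 = key[of h, simplified] and k2 = key[of "- h", simplified]
  have hX: "act (g + h) p \<in> X" "act (g - h) p \<in> X" "act (- (g + h)) p \<in> X" "act (- (g - h)) p \<in> X"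
    "act h q \<in> X" "act (- h) q \<in> X" "act g (act h q) \<in> X" "act g (act (- h) q) \<in> X"
    using g h X by (auto simp del: minus_add minus_diff_eq)
  have dd: "d p (act (g + h) p) = ?lg + 2 * ?D + ?lh" "d p (act (g - h) p) = ?lg + 2 * ?D + ?lh"
    using k1 k2 unfolding btw_def by auto
  \<comment> \<open>The separation happens exactly at \<open>g q\<close>, because \<open>q\<close>
    lies between \<open>h q\<close> and its image under \<open>- h\<close>.\<close>
  have opp: "btw (act (g + h) p) (act g q) (act (g - h) p)"
  proof -
    have "btw (act h q) q (act (- h) q)" 
      using axis_btw[OF h axis_act_minus[OF h q]] h X btw_sym[OF hX(6) X(2) hX(5)] by simp
    then have "btw (act g (act h q)) (act g q) (act g (act (- h) q))" using btw_act[OF g hX(5) X(2) hX(6)] by simp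
    moreover have "act g (act h p) = act (g + h) p" "act g (act (- h) p) = act (g - h) p"
      using act_add g h X act_diff by auto
    moreover have e: "btw (act g q) (act g (act k q)) (act g (act k p))" if k: "k = h \<or> k = - h" for k
    proof -
      have kG: "k \<in> G" "- k \<in> G" using k h by auto
      have kX: "act k q \<in> X" "act k p \<in> X" "act (- k) q \<in> X" using kG X by auto
      have "act (- k) q \<in> axis h" using k axis_act[OF h q] axis_act_minus[OF h q] by auto
      then have "btw (act (- k) q) q p" using qh btw_sym[OF X kX(3)] by blast
      then have "btw q (act k q) (act k p)" using btw_act[OF kG(1) kX(3) X(2,1)] kG X by simp
      then show ?thesis using btw_act[OF g X(2) kX(1,2)] by simp
    qed
    moreover have n: "act g q \<noteq> act g (act k q)" if k: "k = h \<or> k = - h" for k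
    proof -
      have kG: "k \<in> G" using k h by auto
      have "0 < d q (act k q)" using k pos axis_disp_minus[OF h q] d_sym[OF X(2) hX(6)] by auto
      then have "q \<noteq> act k q" using d_refl[OF X(2)] by force
      then show ?thesis using act_inj[OF g X(2)] kG X by simp
    qed
    ultimately have a1: "btw (act g (act h q)) (act g q) (act (g - h) p)"
      using chain(1)[OF hX(7) gX(3) hX(8) hX(2)] e[of "- h"] n[of "- h"] by metis
    have a2: "btw (act (g + h) p) (act g (act h q)) (act g q)"
      using e[of h] btw_sym[OF gX(3) hX(7,1)] act_add[OF g h X(1)] by simp
    have "act g (act h q) \<noteq> act g q" using n[of h] by metis
    then show ?thesis using chain(2)[OF hX(1,7) gX(3) hX(2) a2 a1] by blast
  qed
  have gpv: "gp p (act (g + h) p) (act (g - h) p) = 2 * (?lg + ?D)"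
    using opp k1 k2 dd d_sym[OF X(1) hX(1)] d_sym[OF gX(3) hX(1)] unfolding gp_def btw_def by simp
  show ?thesis
  proof (rule free_pairI[OF _ _ X(1)])
    show "g + h \<in> G" "g - h \<in> G" using g h by auto
    show "0 < d p (act (g + h) p)" "0 < d p (act (g - h) p)" using dd pos by auto
    show "gp p (act (g + h) p) (act (g - h) p) < 2 * d p (act (g + h) p)"
      "gp p (act (g + h) p) (act (g - h) p) < 2 * d p (act (g - h) p)" using gpv dd pos by auto
    show "btw (act (- s) p) p (act t p)" if st: "s \<in> {g + h, g - h}" "t \<in> {g + h, g - h}" for s t
    proof -
      have sX: "act (- s) p \<in> X" "act t p \<in> X" using st g h X by (auto simp del: minus_add minus_diff_eq)
      have "btw (act (- s) p) p (act g p)" using st key[of h] key[of "- h"] kh by (auto simp del: add_uminus_conv_diff minus_add)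
      moreover have "btw p (act g p) (act t p)" using st k1 k2 by auto
      moreover have "p \<noteq> act g p" using pos d_refl[OF X(1)] by force
      ultimately show ?thesis using chain(1)[OF sX(1) X(1) gX(1) sX(2)] by blast
    qed
  qed
qed

text \<open>The case split is whether the projection \<open>q\<close> of \<open>x\<close> to the
  axis of \<open>h\<close> lies on the axis of \<open>g\<close>. If not, projecting back gives a
  genuine bridge, and the radius 2 is the length of \<open>g + h\<close> and
  \<open>g - h\<close>.\<close>

lemma two_axes:
  assumes g: "g \<in> G" and h: "h \<in> G" and x: "x \<in> axis g" "x \<notin> axis h" and ne: "axis h \<noteq> {}"
  shows "short_free {g, h} 2"
proof -
  have X: "x \<in> X" using x by simp
  obtain q where q: "q \<in> axis h" and proj: "\<And>y. y \<in> axis h \<Longrightarrow> btw x q y" using projection[OF h ne X] by blast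
  have b: "g \<in> wball {g, h} 1" "h \<in> wball {g, h} 1" by (rule wball_base, simp)+
  have b1: "- g \<in> wball {g, h} 1" "- h \<in> wball {g, h} 1" by (rule wball_minus, rule b)+
  have b2: "g + h \<in> wball {g, h} 2" "g - h \<in> wball {g, h} 2"
    using wball_add[OF b] wball_diff[OF b] by (simp_all add: numeral_2_eq_2)
  show ?thesis
  proof (cases "q \<in> axis g")
    case True
    have "x \<noteq> q" using x q by auto
    then obtain a c where "a \<in> {g, - g}" "c \<in> {h, - h}" "free_pair a c" using two_axes_meet[OF g h x(1) True q _ proj] by blast
    then have "short_free {g, h} 1" unfolding short_free_def using b b1 by blast
    then show ?thesis by (rule short_free_mono) simp
  next
    case False
    obtain p where p: "p \<in> axis g" and pg: "\<And>y. y \<in> axis g \<Longrightarrow> btw q p y"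
      using projection[OF g _ axis_X[OF q]] x by blast
    have "q \<noteq> p" using p False by auto
    have "free_pair (g + h) (g - h)"
    proof (rule two_axes_disjoint[OF g h p q \<open>q \<noteq> p\<close> pg])
      show "btw p q y" if "y \<in> axis h" for y
        using axis_proj_gp[OF X _ _ _ pg[OF x(1)] \<open>q \<noteq> p\<close> proj[OF that]] p q that by simp
    qed auto
    then show ?thesis unfolding short_free_def using b2 by blast
  qed
qed

text \<open>The radius is 2 * 3: \<open>two_axes\<close> is applied to \<open>g\<close> and a
  conjugate of it of length 3.\<close>

lemma axis_moved:
  assumes g: "g \<in> G" and t: "t \<in> G" and ne: "axis g \<noteq> {}" and mv: "act t ` axis g \<noteq> axis g"
  shows "short_free {g, t} 6"
proof -
  have "\<exists>s\<in>{t, - t}. \<exists>x\<in>axis g. x \<notin> axis (conjg s g)"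
  \<comment> \<open>The image may properly contain the axis as far as is known here, in which case
    the inverse of \<open>t\<close> moves some axis point off the axis.\<close>
  proof (cases "axis g \<subseteq> act t ` axis g")
    case False
    then show ?thesis using axis_conj_eq[OF g t] by auto
  next
    case True
    then obtain x where x: "x \<in> axis g" "act t x \<notin> axis g" using mv by blast
    then have "x \<notin> axis (conjg (- t) g)" using axis_conj_eq[OF g, of "- t"] t by auto
    then show ?thesis using x by blast
  qed
  then obtain s x where s: "s \<in> {t, - t}" "x \<in> axis g" "x \<notin> axis (conjg s g)" by blast
  have sG: "s \<in> G" using s t by auto
  have "axis (conjg s g) \<noteq> {}" using axis_conj_eq[OF g sG] ne by simp
  then have "short_free {g, conjg s g} 2" using two_axes[OF g _ s(2,3)] sG g by simp
  moreover have "{g, conjg s g} \<subseteq> wball {g, t} 3"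
  proof -
    have 1: "g \<in> wball {g, t} 1" "t \<in> wball {g, t} 1" by (rule wball_base, simp)+
    then have 2: "s \<in> wball {g, t} 1" using s wball_minus by blast
    have "conjg s g \<in> wball {g, t} 3"
      unfolding conjg_def using wball_diff[OF wball_add[OF 2 1(1)] 2] by (simp add: numeral_3_eq_3)
    then show ?thesis using 1 wball_mono[of 1 3 "{g, t}"] by auto
  qed
  ultimately show ?thesis using short_free_wball[of "{g, conjg s g}" 2 "{g, t}" 3] by simp
qed

text \<open>The axis has no branch points. The median of three axis points is its own projection,
  since otherwise all three would lie in one direction from it. At a point of the axis only two
  directions contain axis points, so the median is one of the three points.\<close>

lemma axis_three:
  assumes g: "g \<in> G" and x: "x \<in> axis g" and y: "y \<in> axis g" and z: "z \<in> axis g"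
  shows "btw x y z \<or> btw y z x \<or> btw z x y"
proof -
  have X: "x \<in> X" "y \<in> X" "z \<in> X" using assms by auto
  obtain m where m: "m \<in> X" "btw x m y" "btw y m z" "btw x m z" using median[OF X] .
  have ne: "axis g \<noteq> {}" using x by blast
  obtain n where n: "n \<in> axis g" "\<And>y. y \<in> axis g \<Longrightarrow> btw m n y" using projection[OF g ne m(1)] by blast
  have "m = n"
  proof (rule ccontr)
    assume neq: "m \<noteq> n"
    have 1: "0 < gp m n w" if "w \<in> axis g" for w
    proof -
      have "gp m n w = 2 * d m n"
        using n(2)[OF that] d_sym[OF axis_X[OF n(1)] m(1)] unfolding gp_def btw_def by simp
      then show ?thesis using d_pos[OF m(1) axis_X[OF n(1)] neq] by simp
    qed
    have "0 < gp m x y" using gp_pos_trans[of m x n y] 1[OF x] 1[OF y] gp_sym[of m x n] m(1) axis_X[OF n(1)] X by simp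
    then show False using m btw_gp by simp
  qed
  then have mA: "m \<in> axis g" using n(1) by simp
  have mX: "act g m \<in> X" "act (- g) m \<in> X" using g m by auto
  show ?thesis
  proof (cases "m = x \<or> m = y \<or> m = z")
    case True
    then show ?thesis using m btw_sym X by auto
  next
    case False
    have side: "0 < gp m w (act g m) \<or> 0 < gp m w (act (- g) m)" if "w \<in> axis g" "m \<noteq> w" for w
      using axis_side[OF g mA that(1)] that(2) not_btw_gp[OF m(1) axis_X[OF that(1)] mX(1)]
        not_btw_gp[OF m(1) axis_X[OF that(1)] mX(2)] by blast
    have no: "\<not> (0 < gp m v u \<and> 0 < gp m w u)" if "btw v m w" "v \<in> X" "w \<in> X" "u \<in> X" for u v w
      using gp_pos_trans[OF m(1) that(2,4,3)] gp_sym[OF m(1) that(3,4)] that(1) btw_gp by auto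
    show ?thesis using side[OF x] side[OF y] side[OF z] False no[OF m(2) X(1,2)] no[OF m(3) X(2,3)] no[OF m(4) X(1,3)] mX by blast
  qed
qed

text \<open>Signed distance from \<open>q\<close>, positive on the side of \<open>g q\<close>,
  embeds the axis isometrically into the integers.\<close>

lemma axis_coordinate:
  assumes g: "g \<in> G" and q: "q \<in> axis g"
  shows "\<exists>\<beta> :: 'x \<Rightarrow> int. \<beta> q = 0 \<and> \<beta> (act g q) = d q (act g q) \<and> (\<forall>y\<in>axis g. \<forall>z\<in>axis g. d y z = \<bar>\<beta> y - \<beta> z\<bar>)"
proof -
  \<comment> \<open>The test also holds for \<open>y = q\<close>, where both branches give
    0.\<close>
  define \<beta> where "\<beta> y = (if btw y q (act g q) then - d q y else d q y)" for y
  have X: "q \<in> X" "act g q \<in> X" "act (- g) q \<in> X" using g q by auto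
  have pos: "0 < d q (act g q)" using q unfolding axis_def by simp
  have b0: "\<beta> q = 0" using X d_refl by (simp add: \<beta>_def)
  have nb: "\<not> btw (act g q) q (act g q)"
    using pos d_refl[OF X(2)] d_sym[OF X(1,2)] unfolding btw_def by simp
  then have b1: "\<beta> (act g q) = d q (act g q)" by (simp add: \<beta>_def)
  have *: "d y z = \<bar>\<beta> y - \<beta> z\<bar>" if y: "y \<in> axis g" and z: "z \<in> axis g" for y z
  proof -
    have yz: "y \<in> X" "z \<in> X" using y z by auto
    note nn = d_nonneg[OF X(1) yz(1)] d_nonneg[OF X(1) yz(2)] d_nonneg[OF yz]
    note sy = d_sym[OF X(1) yz(1)] d_sym[OF X(1) yz(2)] d_sym[OF yz]
    consider "y = q \<or> z = q" | "y \<noteq> q" "z \<noteq> q" by blast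
    then show ?thesis
    proof cases
      case 1
      have ab: "d q w = \<bar>\<beta> w\<bar>" if "w \<in> axis g" for w
        using d_nonneg[OF X(1) axis_X[OF that]] unfolding \<beta>_def by simp
      have "d y q = d q y" by (rule d_sym[OF yz(1) X(1)])
      then show ?thesis using 1 ab[OF y] ab[OF z] b0 by force
    next
      case 2
      have neg: "btw w q (act g q) \<Longrightarrow> 0 < gp q w (act (- g) q)" if "w \<in> axis g" "w \<noteq> q" for w
        using axis_side[OF g q that(1)] that(2) not_btw_gp[OF X(1) axis_X[OF that(1)] X(3)] by blast
      have opp: "gp q (act (- g) q) (act g q) = 0" 
        using axis_btw[OF g axis_act_minus[OF g q]] g X btw_gp by simp
      have ps: "\<not> btw w q (act g q) \<Longrightarrow> 0 < gp q w (act g q)" if "w \<in> axis g" for w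
        using not_btw_gp[OF X(1) axis_X[OF that] X(2)] by simp
      have same: "0 < gp q y z" if "btw y q (act g q) \<longleftrightarrow> btw z q (act g q)"
      proof (cases "btw y q (act g q)")
        case True
        then show ?thesis using gp_pos_trans[OF X(1) yz(1) X(3) yz(2)] neg[OF y 2(1)] neg[OF z 2(2)] gp_sym[OF X(1) yz(2) X(3)] that by simp
      next
        case False
        then show ?thesis using gp_pos_trans[OF X(1) yz(1) X(2) yz(2)] ps[OF y] ps[OF z] gp_sym[OF X(1) yz(2) X(2)] that by simp
      qed
      have diff: "gp q y z = 0" if "btw y q (act g q) \<noteq> btw z q (act g q)"
      proof (rule ccontr)
        assume "gp q y z \<noteq> 0"
        then have p: "0 < gp q y z" "0 < gp q z y" using gp_nonneg[OF X(1) yz] gp_sym[OF X(1) yz] by auto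
        show False
        proof (cases "btw y q (act g q)")
          case True
          then have "0 < gp q y (act (- g) q)" "0 < gp q z (act g q)" using neg[OF y 2(1)] ps[OF z] that by auto
          then have "0 < gp q y (act g q)" using gp_pos_trans[OF X(1) yz X(2)] p by blast
          then show False using True btw_gp by simp
        next
          case False
          then have "0 < gp q y (act g q)" "btw z q (act g q)" using ps[OF y] that by auto
          then have "0 < gp q z (act g q)" using gp_pos_trans[OF X(1) yz(2,1) X(2)] p by blast
          then show False using \<open>btw z q (act g q)\<close> btw_gp by simp
        qed
      qed
      show ?thesis
      proof (cases "btw y q (act g q) \<longleftrightarrow> btw z q (act g q)")
        case True
        then have "\<not> btw y q z" using same btw_gp by simp
        then have "btw q z y \<or> btw z y q" using axis_three[OF g q y z] btw_sym[OF X(1) yz] btw_sym[OF X(1) yz(2,1)] btw_sym[OF yz X(1)] btw_sym[OF yz(2) X(1) yz(1)] by blast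
        then show ?thesis using True nn sy unfolding \<beta>_def btw_def by auto
      next
        case False
        then have "btw y q z" using diff btw_gp by simp
        then show ?thesis using False nn sy unfolding \<beta>_def by (auto simp: btw_def)
      qed
    qed
  qed
  show ?thesis using b0 b1 * by blast
qed

text \<open>In the coordinate, \<open>h\<close> acts as \<open>t\<close> to plus or minus
  \<open>t\<close>, shifted by \<open>\<tau> h\<close>; \<open>P h\<close> selects the plus sign. A
  reflection is an involution on the axis, which is the clause on \<open>h + h\<close>.\<close>

lemma axis_stabilizer:
  assumes g: "g \<in> G" and ne: "axis g \<noteq> {}" and H: "H \<subseteq> G" and st: "\<And>h x. h \<in> H \<Longrightarrow> x \<in> axis g \<Longrightarrow> act h x \<in> axis g"
  shows "\<exists>(P :: 'g \<Rightarrow> bool) (\<tau> :: 'g \<Rightarrow> int).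
    (\<forall>h\<in>H. \<forall>k\<in>H. (P (h + k) \<longleftrightarrow> (P h \<longleftrightarrow> P k)) \<and> (P h \<and> P k \<longrightarrow> \<tau> (h + k) = \<tau> h + \<tau> k)) \<and>
    (\<forall>h\<in>H. (\<not> P h \<longrightarrow> \<tau> (h + h) = 0) \<and> (P h \<and> \<tau> h = 0 \<longleftrightarrow> (\<forall>x\<in>axis g. act h x = x)))"
proof -
  obtain q where q: "q \<in> axis g" using ne by blast
  obtain \<beta> :: "'x \<Rightarrow> int" where \<beta>: "\<beta> q = 0" "\<beta> (act g q) = d q (act g q)"
    "\<And>y z. y \<in> axis g \<Longrightarrow> z \<in> axis g \<Longrightarrow> d y z = \<bar>\<beta> y - \<beta> z\<bar>" using axis_coordinate[OF g q] by blast
  have pos: "0 < \<beta> (act g q)" using q \<beta>(2) unfolding axis_def by simp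
  have gq: "act g q \<in> axis g" using axis_act[OF g q] .
  define P where "P h \<longleftrightarrow> \<beta> (act h (act g q)) - \<beta> (act h q) = \<beta> (act g q)" for h
  define \<tau> where "\<tau> h = \<beta> (act h q)" for h
  \<comment> \<open>The distances to the images of \<open>q\<close> and \<open>g q\<close> determine
    the image of every other point.\<close>
  have key: "\<beta> (act h y) = (if P h then \<beta> y else - \<beta> y) + \<tau> h" if h: "h \<in> H" and y: "y \<in> axis g" for h y
  proof -
    have hG: "h \<in> G" using H h by blast
    have "\<bar>\<beta> (act h y) - \<beta> (act h q)\<bar> = \<bar>\<beta> y\<bar>" "\<bar>\<beta> (act h y) - \<beta> (act h (act g q))\<bar> = \<bar>\<beta> y - \<beta> (act g q)\<bar>"
      "\<bar>\<beta> (act h (act g q)) - \<beta> (act h q)\<bar> = \<beta> (act g q)"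
      using \<beta>(3)[OF st[OF h y] st[OF h q]] \<beta>(3)[OF st[OF h y] st[OF h gq]] \<beta>(3)[OF st[OF h gq] st[OF h q]]
        \<beta>(3)[OF y q] \<beta>(3)[OF y gq] \<beta>(3)[OF gq q] \<beta>(1) act_d[OF hG axis_X[OF y] axis_X[OF q]] 
        act_d[OF hG axis_X[OF y] axis_X[OF gq]] act_d[OF hG axis_X[OF gq] axis_X[OF q]] pos by simp_all
    then show ?thesis unfolding P_def \<tau>_def using pos by (smt (verit))
  qed
  have inj: "y = z" if "y \<in> axis g" "z \<in> axis g" "\<beta> y = \<beta> z" for y z
    using \<beta>(3)[OF that(1,2)] that d_eq by simp
  have add: "act (h + k) y = act h (act k y)" if "h \<in> H" "k \<in> H" "y \<in> axis g" for h k y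
    using act_add that H axis_X by blast
  show ?thesis
  proof (intro exI conjI ballI)
    fix h k assume hk: "h \<in> H" "k \<in> H"
    have e: "\<beta> (act (h + k) y) = (if P h then \<beta> (act k y) else - \<beta> (act k y)) + \<tau> h" if "y \<in> axis g" for y
      using key[OF hk(1) st[OF hk(2) that]] add[OF hk that] by simp
    have pm: "\<beta> (act k (act g q)) - \<beta> (act k q) = (if P k then \<beta> (act g q) else - \<beta> (act g q))"
      using key[OF hk(2) gq] key[OF hk(2) q] \<beta>(1) by simp
    show "P (h + k) \<longleftrightarrow> (P h \<longleftrightarrow> P k)"
      unfolding P_def[of "h + k"] e[OF gq] e[OF q] using pm pos by (auto split: if_splits)
    show "P h \<and> P k \<longrightarrow> \<tau> (h + k) = \<tau> h + \<tau> k"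
      using e[OF q] \<beta>(1) unfolding \<tau>_def by simp
  next
    fix h assume h: "h \<in> H"
    show "\<not> P h \<longrightarrow> \<tau> (h + h) = 0"
      using key[OF h st[OF h q]] add[OF h h q] unfolding \<tau>_def by simp
    show "P h \<and> \<tau> h = 0 \<longleftrightarrow> (\<forall>x\<in>axis g. act h x = x)"
    proof
      assume "P h \<and> \<tau> h = 0"
      then show "\<forall>x\<in>axis g. act h x = x" using key[OF h] inj st[OF h] by simp
    next
      assume "\<forall>x\<in>axis g. act h x = x"
      then show "P h \<and> \<tau> h = 0" using q gq \<beta>(1) unfolding P_def \<tau>_def by simp
    qed
  qed
qed

end

section \<open>Groups acting on a line\<close>

lemma free_pair_not_comm: "free_pair u v \<Longrightarrow> \<not> comm u v"
proof
  assume "free_pair u v" "comm u v"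
  moreover have "word_val u v [True, False] = u + v" "word_val u v [False, True] = v + u" by simp_all
  ultimately show False unfolding free_pair_def comm_def inj_def by (metis list.inject)
qed

lemma short_free_not_comm:
  assumes "short_free S n" "\<And>s t. s \<in> S \<Longrightarrow> t \<in> S \<Longrightarrow> comm s t" shows False
proof -
  obtain u v where "u \<in> gspan S" "v \<in> gspan S" "free_pair u v"
    using assms(1) wball_gspan unfolding short_free_def by blast
  then show False using gspan_comm[OF assms(2)] free_pair_not_comm by blast
qed

lemma free_like_mono:
  fixes C :: "'g::group_add set"
  assumes "free_like C" "D \<subseteq> C" shows "free_like D"
  unfolding free_like_def
proof (intro conjI ballI impI)
  show "comm a b \<or> short_free {a, b} 6" if "a \<in> D" "b \<in> D" for a b
    using free_like_short[OF assms(1)] that assms(2) by blast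
  show "comm k c" if "c \<in> D" "k \<in> D" "c \<noteq> 0 \<and> comm (conjg k c) c" for c k
    using free_like_malnormal[OF assms(1)] that assms(2) by blast
  show "comm a b" if "c \<in> D" "a \<in> D" "b \<in> D" "c \<noteq> 0 \<and> comm a c \<and> comm b c" for c a b
    using free_like_trans[OF assms(1)] that assms(2) by blast
  show "\<forall>K. subgrp K \<and> K \<subseteq> D \<and> (\<forall>a\<in>K. \<forall>b\<in>K. comm a b) \<longrightarrow>
      (\<exists>\<tau> :: 'g \<Rightarrow> int. inj_on \<tau> K \<and> (\<forall>a\<in>K. \<forall>b\<in>K. \<tau> (a + b) = \<tau> a + \<tau> b))"
    using assms(1)[unfolded free_like_def, THEN conjunct2, THEN conjunct2, THEN conjunct2] assms(2) by (meson subset_trans)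
qed

lemma additive_zero: "subgrp L \<Longrightarrow> (\<And>a b. a \<in> L \<Longrightarrow> b \<in> L \<Longrightarrow> f (a + b) = f a + f b) \<Longrightarrow> f 0 = (0 :: int)"
  using subgrp_zero[of L] by (metis add_0_right add_left_cancel)

lemma additive_minus:
  assumes "subgrp L" "\<And>a b. a \<in> L \<Longrightarrow> b \<in> L \<Longrightarrow> f (a + b) = f a + f b" "a \<in> L"
  shows "f (- a) = - (f a :: int)"
proof -
  have "f (a + - a) = f a + f (- a)" using assms subgrp_minus by blast
  then show ?thesis using additive_zero[OF assms(1,2)] by simp
qed

lemma additive_diff:
  assumes "subgrp L" "\<And>a b. a \<in> L \<Longrightarrow> b \<in> L \<Longrightarrow> f (a + b) = f a + f b" "a \<in> L" "b \<in> L"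
  shows "f (a - b) = (f a :: int) - f b"
proof -
  have "f (a + - b) = f a + f (- b)" using assms subgrp_minus by blast
  then show ?thesis using additive_minus[OF assms(1,2,4)] by simp
qed

text \<open>The values of \<open>f\<close> form a subgroup of the integers. Its least positive
  element is the value of \<open>t\<close>, so every \<open>x\<close> agrees with a multiple of
  \<open>t\<close> up to the kernel of \<open>f\<close>.\<close>

lemma additive_cyclic:
  fixes f :: "'g::group_add \<Rightarrow> int"
  assumes L: "subgrp L" and f: "\<And>a b. a \<in> L \<Longrightarrow> b \<in> L \<Longrightarrow> f (a + b) = f a + f b"
  obtains t where "t \<in> L" "\<And>x. x \<in> L \<Longrightarrow> \<exists>y\<in>gspan {t}. f (x - y) = 0"
proof (cases "\<forall>x\<in>L. f x = 0")
  case True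
  show ?thesis
    by (rule that[of 0]) (use True L subgrp_zero[OF subgrp_gspan] in \<open>auto simp: subgrp_zero intro!: bexI[of _ 0]\<close>)
next
  case False
  let ?pos = "\<lambda>n. \<exists>t\<in>L. 0 < f t \<and> nat (f t) = n"
  have "\<exists>n. ?pos n"
  proof -
    obtain x where "x \<in> L" "f x \<noteq> 0" using False by blast
    then have "0 < f x \<or> 0 < f (- x)" "- x \<in> L" using additive_minus[OF L f] L subgrp_minus by auto
    then show ?thesis using \<open>x \<in> L\<close> by blast
  qed
  then obtain n where n: "?pos n" "\<And>k. k < n \<Longrightarrow> \<not> ?pos k" using exists_least_iff[of ?pos] by blast
  then obtain t where t: "t \<in> L" "0 < f t" "nat (f t) = n" by blast
  have min: "f t \<le> f y" if "y \<in> L" "0 < f y" for y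
    using n(2)[of "nat (f y)"] t that by (metis linorder_not_less nat_mono_iff)
  have tt: "gspan {t} \<subseteq> L" using gspan_least[OF L] t by blast
  have sg: "subgrp (gspan {t})" "t \<in> gspan {t}" by (auto intro: subgrp_gspan gspan_base)
  have "\<exists>y\<in>gspan {t}. f (x - y) = 0" if "x \<in> L" for x
    using that
  proof (induction "nat \<bar>f x\<bar>" arbitrary: x rule: less_induct)
    case less
    consider "f x = 0" | "0 < f x" | "f x < 0" by linarith
    then show ?case
    proof cases
      case 1
      then have "f (x - 0) = 0" by simp
      then show ?thesis using subgrp_zero[OF sg(1)] by blast
    next
      case 2
      have "f (x - t) = f x - f t" "x - t \<in> L" using additive_diff[OF L f less.prems t(1)] subgrp_diff[OF L less.prems t(1)] by auto
      then obtain y where y: "y \<in> gspan {t}" "f (x - t - y) = 0"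
        using less.hyps[of "x - t"] min[OF less.prems 2] t(2) by (smt (verit) nat_less_eq_zless)
      then have "y + t \<in> gspan {t}" "f (x - (y + t)) = 0" using subgrp_add[OF sg(1)] sg(2)
        by (auto simp: group_norm simp del: add_uminus_conv_diff)
      then show ?thesis by blast
    next
      case 3
      have "f (x + t) = f x + f t" "x + t \<in> L" using f[OF less.prems t(1)] subgrp_add[OF L less.prems t(1)] by auto
      moreover have "f t \<le> - f x" using min[of "- x"] additive_minus[OF L f less.prems] 3 subgrp_minus[OF L less.prems] by simp
      ultimately obtain y where y: "y \<in> gspan {t}" "f (x + t - y) = 0"
        using less.hyps[of "x + t"] t(2) 3 by (smt (verit) nat_less_eq_zless)
      then have "y - t \<in> gspan {t}" "f (x - (y - t)) = 0" using subgrp_diff[OF sg(1)] sg(2)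
        by (auto simp: group_norm simp del: add_uminus_conv_diff)
      then show ?thesis by blast
    qed
  qed
  then show ?thesis using that t by blast
qed

lemma dvd_gspan_singleton:
  fixes f :: "'g::group_add \<Rightarrow> int"
  assumes L: "subgrp L" and f: "\<And>a b. a \<in> L \<Longrightarrow> b \<in> L \<Longrightarrow> f (a + b) = f a + f b" and w: "w \<in> L" and x: "x \<in> gspan {w}"
  shows "f w dvd f x"
proof -
  have "x \<in> L \<and> f w dvd f x" using x
  proof (induction rule: gspan_right_induct)
    case zero
    then show ?case using additive_zero[OF L f] subgrp_zero[OF L] by simp
  next
    case (add x s)
    then show ?case using f[of x s] subgrp_add[OF L, of x s] w by simp
  next
    case (diff x s)
    then show ?case using additive_diff[OF L f, of x s] subgrp_diff[OF L, of x s] w by simp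
  qed
  then show ?thesis by blast
qed

text \<open>A group acting on a line by translations (where \<open>P\<close> holds) and reflections, with cyclic kernel.\<close>

lemma virt_abelian_line:
  fixes P :: "'g::group_add \<Rightarrow> bool" and \<tau> \<sigma> :: "'g \<Rightarrow> int"
  assumes H: "subgrp H" and P: "\<And>h k. h \<in> H \<Longrightarrow> k \<in> H \<Longrightarrow> P (h + k) \<longleftrightarrow> (P h \<longleftrightarrow> P k)"
    and \<tau>: "\<And>h k. h \<in> H \<Longrightarrow> k \<in> H \<Longrightarrow> P h \<Longrightarrow> P k \<Longrightarrow> \<tau> (h + k) = \<tau> h + \<tau> k"
    and K: "K = {h\<in>H. P h \<and> \<tau> h = 0}"
    and Kab: "\<And>a b. a \<in> K \<Longrightarrow> b \<in> K \<Longrightarrow> comm a b"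
    and \<sigma>: "inj_on \<sigma> K" "\<And>a b. a \<in> K \<Longrightarrow> b \<in> K \<Longrightarrow> \<sigma> (a + b) = \<sigma> a + \<sigma> b"
  shows "virt_abelian H"
proof -
  define H0 where "H0 = {h\<in>H. P h}"
  have P0: "P 0" using P[of 0 0] subgrp_zero[OF H] by simp
  have Pm: "P (- h) \<longleftrightarrow> P h" if "h \<in> H" for h
    using P[OF that subgrp_minus[OF H that]] P0 by simp
  have H0: "subgrp H0" unfolding H0_def
    using H P P0 Pm by (intro subgrpI) (auto simp: subgrp_zero subgrp_add subgrp_minus)
  have \<tau>0: "\<And>h k. h \<in> H0 \<Longrightarrow> k \<in> H0 \<Longrightarrow> \<tau> (h + k) = \<tau> h + \<tau> k" using \<tau> by (simp add: H0_def)
  have KH0: "K = {h\<in>H0. \<tau> h = 0}" using K by (auto simp: H0_def)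
  note tz = additive_zero[OF H0 \<tau>0] and tm = additive_minus[OF H0 \<tau>0] and td = additive_diff[OF H0 \<tau>0]
  have sK: "subgrp K" unfolding KH0 using H0 \<tau>0 tz tm by (intro subgrpI) (auto simp: subgrp_zero subgrp_add subgrp_minus)
  have Kn: "conjg h k \<in> K" if "h \<in> H0" "k \<in> K" for h k
  proof -
    have "h + k \<in> H0" "k \<in> H0" using that KH0 H0 subgrp_add by auto
    then show ?thesis unfolding conjg_def KH0 using that H0 td[of "h + k" h] \<tau>0[of h k] KH0 by (auto intro: subgrp_diff)
  qed
  \<comment> \<open>The centralizer of \<open>K\<close> among the translations. It is abelian:
    modulo \<open>K\<close> it is cyclic by the values of \<open>\<tau>\<close>, and it commutes
    with \<open>K\<close>.\<close>
  define B where "B = {b\<in>H0. \<forall>k\<in>K. comm b k}"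
  have sB: "subgrp B" unfolding B_def using H0 by (intro subgrpI) (auto simp: subgrp_zero subgrp_add subgrp_minus comm_add)
  have Bab: "comm a b" if ab: "a \<in> B" "b \<in> B" for a b
  proof -
    obtain t where t: "t \<in> B" "\<And>x. x \<in> B \<Longrightarrow> \<exists>y\<in>gspan {t}. \<tau> (x - y) = 0"
      using additive_cyclic[OF sB, of \<tau>] \<tau>0 unfolding B_def by blast
    have tB: "gspan {t} \<subseteq> B" using gspan_least[OF sB] t by blast
    have all: "comm x z" if x: "x \<in> B" and z: "comm t z" "\<And>k. k \<in> K \<Longrightarrow> comm k z" for x z
    proof -
      obtain y where y: "y \<in> gspan {t}" "\<tau> (x - y) = 0" using t(2)[OF x] by blast
      then have "x - y \<in> K" using x tB sB subgrp_diff[OF sB] unfolding KH0 B_def by blast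
      then have "comm (x - y) z" using z by blast
      moreover have "comm y z" by (rule comm_gspan[of "{t}"]) (use y z in auto)
      ultimately have "comm (x - y + y) z" by (rule comm_add)
      then show ?thesis by simp
    qed
    have Bk: "comm k b" if "k \<in> K" "b \<in> B" for k b using that comm_sym unfolding B_def by blast
    have tall: "comm x t" if "x \<in> B" for x using all[OF that, of t] Bk[OF _ t(1)] by simp
    show ?thesis by (rule all[OF ab(1)]) (use tall[OF ab(2)] comm_sym Bk ab in blast)+
  qed
  obtain z where z: "z \<in> K" "\<And>x. x \<in> K \<Longrightarrow> \<exists>y\<in>gspan {z}. \<sigma> (x - y) = 0"
    using additive_cyclic[OF sK \<sigma>(2)] by blast
  have zK: "gspan {z} \<subseteq> K" using gspan_least[OF sK] z by blast
  have sz: "\<sigma> 0 = 0" using additive_zero[OF sK \<sigma>(2)] .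
  have Kz: "K = gspan {z}"
  proof -
    have "x \<in> gspan {z}" if x: "x \<in> K" for x
    proof -
      obtain y where y: "y \<in> gspan {z}" "\<sigma> (x - y) = 0" using z(2)[OF x] by blast
      then have "x - y \<in> K" using x zK subgrp_diff[OF sK] by blast
      then have "x - y = 0" using inj_onD[OF \<sigma>(1), of "x - y" 0] y sz subgrp_zero[OF sK] by simp
      then show ?thesis using y by simp
    qed
    then show ?thesis using zK by blast
  qed
  \<comment> \<open>Conjugation by \<open>h\<close> is an automorphism of the cyclic group
    \<open>K\<close>, which embeds into the integers, so it can only fix or negate the generator.
    Hence \<open>B\<close> has index at most 2 in \<open>H0\<close>.\<close>
  have pm: "conjg h z = z \<or> conjg h z = - z" if h: "h \<in> H0" for h
  proof -
    have cK: "conjg h z \<in> K" using Kn[OF h z(1)] .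
    have 1: "\<sigma> z dvd \<sigma> (conjg h z)" using dvd_gspan_singleton[OF sK \<sigma>(2) z(1)] cK Kz by blast
    have "conjg (- h) z \<in> gspan {z}" using Kn[OF subgrp_minus[OF H0 h] z(1)] Kz by simp
    then have "conjg h (conjg (- h) z) \<in> gspan (conjg h ` {z})" unfolding gspan_conjg by blast
    then have "z \<in> gspan {conjg h z}" by simp
    then have 2: "\<sigma> (conjg h z) dvd \<sigma> z" using dvd_gspan_singleton[OF sK \<sigma>(2) cK] by blast
    have "\<sigma> (conjg h z) = \<sigma> z \<or> \<sigma> (conjg h z) = \<sigma> (- z)"
      using zdvd_antisym_abs[OF 1 2] additive_minus[OF sK \<sigma>(2) z(1)] by linarith
    then show ?thesis using inj_onD[OF \<sigma>(1) _ cK] z(1) subgrp_minus[OF sK z(1)] by blast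
  qed
  have inB: "h \<in> B" if h: "h \<in> H0" "conjg h z = z" for h
  proof -
    have "comm z h" using h(2) comm_iff_conj comm_sym by blast
    then have "comm k h" if "k \<in> K" for k using comm_gspan[of "{z}" h k] that Kz by blast
    then show ?thesis using h(1) comm_sym unfolding B_def by blast
  qed
  have "\<exists>r. \<forall>h\<in>H0. h \<in> B \<or> h - r \<in> B"
  proof (cases "\<forall>h\<in>H0. h \<in> B")
    case False
    then obtain r where r: "r \<in> H0" "r \<notin> B" by blast
    then have rz: "conjg r z = - z" using pm inB by blast
    have "h - r \<in> B" if h: "h \<in> H0" "h \<notin> B" for h
    proof (rule inB)
      show "h - r \<in> H0" using subgrp_diff[OF H0 h(1) r(1)] .
      have "conjg h z = - z" using pm inB h by blast
      moreover have "conjg (- r) z = - z" using rz conjg_cancel(1)[of r z] conjg_minus[of "- r" z] by (metis conjg_minus minus_minus)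
      ultimately have "conjg h (conjg (- r) z) = z" using conjg_minus by (metis minus_minus)
      then show "conjg (h - r) z = z" by (simp add: conjg_conjg)
    qed
    then show ?thesis by blast
  qed auto
  then obtain r where r: "\<And>h. h \<in> H0 \<Longrightarrow> h \<in> B \<or> h - r \<in> B" by blast
  have "\<exists>r'. \<forall>h\<in>H. h \<in> H0 \<or> h - r' \<in> H0"
  proof (cases "\<forall>h\<in>H. h \<in> H0")
    case False
    then obtain s where s: "s \<in> H" "\<not> P s" by (auto simp: H0_def)
    have "h - s \<in> H0" if "h \<in> H" "\<not> P h" for h
      using that s P[OF that(1) subgrp_minus[OF H s(1)]] Pm[OF s(1)] subgrp_diff[OF H that(1) s(1)] by (simp add: H0_def)
    then show ?thesis by (auto simp: H0_def)
  qed auto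
  then obtain r' where r': "\<And>h. h \<in> H \<Longrightarrow> h \<in> H0 \<or> h - r' \<in> H0" by blast
  have fin: "\<exists>k\<in>B. \<exists>x\<in>{0, r}. h = k + x" if "h \<in> H0" for h
    using r[OF that] by (metis add.right_neutral diff_add_cancel insertCI)
  \<comment> \<open>Index at most 2 for \<open>B\<close> in \<open>H0\<close> and for
    \<open>H0\<close> in \<open>H\<close> leaves at most four cosets.\<close>
  have "\<exists>k\<in>B. \<exists>x\<in>{0, r, r', r + r'}. h = k + x" if h: "h \<in> H" for h
    using r'[OF h]
  proof
    assume "h \<in> H0"
    then show ?thesis using fin by blast
  next
    assume "h - r' \<in> H0"
    then obtain k x where kx: "k \<in> B" "x \<in> {0, r}" "h - r' = k + x" using fin by blast
    then have "h = k + (x + r')" by (metis add.assoc diff_add_cancel)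
    moreover have "x + r' \<in> {0, r, r', r + r'}" using kx by auto
    ultimately show ?thesis using kx by blast
  qed
  moreover have "B \<subseteq> H" unfolding B_def H0_def by blast
  ultimately show ?thesis unfolding virt_abelian_def using sB Bab
    by (intro exI[of _ B] exI[of _ "{0, r, r', r + r'}"]) simp
qed

text \<open>Schreier generators for the kernel of the sign \<open>P\<close>, with transversal 0 and
  \<open>r\<close>: besides \<open>s\<close> itself these are \<open>s - r\<close>,
  \<open>r + s\<close> and \<open>r + s - r\<close>, which explains the length 3.\<close>

lemma index_two_generators:
  assumes P: "\<And>h k. h \<in> gspan S \<Longrightarrow> k \<in> gspan S \<Longrightarrow> P (h + k) \<longleftrightarrow> (P h \<longleftrightarrow> P k)"
    and h: "h \<in> gspan S" "P h"
  shows "h \<in> gspan {s\<in>wball S 3. P s}"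
proof -
  let ?S0 = "{s\<in>wball S 3. P s}"
  have sg: "subgrp (gspan ?S0)" by (rule subgrp_gspan)
  have inS: "wball S n \<subseteq> gspan S" for n by (rule wball_gspan)
  have P0: "P 0" using P[of 0 0] subgrp_zero[OF subgrp_gspan[of S]] by simp
  have Pm: "P (- x) \<longleftrightarrow> P x" if "x \<in> gspan S" for x
    using P[OF that subgrp_minus[OF subgrp_gspan that]] P0 by simp
  have Pd: "P (x - y) \<longleftrightarrow> (P x \<longleftrightarrow> P y)" if "x \<in> gspan S" "y \<in> gspan S" for x y
    using P[OF that(1) subgrp_minus[OF subgrp_gspan that(2)]] Pm[OF that(2)] by simp
  show ?thesis
  proof (cases "\<forall>s\<in>S. P s")
    case True
    then have "S \<subseteq> ?S0" using wball_base wball_mono[of 1 3 S] by auto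
    then show ?thesis using gspan_mono h by blast
  next
    case False
    then obtain r where r: "r \<in> S" "\<not> P r" by blast
    have b1: "s \<in> wball S 1" "- s \<in> wball S 1" if "s \<in> S" for s using that wball_base wball_minus by blast+
    \<comment> \<open>The invariant places \<open>x\<close> in the subgroup or in its coset of
      \<open>r\<close>, according to its sign.\<close>
    have step: "(x + s \<in> gspan ?S0 \<and> P (x + s)) \<or> (x + s - r \<in> gspan ?S0 \<and> \<not> P (x + s))"
      if x: "(x \<in> gspan ?S0 \<and> P x) \<or> (x - r \<in> gspan ?S0 \<and> \<not> P x)" "x \<in> gspan S" and s: "s \<in> wball S 1" for x s
    proof -
      have rS: "r \<in> wball S 1" "- r \<in> wball S 1" "r \<in> gspan S" "s \<in> gspan S" using b1[OF r(1)] s inS by blast+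
      have m: "wball S 1 \<subseteq> wball S 3" "wball S 2 \<subseteq> wball S 3" by (rule wball_mono, simp)+
      have w2: "s - r \<in> wball S 3" "r + s \<in> wball S 3" "r + s - r \<in> wball S 3"
        using wball_diff[OF s rS(1)] wball_add[OF rS(1) s] wball_diff[OF wball_add[OF rS(1) s] rS(1)] m 
        by (auto simp: numeral_eq_Suc)
      show ?thesis
      proof (cases "P s")
        case Ps: True
        show ?thesis using x(1)
        proof
          assume a: "x \<in> gspan ?S0 \<and> P x"
          have "s \<in> gspan ?S0" using Ps s m by (intro gspan_base) auto
          then show ?thesis using a subgrp_add[OF sg] P[OF x(2) rS(4)] Ps by blast
        next
          assume a: "x - r \<in> gspan ?S0 \<and> \<not> P x"
          have "P (r + s - r)" using Pd[of "r + s" r] P[OF rS(3,4)] Ps r rS subgrp_add[OF subgrp_gspan] by blast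
          then have "r + s - r \<in> gspan ?S0" using w2 by (intro gspan_base) auto
          then have "(x - r) + (r + s - r) \<in> gspan ?S0" using a subgrp_add[OF sg] by blast
          moreover have "(x - r) + (r + s - r) = x + s - r" by (simp add: group_norm del: add_uminus_conv_diff)
          ultimately show ?thesis using a P[OF x(2) rS(4)] Ps by simp
        qed
      next
        case Ps: False
        show ?thesis using x(1)
        proof
          assume a: "x \<in> gspan ?S0 \<and> P x"
          have "P (s - r)" using Pd[OF rS(4,3)] Ps r by blast
          then have "s - r \<in> gspan ?S0" using w2 by (intro gspan_base) auto
          then have "x + (s - r) \<in> gspan ?S0" using a subgrp_add[OF sg] by blast
          then show ?thesis using a P[OF x(2) rS(4)] Ps by (simp add: add_diff_eq)
        next
          assume a: "x - r \<in> gspan ?S0 \<and> \<not> P x"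
          have "P (r + s)" using P[OF rS(3,4)] Ps r by blast
          then have "r + s \<in> gspan ?S0" using w2 by (intro gspan_base) auto
          then have "(x - r) + (r + s) \<in> gspan ?S0" using a subgrp_add[OF sg] by blast
          moreover have "(x - r) + (r + s) = x + s" by (simp add: group_norm del: add_uminus_conv_diff)
          ultimately show ?thesis using a P[OF x(2) rS(4)] Ps by simp
        qed
      qed
    qed
    have "(h \<in> gspan ?S0 \<and> P h) \<or> (h - r \<in> gspan ?S0 \<and> \<not> P h)"
      using h(1)
    proof (induction rule: gspan_right_induct)
      case zero
      then show ?case using P0 subgrp_zero[OF sg] by simp
    next
      case (add x s)
      show ?case using step[OF add.IH add.hyps(1) b1(1)[OF add.hyps(2)]] .
    next
      case (diff x s)
      show ?case using step[OF diff.IH diff.hyps(1) b1(2)[OF diff.hyps(2)]] by simp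
    qed
    then show ?thesis using h(2) by blast
  qed
qed

section \<open>Groups acting on trees\<close>

context tree_action
begin

lemma axis_fixed_action:
  assumes g: "g \<in> G" "axis g \<noteq> {}" and h: "h \<in> G" "comm h g"
  shows "act h ` axis g = axis g"
  using axis_conj_eq[OF g(1) h(1)] h(2) unfolding comm_iff_conj by simp

text \<open>Everything reduces to the stabilizer \<open>M c\<close> of the axis of a nonzero
  \<open>c\<close>. Freeness makes the kernel on the axis trivial and excludes reflections, so
  translation embeds \<open>M c\<close> into the integers. Commuting nonzero elements share their
  axis by \<open>two_axes\<close>, since a free pair cannot arise from commuting elements; an
  element that moves an axis gives short words by \<open>axis_moved\<close>.\<close>

lemma free_action_free_like:
  assumes free: "\<And>g x. g \<in> G \<Longrightarrow> x \<in> X \<Longrightarrow> act g x = x \<Longrightarrow> g = 0"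
    and inv: "\<And>g x. g \<in> G \<Longrightarrow> x \<in> X \<Longrightarrow> d x (act g x) = 1 \<Longrightarrow> act g (act g x) = x \<Longrightarrow> False"
    and ne: "X \<noteq> {}"
  shows "free_like G"
proof -
  have hyp: "axis c \<noteq> {}" if "c \<in> G" "c \<noteq> 0" for c
  proof -
    have "fixpts c = {}" using free that by (auto simp: fixpts_def)
    then show ?thesis using fix_or_hyperbolic[OF that(1) ne inv[OF that(1)]] hyperbolic_axis by simp
  qed
  define M where "M c = {h\<in>G. act h ` axis c = axis c}" for c
  have sM: "subgrp (M c)" for c
  proof (rule subgrpI)
    have im: "act (a + b) ` axis c = act a ` act b ` axis c" if "a \<in> G" "b \<in> G" for a b
      unfolding image_image using that by (intro image_cong) (auto simp: act_add)
    have i0: "act 0 ` axis c = axis c" 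
      using image_cong[OF HOL.refl, of "axis c" "act 0" "\<lambda>x. x"] act_zero axis_X by simp
    show "0 \<in> M c" using i0 by (simp add: M_def)
    show "a + b \<in> M c" if "a \<in> M c" "b \<in> M c" for a b using that im by (simp add: M_def)
    show "- a \<in> M c" if "a \<in> M c" for a
    proof -
      have "act (- a) ` act a ` axis c = axis c" using im[of "- a" a] that i0 by (simp add: M_def)
      then show ?thesis using that by (simp add: M_def)
    qed
  qed
  have M: "\<exists>\<tau> :: 'g \<Rightarrow> int. inj_on \<tau> (M c) \<and> (\<forall>a\<in>M c. \<forall>b\<in>M c. \<tau> (a + b) = \<tau> a + \<tau> b)" if c: "c \<in> G" "c \<noteq> 0" for c
  proof -
    have st: "act h x \<in> axis c" if "h \<in> M c" "x \<in> axis c" for h x using that by (auto simp: M_def)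
    have MG: "M c \<subseteq> G" unfolding M_def by blast
    obtain P :: "'g \<Rightarrow> bool" and \<tau> :: "'g \<Rightarrow> int" where
      1: "\<forall>h\<in>M c. \<forall>k\<in>M c. (P (h + k) \<longleftrightarrow> (P h \<longleftrightarrow> P k)) \<and> (P h \<and> P k \<longrightarrow> \<tau> (h + k) = \<tau> h + \<tau> k)" and
      2: "\<forall>h\<in>M c. (\<not> P h \<longrightarrow> \<tau> (h + h) = 0) \<and> (P h \<and> \<tau> h = 0 \<longleftrightarrow> (\<forall>x\<in>axis c. act h x = x))"
      using axis_stabilizer[OF c(1) hyp[OF c] MG st] by blast
    have P: "\<And>h k. h \<in> M c \<Longrightarrow> k \<in> M c \<Longrightarrow> P (h + k) \<longleftrightarrow> (P h \<longleftrightarrow> P k)"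
      and \<tau>: "\<And>h k. h \<in> M c \<Longrightarrow> k \<in> M c \<Longrightarrow> P h \<Longrightarrow> P k \<Longrightarrow> \<tau> (h + k) = \<tau> h + \<tau> k"
      and r: "\<And>h. h \<in> M c \<Longrightarrow> \<not> P h \<Longrightarrow> \<tau> (h + h) = 0"
      and k: "\<And>h. h \<in> M c \<Longrightarrow> P h \<and> \<tau> h = 0 \<longleftrightarrow> (\<forall>x\<in>axis c. act h x = x)"
      using 1 2 by simp_all
    have ker: "h = 0" if "h \<in> M c" "P h" "\<tau> h = 0" for h
      using k[OF that(1)] that free[of h] hyp[OF c] axis_X unfolding M_def by blast
    \<comment> \<open>A reflection would satisfy \<open>h + h = 0\<close>, yet every nonzero element
      is hyperbolic and so has infinite order.\<close>
    have Pall: "P h" if h: "h \<in> M c" for h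
    proof (rule ccontr)
      assume n: "\<not> P h"
      then have z: "h + h = 0" using ker[of "h + h"] P[OF h h] r[OF h] subgrp_add[OF sM h h] by blast
      have hG: "h \<in> G" using h by (simp add: M_def)
      have "h \<noteq> 0" using n P[OF h h] by auto
      then obtain x where x: "x \<in> X" "0 < d x (act h x)" "d x (act h (act h x)) = 2 * d x (act h x)" 
        using hyp[OF hG] unfolding axis_def by blast
      then have "act h (act h x) = x" using act_add[OF hG hG x(1)] z by simp
      then show False using x d_refl by simp
    qed
    have add: "\<tau> (a + b) = \<tau> a + \<tau> b" if "a \<in> M c" "b \<in> M c" for a b using \<tau> that Pall by blast
    have "inj_on \<tau> (M c)"
    proof (rule inj_onI)
      fix a b assume ab: "a \<in> M c" "b \<in> M c" "\<tau> a = \<tau> b"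
      then have "\<tau> (a - b) = 0" using additive_diff[OF sM add ab(1,2)] by simp
      then have "a - b = 0" using ker[of "a - b"] Pall subgrp_diff[OF sM ab(1,2)] by blast
      then show "a = b" by simp
    qed
    then show ?thesis using add by blast
  qed
  have Mab: "comm a b" if c: "c \<in> G" "c \<noteq> 0" and ab: "a \<in> M c" "b \<in> M c" for a b c
  proof -
    obtain \<tau> :: "'g \<Rightarrow> int" where \<tau>: "inj_on \<tau> (M c)" "\<forall>a\<in>M c. \<forall>b\<in>M c. \<tau> (a + b) = \<tau> a + \<tau> b" using M[OF c] by blast
    then have "\<tau> (a + b) = \<tau> (b + a)" using ab by simp
    then show ?thesis using inj_onD[OF \<tau>(1)] subgrp_add[OF sM] ab unfolding comm_def by blast
  qed
  have cM: "h \<in> M c" if "c \<in> G" "c \<noteq> 0" "h \<in> G" "comm h c" for h c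
    using axis_fixed_action[OF that(1) hyp[OF that(1,2)] that(3,4)] that(3) by (simp add: M_def)
  have ceq: "axis c = axis e" if ce: "c \<in> G" "c \<noteq> 0" "e \<in> G" "e \<noteq> 0" "comm c e" for c e
  proof -
    have *: "axis c \<subseteq> axis e" if ce: "c \<in> G" "c \<noteq> 0" "e \<in> G" "e \<noteq> 0" "comm c e" for c e
    proof
      fix x assume x: "x \<in> axis c"
      show "x \<in> axis e"
      proof (rule ccontr)
        assume "x \<notin> axis e"
        then have "short_free {c, e} 2" using two_axes[OF ce(1,3) x _ hyp[OF ce(3,4)]] by blast
        then show False by (rule short_free_not_comm) (use ce(5) comm_sym in auto)
      qed
    qed
    then show ?thesis using ce comm_sym by (intro equalityI) blast+
  qed
  show ?thesis
    unfolding free_like_def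
  proof (intro conjI ballI impI allI)
    fix a b assume ab: "a \<in> G" "b \<in> G"
    show "comm a b \<or> short_free {a, b} 6"
    proof (cases "a = 0")
      case False
      show ?thesis
      proof (cases "b \<in> M a")
        case True
        then show ?thesis using Mab[OF ab(1) False] cM[OF ab(1) False ab(1)] by simp
      next
        case nb: False
        then have "act b ` axis a \<noteq> axis a" using ab by (simp add: M_def)
        then show ?thesis using axis_moved[OF ab hyp[OF ab(1) False]] by blast
      qed
    qed simp
  next
    fix c k assume c: "c \<in> G" "k \<in> G" "c \<noteq> 0 \<and> comm (conjg k c) c"
    have n: "conjg k c \<noteq> 0" using c by (metis conjg_inj conjg_zero(2))
    have "axis (conjg k c) = axis c" using ceq[of "conjg k c" c] c n by simp
    then have "k \<in> M c" using axis_conj_eq[of c k] c by (simp add: M_def)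
    then show "comm k c" using Mab[of c k c] cM[of c c] c by simp
  next
    fix c a b assume "c \<in> G" "a \<in> G" "b \<in> G" "c \<noteq> 0 \<and> comm a c \<and> comm b c"
    then show "comm a b" using Mab cM by blast
  next
    fix K assume K: "subgrp K \<and> K \<subseteq> G \<and> (\<forall>a\<in>K. \<forall>b\<in>K. comm a b)"
    show "\<exists>\<tau> :: 'g \<Rightarrow> int. inj_on \<tau> K \<and> (\<forall>a\<in>K. \<forall>b\<in>K. \<tau> (a + b) = \<tau> a + \<tau> b)"
    proof (cases "K \<subseteq> {0}")
      case True
      then show ?thesis by (intro exI[of _ "\<lambda>_. 0"]) (auto simp: inj_on_def)
    next
      case False
      then obtain c where c: "c \<in> K" "c \<noteq> 0" by blast
      then have cG: "c \<in> G" using K by blast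
      have KM: "K \<subseteq> M c" using cM[OF cG c(2)] K c by blast
      obtain \<tau> :: "'g \<Rightarrow> int" where \<tau>: "inj_on \<tau> (M c)" "\<forall>a\<in>M c. \<forall>b\<in>M c. \<tau> (a + b) = \<tau> a + \<tau> b" using M[OF cG c(2)] by blast
      then show ?thesis using inj_on_subset[OF \<tau>(1) KM] KM by blast
    qed
  qed
qed

text \<open>In the line case a nontrivial commutator \<open>c\<close> of translations lies in the kernel \<open>K\<close>. If it
  commutes with its conjugates by the generators, then, since centralizers in a free group are
  malnormal, it centralizes all of \<open>K\<close>.\<close>

theorem tree_alternative:
  assumes inv: "\<And>g x. g \<in> G \<Longrightarrow> x \<in> X \<Longrightarrow> d x (act g x) = 1 \<Longrightarrow> act g (act g x) = x \<Longrightarrow> False"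
    and ne: "X \<noteq> {}"
    and vert: "\<And>x. x \<in> X \<Longrightarrow> alternative {g\<in>G. act g x = x}"
    and line: "\<And>g. g \<in> G \<Longrightarrow> axis g \<noteq> {} \<Longrightarrow> \<exists>x\<in>axis g. free_like {k\<in>G. act k x = x}"
  shows "alternative G"
  unfolding alternative_def
proof (intro allI impI)
  fix S assume S: "finite S \<and> S \<subseteq> G"
  let ?H = "gspan S"
  have sH: "subgrp ?H" by (rule subgrp_gspan)
  have HG: "?H \<subseteq> G" using gspan_least[OF subG] S by blast
  show "virt_abelian ?H \<or> short_free S 600"
  proof (cases "\<exists>x\<in>X. \<forall>s\<in>S. act s x = x")
    case True
    then obtain x where x: "x \<in> X" "\<And>s. s \<in> S \<Longrightarrow> act s x = x" by blast
    then have "S \<subseteq> {g\<in>G. act g x = x}" using S by blast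
    then show ?thesis using vert[OF x(1)] S unfolding alternative_def by blast
  next
    case False
    \<comment> \<open>If no generator and no product of two generators has an axis,
      \<open>common_fix\<close> produces a fixed vertex.\<close>
    have "\<exists>g\<in>wball S 2. axis g \<noteq> {}"
    proof (rule ccontr)
      assume n: "\<not> ?thesis"
      have w: "s \<in> wball S 2" "s + t \<in> wball S 2" if "s \<in> S" "t \<in> S" for s t
        using wball_add[OF wball_base wball_base, OF that] wball_base[OF that(1)] wball_mono[of 1 2 S] by (auto simp: numeral_2_eq_2)
      have "\<exists>x\<in>X. \<forall>s\<in>S. act s x = x"
      proof (rule common_fix)
        show "finite S" "S \<subseteq> G" "X \<noteq> {}" using S ne by auto
        show "fixpts s \<noteq> {}" if "s \<in> S" for s
        proof -
          have sG: "s \<in> G" using that S by blast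
          have "axis s = {}" using n w(1)[OF that that] by blast
          then show ?thesis using fix_or_hyperbolic[OF sG ne inv[OF sG]] unfolding hyperbolic_axis by simp
        qed
        show "\<not> hyperbolic (s + t)" if "s \<in> S" "t \<in> S" for s t
          unfolding hyperbolic_axis using n w(2)[OF that] by blast
      qed
      then show False using False by blast
    qed
    then obtain g where g: "g \<in> wball S 2" "axis g \<noteq> {}" by blast
    have gH: "g \<in> ?H" and gG: "g \<in> G" using g(1) wball_gspan HG by blast+
    show ?thesis
    proof (cases "\<exists>t\<in>S. act t ` axis g \<noteq> axis g")
      case True
      then obtain t where t: "t \<in> S" "act t ` axis g \<noteq> axis g" by blast
      then have "short_free {g, t} 6" using axis_moved[OF gG _ g(2) t(2)] S by blast
      moreover have "{g, t} \<subseteq> wball S 2" using g(1) t(1) wball_base[OF t(1)] wball_mono[of 1 2 S] by auto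
      ultimately have "short_free S (2 * 6)" by (rule short_free_wball)
      then show ?thesis using short_free_mono[of S "2 * 6" 600] by simp
    next
      case False
      have st: "act h x \<in> axis g" if "h \<in> ?H" "x \<in> axis g" for h x
        using that
      proof (induction h arbitrary: x rule: gspan_right_induct)
        case zero
        then show ?case by simp
      next
        case (add h s)
        have "act s x \<in> axis g" using False add.hyps(2) add.prems by blast
        moreover have "s \<in> G" "h \<in> G" using add.hyps S HG by blast+
        ultimately show ?case using add.IH act_add[of h s x] axis_X[OF add.prems] by simp
      next
        case (diff h s)
        have sG: "s \<in> G" and hG: "h \<in> G" using diff.hyps S HG by blast+
        obtain y where y: "y \<in> axis g" "x = act s y" using False diff.hyps(2) diff.prems by blast
        then have "act (- s) x = y" using sG by simp
        then show ?case using diff.IH[OF y(1)] act_diff[OF hG sG axis_X[OF diff.prems]] by simp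
      qed
      obtain P :: "'g \<Rightarrow> bool" and \<tau> :: "'g \<Rightarrow> int" where
        1: "\<forall>h\<in>?H. \<forall>k\<in>?H. (P (h + k) \<longleftrightarrow> (P h \<longleftrightarrow> P k)) \<and> (P h \<and> P k \<longrightarrow> \<tau> (h + k) = \<tau> h + \<tau> k)" and
        2: "\<forall>h\<in>?H. (\<not> P h \<longrightarrow> \<tau> (h + h) = 0) \<and> (P h \<and> \<tau> h = 0 \<longleftrightarrow> (\<forall>x\<in>axis g. act h x = x))"
        using axis_stabilizer[OF gG g(2) HG st] by blast
      have P: "\<And>h k. h \<in> ?H \<Longrightarrow> k \<in> ?H \<Longrightarrow> P (h + k) \<longleftrightarrow> (P h \<longleftrightarrow> P k)"
        and \<tau>: "\<And>h k. h \<in> ?H \<Longrightarrow> k \<in> ?H \<Longrightarrow> P h \<Longrightarrow> P k \<Longrightarrow> \<tau> (h + k) = \<tau> h + \<tau> k"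
        and ker: "\<And>h. h \<in> ?H \<Longrightarrow> P h \<and> \<tau> h = 0 \<longleftrightarrow> (\<forall>x\<in>axis g. act h x = x)"
        using 1 2 by simp_all
      define K where "K = {h\<in>?H. P h \<and> \<tau> h = 0}"
      \<comment> \<open>The kernel \<open>K\<close> fixes the axis pointwise, so it lies in the
        stabilizer of any single axis point; one of edge type suffices.\<close>
      obtain x where x: "x \<in> axis g" "free_like {k\<in>G. act k x = x}" using line[OF gG g(2)] by blast
      have "K \<subseteq> {k\<in>G. act k x = x}" using ker HG x(1) unfolding K_def by blast
      then have fK: "free_like K" using free_like_mono x(2) by blast
      have P0: "P 0" using P[of 0 0] subgrp_zero[OF sH] by simp
      have Pm: "P (- h) \<longleftrightarrow> P h" if "h \<in> ?H" for h
        using P[OF that subgrp_minus[OF sH that]] P0 by simp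
      define H0 where "H0 = {h\<in>?H. P h}"
      have sH0: "subgrp H0" unfolding H0_def
        using sH P P0 Pm by (intro subgrpI) (auto simp: subgrp_zero subgrp_add subgrp_minus)
      have \<tau>0: "\<And>h k. h \<in> H0 \<Longrightarrow> k \<in> H0 \<Longrightarrow> \<tau> (h + k) = \<tau> h + \<tau> k" using \<tau> by (simp add: H0_def)
      have KH0: "K = {h\<in>H0. \<tau> h = 0}" by (auto simp: H0_def K_def)
      have sK: "subgrp K" unfolding KH0 using sH0 \<tau>0 additive_zero[OF sH0 \<tau>0] additive_minus[OF sH0 \<tau>0] 
        by (intro subgrpI) (auto simp: subgrp_zero subgrp_add subgrp_minus)
      have Kn: "conjg h k \<in> K" if h: "h \<in> ?H" and k: "k \<in> K" for h k
      proof -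
        have kH: "k \<in> ?H" using k by (simp add: K_def)
        have kf: "act k y = y" if "y \<in> axis g" for y using ker[OF kH] k that unfolding K_def by blast
        have cH: "conjg h k \<in> ?H" unfolding conjg_def using sH h kH by (intro subgrp_add subgrp_diff)
        have "act (conjg h k) y = y" if y: "y \<in> axis g" for y
        proof -
          have hG: "h \<in> G" "- h \<in> G" "k \<in> G" using h kH HG by auto
          have "act (- h) y \<in> axis g" using st subgrp_minus[OF sH h] y by blast
          then have "act k (act (- h) y) = act (- h) y" using kf by blast
          then show ?thesis unfolding conjg_def using act_diff[of "h + k" h y] act_add[OF hG(1,3), of "act (- h) y"] hG axis_X[OF y] by simp
        qed
        then show ?thesis using ker[OF cH] cH unfolding K_def by blast
      qed
      have fin: "virt_abelian ?H" if Kab: "\<And>a b. a \<in> K \<Longrightarrow> b \<in> K \<Longrightarrow> comm a b"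
      proof -
        obtain \<sigma> :: "'g \<Rightarrow> int" where "inj_on \<sigma> K" "\<And>a b. a \<in> K \<Longrightarrow> b \<in> K \<Longrightarrow> \<sigma> (a + b) = \<sigma> a + \<sigma> b"
          using free_like_embed[OF fK sK _ Kab] by blast
        then show ?thesis using virt_abelian_line[OF sH P \<tau> K_def Kab] by blast
      qed
      let ?S0 = "{s\<in>wball S 3. P s}"
      have H0: "H0 \<subseteq> gspan ?S0" using index_two_generators[of S P] P unfolding H0_def by blast
      show ?thesis
      proof (cases "\<forall>s\<in>?S0. \<forall>t\<in>?S0. comm s t")
        case True
        then have "comm a b" if "a \<in> H0" "b \<in> H0" for a b using gspan_comm[of ?S0 a b] that H0 by blast
        then show ?thesis using fin unfolding KH0 by blast
      next
        case False
        then obtain s t where s: "s \<in> wball S 3" "P s" and t: "t \<in> wball S 3" "P t" and nst: "\<not> comm s t" by blast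
        have stH: "s \<in> H0" "t \<in> H0" using s t wball_gspan unfolding H0_def by blast+
        \<comment> \<open>Translations commute modulo \<open>K\<close>, since \<open>\<tau>\<close>
          is additive with values in the integers. So this commutator of two words of length 3 is an
          element of \<open>K\<close> of length 12.\<close>
        define c where "c = s + t - s - t"
        have cw: "c \<in> wball S 12" unfolding c_def
          using wball_diff[OF wball_diff[OF wball_add[OF s(1) t(1)] s(1)] t(1)] by simp
        have H0d: "a - b \<in> H0" "a + b \<in> H0" if "a \<in> H0" "b \<in> H0" for a b using that subgrp_diff[OF sH0] subgrp_add[OF sH0] by auto
        have "\<tau> c = 0" unfolding c_def
          using stH H0d \<tau>0 additive_diff[OF sH0 \<tau>0] by simp
        moreover have "c \<in> H0" unfolding c_def using stH H0d by simp
        ultimately have cK: "c \<in> K" unfolding KH0 by simp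
        have c0: "c \<noteq> 0"
        proof
          assume "c = 0"
          then have "s + t - s = t" unfolding c_def by simp
          then show False using nst unfolding comm_def by (simp add: diff_eq_eq)
        qed
        show ?thesis
        proof (cases "\<exists>r\<in>S. \<not> comm (conjg r c) c")
          case True
          then obtain r where r: "r \<in> S" "\<not> comm (conjg r c) c" by blast
          have "conjg r c \<in> K" using Kn[OF gspan_base[OF r(1)] cK] .
          then have "short_free {c, conjg r c} 6" using free_like_short[OF fK cK] r(2) comm_sym by blast
          \<comment> \<open>One more letter on either side gives 14, and the dichotomy in the edge
            group multiplies by 6.\<close>
          moreover have "{c, conjg r c} \<subseteq> wball S 14"
          proof -
            have "conjg r c \<in> wball S 14" unfolding conjg_def
              using wball_diff[OF wball_add[OF wball_base[OF r(1)] cw] wball_base[OF r(1)]] by simp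
            then show ?thesis using cw wball_mono[of 12 14 S] by auto
          qed
          ultimately have "short_free S (14 * 6)" by (rule short_free_wball)
          then show ?thesis using short_free_mono[of S "14 * 6" 600] by simp
        next
          case False
          have cj: "conjg h c \<noteq> 0" for h using c0 by (metis conjg_inj conjg_zero(2))
          \<comment> \<open>Commuting with a fixed nonzero element is a transitive relation in
            \<open>K\<close>, so the property passes from the generators to products, and with
            \<open>inv'\<close> to all of the group.\<close>
          have step: "comm (conjg (r + h) c) c" if r: "r \<in> ?H" "comm (conjg r c) c" and h: "h \<in> ?H" "comm (conjg h c) c" for r h
          proof -
            have "comm (conjg r (conjg h c)) (conjg r c)" using comm_conj[OF h(2)] .
            then have "comm (conjg (r + h) c) (conjg r c)" by (simp add: conjg_conjg)
            moreover have "conjg (r + h) c \<in> K" "conjg r c \<in> K" using Kn[OF _ cK] subgrp_add[OF sH r(1) h(1)] r by auto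
            ultimately show ?thesis using free_like_trans[OF fK _ _ cK cj, of r "conjg (r + h) c"] r(2) comm_sym by blast
          qed
          have inv': "comm (conjg (- r) c) c" if "comm (conjg r c) c" for r
            using comm_conj[OF that, of "- r"] comm_sym[of c "conjg (- r) c"] by simp
          have all: "comm (conjg h c) c" if "h \<in> ?H" for h
            using that
          proof (induction rule: gspan_left_induct)
            case (add h s)
            then show ?case using step[of s h] False gspan_base by blast
          next
            case (minus h s)
            then show ?case using step[of "- s" h] False inv' gspan_base subgrp_minus[OF sH] by blast
          qed simp
          \<comment> \<open>Now \<open>h\<close> may be taken in \<open>K\<close> itself, which is
            the situation of \<open>free_like_malnormal\<close>.\<close>
          have "comm k c" if "k \<in> K" for k
            using free_like_malnormal[OF fK cK that c0] all that unfolding K_def by blast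
          then have "comm a b" if "a \<in> K" "b \<in> K" for a b
            using free_like_trans[OF fK cK that c0] that by blast
          then show ?thesis using fin by blast
        qed
      qed
    qed
  qed
qed

end

section \<open>Trees of words and free groups\<close>

fun lcp :: "'b list \<Rightarrow> 'b list \<Rightarrow> nat" where
  "lcp (x # xs) (y # ys) = (if x = y then Suc (lcp xs ys) else 0)"
| "lcp _ _ = 0"

text \<open>Path distance in the tree of all lists, where the parent of a list is obtained by
  dropping its last entry.\<close>

definition ldist :: "'b list \<Rightarrow> 'b list \<Rightarrow> int" where
  "ldist u v = int (length u) + int (length v) - 2 * int (lcp u v)"

lemma lcp_Nil [simp]: "lcp u [] = 0" by (cases u) auto

lemma lcp_sym: "lcp u v = lcp v u"
  by (induction u v rule: lcp.induct) auto

lemma lcp_le: "lcp u v \<le> length u" "lcp u v \<le> length v"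
  by (induction u v rule: lcp.induct) auto

lemma lcp_refl [simp]: "lcp u u = length u"
  by (induction u) auto

lemma lcp_ultra: "min (lcp u v) (lcp v w) \<le> lcp u w"
proof (induction u v arbitrary: w rule: lcp.induct)
  case (1 x xs y ys)
  show ?case using 1 by (cases w) auto
qed auto

lemma lcp_full: "lcp u v = length u \<Longrightarrow> lcp u v = length v \<Longrightarrow> u = v"
  by (induction u v rule: lcp.induct) (auto split: if_splits)

lemma lcp_take: "lcp (take k u) v = min k (lcp u v)"
proof (induction u v arbitrary: k rule: lcp.induct)
  case (1 x xs y ys)
  then show ?case by (cases k) auto
qed auto

lemma lcp_append: "lcp u (u @ v) = length u"
  by (induction u) auto

lemma ldist_append [simp]: "ldist u (u @ v) = int (length v)" "ldist (u @ v) u = int (length v)"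
  using lcp_append[of u v] lcp_sym[of "u @ v" u] by (auto simp: ldist_def)

lemma ldist_one: "ldist u v = 1 \<longleftrightarrow> (\<exists>a. v = u @ [a]) \<or> (\<exists>a. u = v @ [a])"
proof
  assume 1: "ldist u v = 1"
  have pre: "\<exists>a. v = u @ [a]" if "lcp u v = length u" "length v = Suc (length u)" for u v :: "'a list"
    using that
  proof (induction u v rule: lcp.induct)
    case (1 x xs y ys)
    then show ?case by (auto split: if_splits)
  qed (auto simp: length_Suc_conv)
  have "(lcp u v = length u \<and> length v = Suc (length u)) \<or> (lcp u v = length v \<and> length u = Suc (length v))"
    using 1 lcp_le[of u v] unfolding ldist_def by presburger
  then show "(\<exists>a. v = u @ [a]) \<or> (\<exists>a. u = v @ [a])" using pre[of u v] pre[of v u] lcp_sym[of u v] by auto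
qed auto

text \<open>The lengths cancel, and the ultrametric inequality for common prefixes remains.\<close>

lemma ldist_four: "ldist x y + ldist z w \<le> max (ldist x z + ldist y w) (ldist x w + ldist y z)"
proof -
  have *: "min (int (lcp a b)) (int (lcp b c)) \<le> int (lcp a c)" for a b c :: "'a list"
    using lcp_ultra[of a b c] by linarith
  show ?thesis unfolding ldist_def
    using *[of x z y] *[of x w y] *[of z x w] *[of z y w]
    by (simp add: lcp_sym[of y x] lcp_sym[of z x] lcp_sym[of w x] lcp_sym[of z y] lcp_sym[of w y] lcp_sym[of w z])
qed

text \<open>A prefix-closed set of addresses is a subtree. A geodesic climbs from one list to the
  common prefix and descends to the other.\<close>

lemma list_tree:
  assumes inj: "inj_on addr X" and pre: "\<And>x k. x \<in> X \<Longrightarrow> \<exists>y\<in>X. addr y = take k (addr x)"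
  shows "metric_tree X (\<lambda>x y. ldist (addr x) (addr y))"
proof
  fix x y z w assume X: "x \<in> X" "y \<in> X" "z \<in> X" 
  show "ldist (addr x) (addr x) = 0" by (simp add: ldist_def)
  show "0 \<le> ldist (addr x) (addr y)" using lcp_le[of "addr x" "addr y"] by (simp add: ldist_def)
  show "ldist (addr x) (addr y) = ldist (addr y) (addr x)" by (simp add: ldist_def lcp_sym)
  show "even (ldist (addr x) (addr y) + ldist (addr y) (addr z) + ldist (addr x) (addr z))" by (simp add: ldist_def)
  show "ldist (addr x) (addr y) + ldist (addr z) (addr w)
    \<le> max (ldist (addr x) (addr z) + ldist (addr y) (addr w)) (ldist (addr x) (addr w) + ldist (addr y) (addr z))"
    by (rule ldist_four)
next
  fix x y assume X: "x \<in> X" "y \<in> X" "ldist (addr x) (addr y) = 0"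
  then have "addr x = addr y" using lcp_le[of "addr x" "addr y"] by (intro lcp_full) (simp_all add: ldist_def)
  then show "x = y" using inj X by (simp add: inj_on_def)
next
  fix x y and k :: int assume X: "x \<in> X" "y \<in> X" and k: "0 \<le> k" "k \<le> ldist (addr x) (addr y)"
  let ?u = "addr x" and ?v = "addr y"
  let ?c = "lcp ?u ?v"
  note le = lcp_le[of ?u ?v]
  show "\<exists>z\<in>X. ldist ?u (addr z) = k \<and> ldist (addr z) ?v = ldist ?u ?v - k"
  proof (cases "k \<le> int (length ?u) - int ?c")
    case True
    \<comment> \<open>Still on the climbing part: \<open>k\<close> entries are dropped.\<close>
    define n where "n = length ?u - nat k"
    have n: "int n = int (length ?u) - k" "n \<ge> ?c" "n \<le> length ?u" using True k le unfolding n_def by linarith+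
    obtain z where z: "z \<in> X" "addr z = take n ?u" using pre[OF X(1)] by blast
    have "lcp ?u (take n ?u) = n" using lcp_take[of n ?u ?u] n lcp_sym[of ?u] by simp
    moreover have "lcp (take n ?u) ?v = ?c" using lcp_take[of n ?u ?v] n by simp
    ultimately show ?thesis using z n by (intro bexI[of _ z]) (simp_all add: ldist_def)
  next
    case False
    \<comment> \<open>The climb to the common prefix uses up \<open>length ?u - ?c\<close> steps;
      the remaining steps are added to its length \<open>?c\<close>.\<close>
    define n where "n = nat (k - int (length ?u) + 2 * int ?c)"
    have n: "int n = k - int (length ?u) + 2 * int ?c" "n \<ge> ?c" "n \<le> length ?v" using False k le unfolding n_def ldist_def by linarith+
    obtain z where z: "z \<in> X" "addr z = take n ?v" using pre[OF X(2)] by blast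
    have "lcp (take n ?v) ?v = n" using lcp_take[of n ?v ?v] n by simp
    moreover have "lcp ?u (take n ?v) = ?c" using lcp_take[of n ?v ?u] lcp_sym[of ?u] n by simp
    ultimately show ?thesis using z n by (intro bexI[of _ z]) (simp_all add: ldist_def)
  qed
qed

context metric_tree
begin

lemma adjacency_lipschitz:
  assumes "\<And>x. x \<in> X \<Longrightarrow> \<phi> x \<in> X" "\<And>x y. x \<in> X \<Longrightarrow> y \<in> X \<Longrightarrow> d x y = 1 \<Longrightarrow> d (\<phi> x) (\<phi> y) = 1"
    and "x \<in> X" "y \<in> X"
  shows "d (\<phi> x) (\<phi> y) \<le> d x y"
  using assms(3,4)
proof (induction "nat (d x y)" arbitrary: y)
  case 0
  then have "x = y" using d_eq d_nonneg[of x y] by simp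
  then show ?case using 0 d_refl assms(1) by simp
next
  case (Suc n)
  then have k: "0 \<le> int n" "int n \<le> d x y" "d x y = int n + 1" by linarith+
  obtain z where z: "z \<in> X" "d x z = int n" "d z y = d x y - int n" using geod[OF Suc.prems k(1,2)] by blast
  then have "d (\<phi> x) (\<phi> z) \<le> d x z" using Suc.hyps(1)[of z] Suc.prems by simp
  moreover have "d (\<phi> z) (\<phi> y) = 1" using assms(2)[of z y] z k Suc.prems by simp
  ultimately show ?case using tri[of "\<phi> x" "\<phi> z" "\<phi> y"] assms(1) z k Suc.prems by force
qed

text \<open>Preserving adjacency is enough: by \<open>adjacency_lipschitz\<close> a group element
  and its inverse both do not increase distances.\<close>

lemma tree_actionI:
  fixes G :: "'g::group_add set"
  assumes "subgrp G" "\<And>g x. g \<in> G \<Longrightarrow> x \<in> X \<Longrightarrow> act g x \<in> X"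
    "\<And>g h x. g \<in> G \<Longrightarrow> h \<in> G \<Longrightarrow> x \<in> X \<Longrightarrow> act (g + h) x = act g (act h x)"
    "\<And>x. x \<in> X \<Longrightarrow> act 0 x = x"
    and adj: "\<And>g x y. g \<in> G \<Longrightarrow> x \<in> X \<Longrightarrow> y \<in> X \<Longrightarrow> d x y = 1 \<Longrightarrow> d (act g x) (act g y) = 1"
  shows "tree_action X d G act"
proof
  show "d (act g x) (act g y) = d x y" if g: "g \<in> G" and x: "x \<in> X" and y: "y \<in> X" for g x y
  proof (rule antisym)
    show "d (act g x) (act g y) \<le> d x y" 
      by (rule adjacency_lipschitz[of "act g"]) (use assms that in auto)
    have m: "- g \<in> G" using assms(1) g subgrp_minus by blast
    have i: "act (- g) (act g z) = z" if "z \<in> X" for z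
      using assms(3)[OF m g that] assms(4)[OF that] by simp
    have "d (act (- g) (act g x)) (act (- g) (act g y)) \<le> d (act g x) (act g y)"
      by (rule adjacency_lipschitz[of "act (- g)"]) (use assms that m in auto)
    then show "d x y \<le> d (act g x) (act g y)" using i x y by simp
  qed
qed (use assms in auto)

end

section \<open>Words in generators, reduced words and free groups\<close>

definition evalw :: "('v \<Rightarrow> 'g::group_add) \<Rightarrow> 'v word \<Rightarrow> 'g" where
  "evalw f w = sum_list (map (\<lambda>(x, b). if b then f x else - f x) w)"

lemma evalw_Nil [simp]: "evalw f [] = 0"
  and evalw_Cons: "evalw f (l # w) = evalw f [l] + evalw f w"
  and evalw_append [simp]: "evalw f (u @ w) = evalw f u + evalw f w"
  by (simp_all add: evalw_def)

lemma evalw_inv_letter: "evalw f [inv_letter l] = - evalw f [l]"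
  by (cases l) (auto simp: evalw_def inv_letter_def)

lemma evalw_inv_word: "evalw f (map inv_letter (rev u)) = - evalw f u"
proof (induction u)
  case (Cons l u)
  then show ?case by (simp add: evalw_inv_letter evalw_Cons[of f l u] minus_add)
qed simp

lemma gspan_evalw: "gspan (f ` L) = evalw f ` words_on L"
proof (intro equalityI subsetI)
  fix x assume "x \<in> gspan (f ` L)"
  then obtain xs where xs: "x = sum_list xs" "set xs \<subseteq> f ` L \<union> uminus ` f ` L" by (auto simp: gspan_def)
  have "\<exists>w\<in>words_on L. sum_list xs = evalw f w" using xs(2)
  proof (induction xs)
    case Nil
    then show ?case by (intro bexI[of _ "[]"]) auto
  next
    case (Cons y ys)
    then obtain w where w: "w \<in> words_on L" "sum_list ys = evalw f w" by auto
    obtain v where v: "v \<in> L" "y = f v \<or> y = - f v" using Cons.prems by auto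
    then have "y = evalw f [(v, True)] \<or> y = evalw f [(v, False)]" by (auto simp: evalw_def)
    then obtain b where "y = evalw f [(v, b)]" by blast
    then have "sum_list (y # ys) = evalw f ((v, b) # w)" using w by (simp add: evalw_Cons[of f _ w])
    then show ?case using v w by (intro bexI[of _ "(v, b) # w"]) auto
  qed
  then show "x \<in> evalw f ` words_on L" using xs by auto
next
  fix x assume "x \<in> evalw f ` words_on L"
  then obtain w where w: "w \<in> words_on L" "x = evalw f w" by blast
  have "evalw f w \<in> gspan (f ` L)" using w(1)
  proof (induction w)
    case Nil
    then show ?case using subgrp_zero[OF subgrp_gspan] by simp
  next
    case (Cons l w)
    have "f (fst l) \<in> gspan (f ` L)" using Cons.prems by (intro gspan_base) auto
    then have "evalw f [l] \<in> gspan (f ` L)" using subgrp_minus[OF subgrp_gspan] by (cases l) (auto simp: evalw_def)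
    then show ?case using Cons subgrp_add[OF subgrp_gspan] by (auto simp: evalw_Cons[of f l w])
  qed
  then show "x \<in> gspan (f ` L)" using w by simp
qed

fun reduced :: "'v word \<Rightarrow> bool" where
  "reduced (l # k # w) \<longleftrightarrow> k \<noteq> inv_letter l \<and> reduced (k # w)"
| "reduced _ \<longleftrightarrow> True"

lemma reduced_append:
  "reduced (u @ w) \<longleftrightarrow> reduced u \<and> reduced w \<and> (u \<noteq> [] \<and> w \<noteq> [] \<longrightarrow> hd w \<noteq> inv_letter (last u))"
proof (induction u rule: reduced.induct)
  case ("2_2" l)
  then show ?case by (cases w) auto
qed auto

lemma inv_letter_inj [simp]: "inv_letter a = inv_letter b \<longleftrightarrow> a = b"
  by (metis inv_letter_inv_letter)

lemma reduced_inv_word: "reduced u \<Longrightarrow> reduced (map inv_letter (rev u))"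
proof (induction u)
  case (Cons l u)
  have "reduced u" using Cons.prems by (cases u) auto
  moreover have "u \<noteq> [] \<longrightarrow> inv_letter l \<noteq> inv_letter (last (map inv_letter (rev u)))"
    using Cons.prems by (cases u) (auto simp: last_map last_rev)
  ultimately show ?case using Cons.IH by (simp add: reduced_append)
qed simp

text \<open>Cancellation is a matter of spelling only, so one reduced word serves all
  \<open>f\<close> at once. The final disjunction says that the new word is a neighbour of the old
  one in the tree of reduced words.\<close>

lemma reduced_extend:
  assumes "(w :: 'v word) \<in> words_on L" "reduced w" "fst l \<in> L"
  shows "\<exists>v. v \<in> words_on L \<and> reduced v \<and> (\<forall>f :: 'v \<Rightarrow> 'g::group_add. evalw f v = evalw f w + evalw f [l]) \<and>
    (v = w @ [l] \<or> w = v @ [inv_letter l])"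
proof (cases "w \<noteq> [] \<and> last w = inv_letter l")
  case True
  then have w: "w = butlast w @ [inv_letter l]" by (metis append_butlast_last_id)
  have "butlast w @ [inv_letter l] \<in> words_on L" "reduced (butlast w @ [inv_letter l])" using w assms by simp_all
  then have "butlast w \<in> words_on L" "reduced (butlast w)" by (simp_all only: words_on_append reduced_append)
  moreover have "evalw f (butlast w) = evalw f w + evalw f [l]" for f :: "'v \<Rightarrow> 'g"
  proof -
    have "evalw f w = evalw f (butlast w) + evalw f [inv_letter l]" using w evalw_append by metis
    then show ?thesis by (simp add: evalw_inv_letter)
  qed
  ultimately show ?thesis using w by blast
next
  case False
  then have "reduced (w @ [l])" using assms by (auto simp: reduced_append)
  then show ?thesis using assms by (intro exI[of _ "w @ [l]"]) auto
qed

lemma reduced_exists: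
  assumes "(w :: 'v word) \<in> words_on L"
  shows "\<exists>v. v \<in> words_on L \<and> reduced v \<and> (\<forall>f :: 'v \<Rightarrow> 'g::group_add. evalw f v = evalw f w)"
  using assms
proof (induction w rule: rev_induct)
  case Nil
  show ?case by (intro exI[of _ "[]"]) auto
next
  case (snoc l w)
  then obtain v where v: "v \<in> words_on L" "reduced v" "\<forall>f :: 'v \<Rightarrow> 'g. evalw f v = evalw f w" by auto
  moreover have "fst l \<in> L" using snoc.prems by auto
  ultimately show ?case using reduced_extend[of v L l] by (metis evalw_append)
qed

text \<open>The group acts freely by left translation on its Cayley tree. The vertices are the group
  elements, addressed by their reduced words \<open>nf\<close>.\<close>

lemma free_group_free_like:
  fixes f :: "'v \<Rightarrow> 'g::group_add"
  assumes free: "\<And>w. w \<in> words_on L \<Longrightarrow> reduced w \<Longrightarrow> w \<noteq> [] \<Longrightarrow> evalw f w \<noteq> 0"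
  shows "free_like (gspan (f ` L))"
proof -
  let ?G = "gspan (f ` L)"
  have uniq: "u = v" if "u \<in> words_on L" "reduced u" "v \<in> words_on L" "reduced v" "evalw f u = evalw f v" for u v
    using that
  proof (induction u arbitrary: v)
    case Nil
    then show ?case using free[of v] by auto
  next
    case (Cons l u)
    show ?case
    proof (cases v)
      case Nil
      then show ?thesis using free[of "l # u"] Cons.prems by auto
    next
      case v: (Cons k w)
      have r: "reduced u" "reduced w" using Cons.prems v by (cases u; cases w; auto)+
      show ?thesis
      proof (cases "k = l")
        case True
        then have "evalw f u = evalw f w" using Cons.prems(5) v by (simp add: evalw_Cons[of f _ u] evalw_Cons[of f _ w])
        then show ?thesis using Cons.IH[of w] r Cons.prems v True by simp
      next
        case False
        let ?w = "map inv_letter (rev (l # u)) @ v"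
        have "reduced ?w" using reduced_inv_word[OF Cons.prems(2)] Cons.prems(4) False v
          unfolding reduced_append by (simp add: last_map last_rev)
        moreover have "?w \<in> words_on L" using words_on_inverse[OF Cons.prems(1)] Cons.prems(3) words_on_append by blast
        moreover have "evalw f ?w = 0" unfolding evalw_append evalw_inv_word using Cons.prems(5) by simp
        ultimately show ?thesis using free[of ?w] by simp
      qed
    qed
  qed
  have ex: "\<exists>v. v \<in> words_on L \<and> reduced v \<and> evalw f v = evalw f w" if "w \<in> words_on L" for w
    using reduced_exists[OF that] by blast
  define nf where "nf g = (SOME v. v \<in> words_on L \<and> reduced v \<and> evalw f v = g)" for g
  have nf: "nf g \<in> words_on L" "reduced (nf g)" "evalw f (nf g) = g" if "g \<in> ?G" for g
    using someI_ex[of "\<lambda>v. v \<in> words_on L \<and> reduced v \<and> evalw f v = g"] ex that unfolding nf_def gspan_evalw by auto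
  have nfE: "nf (evalw f v) = v" if "v \<in> words_on L" "reduced v" for v
    using uniq[OF nf(1,2) that nf(3)] that unfolding gspan_evalw by blast
  have wG: "evalw f v \<in> ?G" if "v \<in> words_on L" for v using that unfolding gspan_evalw by blast
  interpret metric_tree ?G "\<lambda>x y. ldist (nf x) (nf y)"
  proof (rule list_tree)
    show "inj_on nf ?G" by (rule inj_onI) (metis nf(3))
    fix x k assume x: "x \<in> ?G"
    have "take k (nf x) @ drop k (nf x) \<in> words_on L" "reduced (take k (nf x) @ drop k (nf x))" using nf[OF x] by simp_all
    then have "take k (nf x) \<in> words_on L" "reduced (take k (nf x))" by (simp_all only: words_on_append reduced_append)
    then show "\<exists>y\<in>?G. nf y = take k (nf x)" using nfE wG by blast
  qed
  have adj: "ldist (nf x) (nf y) = 1 \<longleftrightarrow> (\<exists>l. fst l \<in> L \<and> y = x + evalw f [l])" if x: "x \<in> ?G" and y: "y \<in> ?G" for x y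
  proof
    assume "ldist (nf x) (nf y) = 1"
    then consider l where "nf y = nf x @ [l]" | l where "nf x = nf y @ [l]" unfolding ldist_one by blast
    then show "\<exists>l. fst l \<in> L \<and> y = x + evalw f [l]"
    proof cases
      case 1
      then have "y = x + evalw f [l]" "fst l \<in> L" using nf[OF x] nf[OF y] evalw_append[of f "nf x" "[l]"] by auto
      then show ?thesis by blast
    next
      case 2
      then have "x = y + evalw f [l]" "fst l \<in> L" using nf[OF x] nf[OF y] evalw_append[of f "nf y" "[l]"] by auto
      then have "y = x + evalw f [inv_letter l]" "fst (inv_letter l) \<in> L" by (simp_all add: evalw_inv_letter)
      then show ?thesis by blast
    qed
  next
    assume "\<exists>l. fst l \<in> L \<and> y = x + evalw f [l]"
    then obtain l where l: "fst l \<in> L" "y = x + evalw f [l]" by blast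
    then obtain v where v: "v \<in> words_on L" "reduced v" "evalw f v = evalw f (nf x) + evalw f [l]" "v = nf x @ [l] \<or> nf x = v @ [inv_letter l]"
      using reduced_extend[OF nf(1,2)[OF x]] by blast
    then have "nf y = v" using nfE[of v] l nf(3)[OF x] by simp
    then show "ldist (nf x) (nf y) = 1" using v(4) unfolding ldist_one by blast
  qed
  have lin: "evalw f [l] \<in> ?G" if "fst l \<in> L" for l using wG[of "[l]"] that by simp
  interpret tree_action ?G "\<lambda>x y. ldist (nf x) (nf y)" ?G "(+)"
  proof (rule tree_actionI)
    fix g x y assume 1: "g \<in> ?G" "x \<in> ?G" "y \<in> ?G" "ldist (nf x) (nf y) = 1"
    have "g + x \<in> ?G" "g + y \<in> ?G" using 1 subgrp_add[OF subgrp_gspan] by blast+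
    then show "ldist (nf (g + x)) (nf (g + y)) = 1" using adj[of x y] adj[of "g + x" "g + y"] 1 by (auto simp: add.assoc)
  qed (auto simp: subgrp_gspan add.assoc intro: subgrp_add[OF subgrp_gspan])
  show ?thesis
  proof (rule free_action_free_like)
    show "g = 0" if "g + x = x" for g x :: 'g
      using that add_right_cancel[of g x 0] by simp
    show "?G \<noteq> {}" using subgrp_zero[OF subgrp_gspan] by blast
    fix g x assume g: "g \<in> ?G" and x: "x \<in> ?G" and 1: "ldist (nf x) (nf (g + x)) = 1" "g + (g + x) = x"
    obtain l where l: "fst l \<in> L" "g + x = x + evalw f [l]" using adj[OF x subgrp_add[OF subgrp_gspan g x]] 1 by blast
    \<comment> \<open>An inverted edge with label \<open>l\<close> would make \<open>l\<close> an
      involution, although \<open>[l, l]\<close> is reduced.\<close>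
    have "x + (evalw f [l] + evalw f [l]) = g + x + evalw f [l]" by (metis add.assoc l(2))
    also have "\<dots> = g + (g + x)" by (metis add.assoc l(2))
    finally have "evalw f [l] + evalw f [l] = 0"
      using 1 add_left_cancel[of x "evalw f [l] + evalw f [l]" 0] by simp
    then have "evalw f [l, l] = 0" by (simp add: evalw_Cons[of f l "[l]"])
    moreover have "l \<noteq> inv_letter l" by (cases l) (simp add: inv_letter_def)
    ultimately show False using free[of "[l, l]"] l by simp
  qed
qed

section \<open>The tree of an amalgamated product\<close>

lemma coset_eq: "subgrp K \<Longrightarrow> (+) g ` K = (+) h ` K \<longleftrightarrow> - g + h \<in> K"
proof
  assume K: "subgrp K" and "(+) g ` K = (+) h ` K"
  moreover have "h + 0 \<in> (+) h ` K" using subgrp_zero[OF K] by (rule imageI)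
  ultimately obtain k where "k \<in> K" "h = g + k" by auto
  then show "- g + h \<in> K" by simp
next
  have *: "(+) h ` K \<subseteq> (+) g ` K" if K: "subgrp K" and "- g + h \<in> K" for g h
  proof
    fix x assume "x \<in> (+) h ` K"
    then obtain k where "k \<in> K" "x = h + k" by blast
    moreover from this have "- g + h + k \<in> K" using that subgrp_add by blast
    moreover have "h + k = g + (- g + h + k)" by (simp add: add.assoc)
    ultimately show "x \<in> (+) g ` K" by blast
  qed
  assume K: "subgrp K" "- g + h \<in> K"
  have "- (- g + h) = - h + g" by (simp add: minus_add)
  then have "- h + g \<in> K" using subgrp_minus[OF K] by simp
  then show "(+) g ` K = (+) h ` K" using *[OF K] *[of h g] K by blast
qed

text \<open>The normal form theorem taken as an internal definition: by \<open>alternating\<close>,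
  subgroups of one ambient group span their amalgamated product over \<open>C\<close>. Arbitrarily
  many factors are allowed, so that a star with all its edges is a single amalgam.\<close>

locale amalgam =
  fixes G :: "'i \<Rightarrow> 'g::group_add set" and I :: "'i set" and C :: "'g set"
  assumes subG: "i \<in> I \<Longrightarrow> subgrp (G i)" and subC: "subgrp C" and CG: "i \<in> I \<Longrightarrow> C \<subseteq> G i" and I_ne: "I \<noteq> {}"
    and alternating: "ws \<noteq> [] \<Longrightarrow> distinct_adj (map fst ws) \<Longrightarrow> \<forall>(i, g)\<in>set ws. i \<in> I \<and> g \<in> G i - C \<Longrightarrow>
      sum_list (map snd ws) \<notin> C"
begin

definition A :: "'g set" where "A = gspan (\<Union>i\<in>I. G i)"

definition coset_rep :: "'g \<Rightarrow> 'g" where "coset_rep g = (SOME h. h \<in> (+) g ` C)"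

text \<open>No trailing element of \<open>C\<close> is recorded: a normal list stands for a left
  coset of \<open>C\<close>, not for an element.\<close>

definition normal :: "('i \<times> 'g) list \<Rightarrow> bool" where
  "normal ws \<longleftrightarrow> distinct_adj (map fst ws) \<and> (\<forall>(i, g)\<in>set ws. i \<in> I \<and> g \<in> G i - C \<and> coset_rep g = g)"

abbreviation "val ws \<equiv> sum_list (map snd ws)"

text \<open>A last syllable of type \<open>i\<close> is absorbed by a coset of \<open>G i\<close>.
  Such cosets therefore correspond to the normal lists that do not end in type
  \<open>i\<close>.\<close>

definition ends :: "'i \<Rightarrow> ('i \<times> 'g) list \<Rightarrow> bool" where
  "ends i ws \<longleftrightarrow> ws \<noteq> [] \<and> fst (last ws) = i"

lemma coset_rep: "- g + coset_rep g \<in> C" "- coset_rep g + g \<in> C"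
proof -
  have "\<exists>h. h \<in> (+) g ` C" using subgrp_zero[OF subC] by blast
  then have "coset_rep g \<in> (+) g ` C" unfolding coset_rep_def by (rule someI_ex)
  then obtain c where "c \<in> C" "coset_rep g = g + c" by blast
  then show 1: "- g + coset_rep g \<in> C" by simp
  have "- (- g + coset_rep g) = - coset_rep g + g" by (simp add: minus_add)
  then show "- coset_rep g + g \<in> C" using subgrp_minus[OF subC 1] by simp
qed

lemma coset_rep_eq: "- g + h \<in> C \<Longrightarrow> coset_rep g = coset_rep h"
  using coset_eq[OF subC, of g h] by (simp add: coset_rep_def)

lemma coset_rep_rep: "coset_rep (coset_rep g) = coset_rep g"
  using coset_rep_eq coset_rep(1) by metis

lemma coset_rep_in: "i \<in> I \<Longrightarrow> g \<in> G i - C \<Longrightarrow> coset_rep g \<in> G i - C"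
proof -
  assume i: "i \<in> I" and g: "g \<in> G i - C"
  have e: "g + (- g + coset_rep g) = coset_rep g" by simp
  have "g + (- g + coset_rep g) \<in> G i" using g coset_rep(1) CG[OF i] subgrp_add[OF subG[OF i]] by blast
  moreover have "g + (- g + coset_rep g) \<notin> C" using g coset_rep(1) subgrp_add_right[OF subC] by blast
  ultimately show ?thesis unfolding e by blast
qed

lemma normal_append: "normal (u @ w) \<longleftrightarrow> normal u \<and> normal w \<and> (u = [] \<or> w = [] \<or> fst (last u) \<noteq> fst (hd w))"
  by (auto simp: normal_def distinct_adj_append_iff last_map hd_map)

lemma normal_single: "normal [(i, g)] \<longleftrightarrow> i \<in> I \<and> g \<in> G i - C \<and> coset_rep g = g"
  by (auto simp: normal_def)

lemma val_inv: "val (map (\<lambda>(i, g). (i, - g)) (rev ws)) = - val ws" for ws :: "('i \<times> 'g) list"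
  by (induction ws) (auto simp: minus_add)

lemma fst_inv: "map fst (map (\<lambda>(i, g). (i, - g)) (rev ws)) = rev (map fst ws)"
  by (simp add: rev_map split_beta o_def)

text \<open>Unless the first syllables agree, the inverse of one list followed by the other is
  alternating, possibly after merging two syllables of the same type, and so its value cannot lie in
  \<open>C\<close>.\<close>

lemma normal_unique:
  "normal ws \<Longrightarrow> normal ws' \<Longrightarrow> - val ws + val ws' \<in> C \<Longrightarrow> ws = ws'"
proof (induction ws arbitrary: ws')
  case Nil
  then show ?case using alternating[of ws'] by (fastforce simp: normal_def)
next
  case (Cons p u)
  obtain i g where p: "p = (i, g)" by fastforce
  have nu: "normal u" "i \<in> I" "g \<in> G i - C" "coset_rep g = g" "u = [] \<or> i \<noteq> fst (hd u)"
    using Cons.prems(1) p normal_append[of "[p]" u] normal_single by auto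
  show ?case
  proof (cases ws')
    case Nil
    then have "val (p # u) \<in> C" using Cons.prems(3) subgrp_minus_iff[OF subC, of "val (p # u)"] by simp
    then show ?thesis using alternating[of "p # u"] Cons.prems(1) by (fastforce simp: normal_def)
  next
    case (Cons q w)
    obtain j h where q: "q = (j, h)" by fastforce
    have nw: "normal w" "j \<in> I" "h \<in> G j - C" "coset_rep h = h" "w = [] \<or> j \<noteq> fst (hd w)"
      using Cons.prems(2) Cons q normal_append[of "[q]" w] normal_single by auto
    let ?inv = "\<lambda>ws. map (\<lambda>(i, g). (i, - g)) (rev ws)"
    have ent: "\<forall>(i, g)\<in>set (?inv v). i \<in> I \<and> g \<in> G i - C" if "normal v" for v
      using that subgrp_minus_iff[OF subC] subgrp_minus_iff[OF subG] by (fastforce simp: normal_def)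
    have adj: "distinct_adj (map fst (?inv v))" if "normal v" for v
      using that unfolding fst_inv by (simp add: normal_def)
    have lst: "v \<noteq> [] \<Longrightarrow> last (map fst (?inv v)) = fst (hd v)" for v :: "('i \<times> 'g) list"
      unfolding fst_inv by (simp add: last_rev hd_map)
    have v: "- val (p # u) + val (q # w) \<in> C" using Cons.prems(3) Cons by simp
    have "i = j"
    proof (rule ccontr)
      assume ij: "i \<noteq> j"
      have "distinct_adj (map fst (?inv (p # u)) @ map fst (q # w))"
        unfolding distinct_adj_append_iff
        using adj[OF Cons.prems(1)] lst[of "p # u"] Cons.prems(2) Cons p q ij by (simp add: normal_def)
      moreover have "\<forall>(i, g)\<in>set (?inv (p # u) @ q # w). i \<in> I \<and> g \<in> G i - C"
        using ent[OF Cons.prems(1)] Cons.prems(2) Cons by (auto simp: normal_def)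
      ultimately have "val (?inv (p # u) @ q # w) \<notin> C"
        by (intro alternating) (simp_all only: map_append, simp)
      then show False using v unfolding map_append sum_list_append val_inv by blast
    qed
    have gh: "- g + h \<in> G i" using nu nw \<open>i = j\<close> subG subgrp_add subgrp_minus by blast
    have e: "- val (p # u) + val (q # w) = - val u + (- g + h + val w)"
      using p q by (simp add: minus_add add.assoc group_norm del: add_uminus_conv_diff)
    have "- g + h \<in> C"
    proof (rule ccontr)
      assume n: "- g + h \<notin> C"
      have "distinct_adj (map fst (?inv u) @ i # map fst w)"
        unfolding distinct_adj_append_iff
        using adj[OF nu(1)] lst[of u] nu nw \<open>i = j\<close> by (auto simp: normal_def hd_map distinct_adj_Cons)
      moreover have "\<forall>(i, g)\<in>set (?inv u @ (i, - g + h) # w). i \<in> I \<and> g \<in> G i - C"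
        using ent[OF nu(1)] nu(2) gh n nw(1) by (auto simp: normal_def)
      ultimately have "val (?inv u @ (i, - g + h) # w) \<notin> C"
        by (intro alternating) (simp_all only: map_append list.map fst_conv, simp)
      then show False using v e unfolding map_append sum_list_append val_inv by (simp add: add.assoc)
    qed
    then have gh: "g = h" using coset_rep_eq nu nw by metis
    then have "- val u + val w \<in> C" using v e by simp
    then have "u = w" using Cons.IH nu(1) nw(1) by blast
    then show ?thesis using p q gh \<open>i = j\<close> Cons by simp
  qed
qed

lemma normal_step:
  assumes u: "normal u" "\<not> ends i u" and i: "i \<in> I" and k: "k \<in> G i"
  shows "\<exists>ws. normal ws \<and> - val ws + (val u + k) \<in> C"
proof (cases "k \<in> C")
  case True
  then show ?thesis using u by (intro exI[of _ u]) simp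
next
  case False
  have "normal (u @ [(i, coset_rep k)])"
    unfolding normal_append normal_single using u i coset_rep_in[OF i] k False coset_rep_rep by (auto simp: ends_def)
  moreover have "- val (u @ [(i, coset_rep k)]) + (val u + k) = - coset_rep k + k"
    by (simp add: minus_add add.assoc group_norm del: add_uminus_conv_diff)
  ultimately show ?thesis using coset_rep(2)[of k] by metis
qed

lemma normal_split:
  assumes "normal ws"
  obtains "\<not> ends i ws" | u t where "ws = u @ [(i, t)]" "normal u" "\<not> ends i u" "i \<in> I" "t \<in> G i - C"
proof (cases "ends i ws")
  case True
  then obtain t where "ws = butlast ws @ [(i, t)]" unfolding ends_def by (metis append_butlast_last_id prod.collapse)
  moreover have "normal (butlast ws @ [(i, t)])" using assms calculation by metis
  then have "normal (butlast ws)" "\<not> ends i (butlast ws)" "i \<in> I" "t \<in> G i - C"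
    unfolding normal_append normal_single ends_def by auto
  ultimately show ?thesis using that(2) by blast
qed (use that in blast)

lemma subA: "subgrp A" unfolding A_def by (rule subgrp_gspan)

lemma GA: "i \<in> I \<Longrightarrow> G i \<subseteq> A" unfolding A_def using gspan_base by blast

lemma normal_exists: "g \<in> A \<Longrightarrow> \<exists>ws. normal ws \<and> - val ws + g \<in> C"
  unfolding A_def
proof (induction rule: gspan_right_induct)
  case zero
  show ?case using subgrp_zero[OF subC] by (intro exI[of _ "[]"]) (simp add: normal_def)
next
  have step: "\<exists>ws. normal ws \<and> - val ws + (x + s) \<in> C" if x: "\<exists>ws. normal ws \<and> - val ws + x \<in> C" and s: "i \<in> I" "s \<in> G i" for x s i
  proof -
    obtain ws where ws: "normal ws" "- val ws + x \<in> C" using x by blast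
    then have cG: "- val ws + x \<in> G i" using CG[OF s(1)] by blast
    from ws(1) show ?thesis
    proof (cases rule: normal_split[of ws i])
      case 1
      have "- val ws + x + s \<in> G i" using subgrp_add[OF subG[OF s(1)] cG s(2)] .
      moreover have "val ws + (- val ws + x + s) = x + s" by (simp add: add.assoc)
      ultimately show ?thesis using normal_step[OF ws(1) 1 s(1)] by metis
    next
      case (2 u t)
      have "t + (- val ws + x + s) \<in> G i" using 2 subgrp_add[OF subG[OF s(1)]] cG s(2) by blast
      moreover have "val u + (t + (- val ws + x + s)) = x + s" using 2(1) 
        by (simp add: minus_add add.assoc group_norm del: add_uminus_conv_diff)
      ultimately show ?thesis using normal_step[OF 2(2,3) s(1)] by metis
    qed
  qed
  case (add x s)
  then show ?case using step by blast
  case (diff x s)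
  then obtain i where "i \<in> I" "- s \<in> G i" using subG subgrp_minus by blast
  then show ?case using step[OF diff.IH, of i "- s"] by simp
qed

lemma normal_A: "normal ws \<Longrightarrow> val ws \<in> A"
  by (rule subgrp_sum_list[OF subA]) (use GA in \<open>fastforce simp: normal_def\<close>)

text \<open>If the difference were outside \<open>C\<close>, appending its representative to
  \<open>ws\<close> would give a normal list for the coset of \<open>ws'\<close> that ends in type
  \<open>i\<close>, against uniqueness.\<close>

lemma normal_unique_G:
  assumes i: "i \<in> I" and ws: "normal ws" "\<not> ends i ws" and ws': "normal ws'" "\<not> ends i ws'" and k: "- val ws + val ws' \<in> G i"
  shows "ws = ws'"
proof (cases "- val ws + val ws' \<in> C")
  case True
  then show ?thesis using normal_unique ws ws' by blast
next
  case False
  let ?k = "- val ws + val ws'"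
  have "normal (ws @ [(i, coset_rep ?k)])"
    unfolding normal_append normal_single using ws i coset_rep_in[OF i] k False coset_rep_rep by (auto simp: ends_def)
  moreover have "- val (ws @ [(i, coset_rep ?k)]) + val ws' = - coset_rep ?k + ?k"
    by (simp add: minus_add add.assoc group_norm del: add_uminus_conv_diff)
  ultimately have "ws @ [(i, coset_rep ?k)] = ws'" using normal_unique ws'(1) coset_rep(2)[of ?k] by metis
  moreover have "ends i (ws @ [(i, coset_rep ?k)])" by (simp add: ends_def)
  ultimately show ?thesis using ws'(2) by simp
qed

text \<open>The Bass-Serre tree of a star of groups with \<open>C\<close> at the center. For two
  factors it is the barycentric subdivision of the usual tree, the vertices tagged
  \<open>None\<close> being the midpoints of edges.\<close>

definition vertices :: "('i option \<times> 'g set) set" where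
  "vertices = {(None, (+) g ` C) | g. g \<in> A} \<union> {(Some i, (+) g ` G i) | i g. i \<in> I \<and> g \<in> A}"

text \<open>A syllable is two steps in the tree: \<open>Inl i\<close> leads from a coset of
  \<open>C\<close> to the coset of \<open>G i\<close> containing it, and \<open>Inr g\<close> to
  another coset of \<open>C\<close> inside. Cosets of \<open>C\<close> are thus the vertices at even
  depth.\<close>

definition addrC :: "('i \<times> 'g) list \<Rightarrow> ('i + 'g) list" where
  "addrC ws = concat (map (\<lambda>(i, g). [Inl i, Inr g]) ws)"

lemma addrC_simps [simp]: "addrC [] = []" "addrC (u @ w) = addrC u @ addrC w" "addrC [(i, g)] = [Inl i, Inr g]"
  "addrC ((i, g) # w) = Inl i # Inr g # addrC w"
  by (simp_all add: addrC_def)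

lemma addrC_inj [simp]: "addrC u = addrC w \<longleftrightarrow> u = w"
proof (induction u arbitrary: w)
  case Nil
  show ?case by (cases w) auto
next
  case (Cons p u)
  show ?case by (cases w; cases p) (auto simp: Cons.IH)
qed

lemma addrC_even: "even (length (addrC u))"
  by (induction u) auto

lemma addrC_snoc: "addrC u = addrC v @ [Inl i, a] \<Longrightarrow> \<exists>t. u = v @ [(i, t)] \<and> a = Inr t"
proof (induction u arbitrary: v)
  case (Cons p u)
  show ?case
  proof (cases v)
    case Nil
    then show ?thesis using Cons.prems by (cases p; cases u) auto
  next
    case (Cons q w)
    then show ?thesis using Cons.prems Cons.IH[of w] by (cases p; cases q) auto
  qed
qed auto

definition addr :: "'i option \<times> 'g set \<Rightarrow> ('i + 'g) list" where
  "addr x = (case x of (None, K) \<Rightarrow> addrC (THE ws. normal ws \<and> (+) (val ws) ` C = K)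
     | (Some i, K) \<Rightarrow> addrC (THE ws. normal ws \<and> \<not> ends i ws \<and> (+) (val ws) ` G i = K) @ [Inl i])"

lemma addr_None: "normal ws \<Longrightarrow> addr (None, (+) (val ws) ` C) = addrC ws"
proof -
  assume ws: "normal ws"
  have "(THE us. normal us \<and> (+) (val us) ` C = (+) (val ws) ` C) = ws"
    using ws normal_unique coset_eq[OF subC] by (intro the_equality) auto
  then show ?thesis by (simp add: addr_def)
qed

lemma addr_Some: "i \<in> I \<Longrightarrow> normal ws \<Longrightarrow> \<not> ends i ws \<Longrightarrow> addr (Some i, (+) (val ws) ` G i) = addrC ws @ [Inl i]"
proof -
  assume ws: "i \<in> I" "normal ws" "\<not> ends i ws"
  have "(THE us. normal us \<and> \<not> ends i us \<and> (+) (val us) ` G i = (+) (val ws) ` G i) = ws"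
    using ws normal_unique_G[OF ws(1)] coset_eq[OF subG[OF ws(1)]] by (intro the_equality) auto
  then show ?thesis by (simp add: addr_def)
qed

lemma vertex_cases:
  assumes "x \<in> vertices"
  obtains ws where "normal ws" "x = (None, (+) (val ws) ` C)"
  | i ws where "i \<in> I" "normal ws" "\<not> ends i ws" "x = (Some i, (+) (val ws) ` G i)"
proof -
  from assms consider g where "g \<in> A" "x = (None, (+) g ` C)" | i g where "i \<in> I" "g \<in> A" "x = (Some i, (+) g ` G i)"
    unfolding vertices_def by blast
  then show ?thesis
  proof cases
    case 1
    then obtain ws where "normal ws" "- val ws + g \<in> C" using normal_exists by blast
    then show ?thesis using that(1) 1 coset_eq[OF subC] by metis
  next
    case 2
    then obtain ws where ws: "normal ws" "- val ws + g \<in> C" using normal_exists by blast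
    then have e: "(+) (val ws) ` G i = (+) g ` G i" using coset_eq[OF subG[OF 2(1)]] CG[OF 2(1)] by blast
    from ws(1) show ?thesis
    proof (cases rule: normal_split[of ws i])
      case 1
      then show ?thesis using that(2)[of i ws] ws 2 e by simp
    next
      case (2 u t)
      have "- val ws + val u = - t" using 2(1) by (simp add: minus_add add.assoc group_norm del: add_uminus_conv_diff)
      then have "- val ws + val u \<in> G i" using 2(5) subgrp_minus[OF subG[OF 2(4)]] by auto
      then have "(+) (val ws) ` G i = (+) (val u) ` G i" using coset_eq[OF subG[OF 2(4)]] by blast
      then show ?thesis using that(2)[OF 2(4,2,3)] e \<open>x = (Some i, (+) g ` G i)\<close> by simp
    qed
  qed
qed

lemma vertices_None [simp]: "normal ws \<Longrightarrow> (None, (+) (val ws) ` C) \<in> vertices"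
  and vertices_Some [simp]: "i \<in> I \<Longrightarrow> normal ws \<Longrightarrow> (Some i, (+) (val ws) ` G i) \<in> vertices"
  using normal_A unfolding vertices_def by blast+

lemma addr_inj: "inj_on addr vertices"
proof (rule inj_onI)
  fix x y assume x: "x \<in> vertices" and y: "y \<in> vertices" and e: "addr x = addr y"
  have odd: "addrC u \<noteq> addrC w @ [Inl i]" for u w i
    using addrC_even[of u] addrC_even[of w] by (metis even_Suc length_append_singleton)
  from x y show "x = y"
    by (cases rule: vertex_cases; elim vertex_cases) (use e odd odd[symmetric] in \<open>auto simp: addr_None addr_Some\<close>)
qed

text \<open>The parent of a coset of \<open>C\<close> forgets the element of the last syllable but
  keeps its type; the parent of a coset of \<open>G i\<close> forgets the type.\<close>

lemma addr_butlast:
  assumes "x \<in> vertices" "addr x \<noteq> []"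
  shows "\<exists>y\<in>vertices. addr y = butlast (addr x)"
  using assms(1)
proof (cases rule: vertex_cases)
  case (1 ws)
  then have a: "addr x = addrC ws" by (simp add: addr_None)
  then have "ws \<noteq> []" using assms(2) by auto
  then obtain i t where "last ws = (i, t)" "ws = butlast ws @ [(i, t)]" by (metis append_butlast_last_id surj_pair)
  then have "ends i ws" using \<open>ws \<noteq> []\<close> by (simp add: ends_def)
  from 1(1) show ?thesis
  proof (cases rule: normal_split[of ws i])
    case (2 u t)
    have "addr (Some i, (+) (val u) ` G i) = butlast (addr x)" using addr_Some[OF 2(4,2,3)] a 2(1) by (simp add: butlast_append)
    then show ?thesis using vertices_Some[OF 2(4,2)] by (intro bexI)
  qed (use \<open>ends i ws\<close> in blast)
next
  case (2 i ws)
  then have "addr (None, (+) (val ws) ` C) = butlast (addr x)" by (simp add: addr_Some addr_None)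
  then show ?thesis using vertices_None[OF 2(2)] by (intro bexI)
qed

lemma addr_take: "x \<in> vertices \<Longrightarrow> \<exists>y\<in>vertices. addr y = take k (addr x)"
proof (induction "length (addr x) - k" arbitrary: x)
  case 0
  then show ?case by auto
next
  case (Suc n)
  then have "addr x \<noteq> []" by auto
  then obtain y where y: "y \<in> vertices" "addr y = butlast (addr x)" using addr_butlast Suc.prems by blast
  then have "n = length (addr y) - k" using Suc.hyps(2) by simp
  then obtain z where "z \<in> vertices" "addr z = take k (addr y)" using Suc.hyps(1) y by blast
  moreover have "take k (addr y) = take k (addr x)" using y Suc.hyps(2) by (simp add: take_butlast)
  ultimately show ?case by metis
qed

abbreviation dist where "dist x y \<equiv> ldist (addr x) (addr y)"

definition adjacent where
  "adjacent x y \<longleftrightarrow> (\<exists>g\<in>A. \<exists>i\<in>I. x = (None, (+) g ` C) \<and> y = (Some i, (+) g ` G i))"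

lemma adjacent_dist: "adjacent x y \<Longrightarrow> dist x y = 1"
proof -
  assume "adjacent x y"
  then obtain g i where gi: "g \<in> A" "i \<in> I" "x = (None, (+) g ` C)" "y = (Some i, (+) g ` G i)" unfolding adjacent_def by blast
  obtain ws where ws: "normal ws" "- val ws + g \<in> C" using normal_exists gi by blast
  then have x: "x = (None, (+) (val ws) ` C)" using gi coset_eq[OF subC] by metis
  have "(+) (val ws) ` G i = (+) g ` G i" using coset_eq[OF subG[OF gi(2)]] CG[OF gi(2)] ws by blast
  then have y: "y = (Some i, (+) (val ws) ` G i)" using gi by simp
  from ws(1) show ?thesis
  proof (cases rule: normal_split[of ws i])
    case 1
    then show ?thesis using addr_None[OF ws(1)] addr_Some[OF gi(2) ws(1) 1] x y by simp
  next
    case (2 u t)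
    have "- val ws + val u = - t" using 2(1) by (simp add: minus_add add.assoc group_norm del: add_uminus_conv_diff)
    then have "- val ws + val u \<in> G i" using 2(5) subgrp_minus[OF subG[OF 2(4)]] by auto
    then have "(+) (val ws) ` G i = (+) (val u) ` G i" using coset_eq[OF subG[OF 2(4)]] by blast
    then have "addr y = addrC u @ [Inl i]" "addr x = addrC u @ [Inl i] @ [Inr t]"
      using addr_None[OF ws(1)] addr_Some[OF 2(4,2,3)] x y 2(1) by simp_all
    then show ?thesis using ldist_append(2)[of "addrC u @ [Inl i]" "[Inr t]"] by simp
  qed
qed

text \<open>Addresses depend on chosen representatives and are not compatible with translation.
  Adjacency as a relation between cosets is, which is what makes the action isometric.\<close>

lemma dist_adjacent: "x \<in> vertices \<Longrightarrow> y \<in> vertices \<Longrightarrow> dist x y = 1 \<longleftrightarrow> adjacent x y \<or> adjacent y x"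
proof
  assume x: "x \<in> vertices" and y: "y \<in> vertices"
  have *: "adjacent x y \<or> adjacent y x" if x: "x \<in> vertices" and y: "y \<in> vertices" and e: "addr y = addr x @ [a]" for x y a
    using x
  proof (cases rule: vertex_cases)
    case (1 ws)
    then have ax: "addr x = addrC ws" by (simp add: addr_None)
    from y show ?thesis
    proof (cases rule: vertex_cases)
      case (1 us)
      then have "addr y = addrC us" by (simp add: addr_None)
      then show ?thesis using e ax addrC_even[of us] addrC_even[of ws] by (metis even_Suc length_append_singleton)
    next
      case (2 i us)
      then have "us = ws" using e ax by (simp add: addr_Some)
      then show ?thesis using 1 2 normal_A unfolding adjacent_def by blast
    qed
  next
    case (2 i ws)
    then have ax: "addr x = addrC ws @ [Inl i]" by (simp add: addr_Some)
    from y show ?thesis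
    proof (cases rule: vertex_cases)
      case (1 us)
      then have "addrC us = addrC ws @ [Inl i, a]" using e ax by (simp add: addr_None)
      then obtain t where t: "us = ws @ [(i, t)]" using addrC_snoc by blast
      then have "t \<in> G i" using 1(1) by (simp add: normal_append normal_single)
      then have "- val ws + val us \<in> G i" using t by simp
      then have "(+) (val ws) ` G i = (+) (val us) ` G i" using coset_eq[OF subG[OF 2(1)]] by blast
      then show ?thesis using 1 2 normal_A unfolding adjacent_def by metis
    next
      case (2 j us)
      then have "addr y = addrC us @ [Inl j]" by (simp add: addr_Some)
      then show ?thesis using e ax addrC_even[of us] addrC_even[of ws] by (metis even_Suc length_append_singleton)
    qed
  qed
  show "adjacent x y \<or> adjacent y x" if "dist x y = 1" using that *[OF x y] *[OF y x] unfolding ldist_one by blast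
  show "dist x y = 1" if "adjacent x y \<or> adjacent y x" using that adjacent_dist[of x y] adjacent_dist[of y x]
    by (auto simp: ldist_def lcp_sym)
qed

definition act :: "'g \<Rightarrow> 'i option \<times> 'g set \<Rightarrow> 'i option \<times> 'g set" where
  "act h x = (fst x, (+) h ` snd x)"

lemma translate_coset: "(+) h ` (+) g ` K = (+) (h + g) ` (K :: 'g set)"
  by (auto simp: image_image add.assoc)

lemma stabilizer: "subgrp K \<Longrightarrow> (+) h ` (+) g ` K = (+) g ` K \<Longrightarrow> h \<in> conjg g ` K" for K :: "'g set"
proof -
  assume K: "subgrp K" "(+) h ` (+) g ` K = (+) g ` K"
  have "(+) g ` K = (+) (h + g) ` K" using K(2) translate_coset[of h g K] by simp
  then have "- g + (h + g) \<in> K" unfolding coset_eq[OF K(1)] .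
  moreover have "h = conjg g (- g + (h + g))" unfolding conjg_def by (simp add: group_norm del: add_uminus_conv_diff)
  ultimately show ?thesis by blast
qed

text \<open>Stabilizers lie in conjugates of \<open>C\<close> or of a factor. Edges are not
  inverted, because the action preserves the tags and every edge joins a \<open>None\<close> vertex
  to a tagged one.\<close>

theorem amalgam_alternative:
  assumes free: "free_like C" and alt: "\<And>i. i \<in> I \<Longrightarrow> alternative (G i)"
  shows "alternative A"
proof -
  note sub = subG
  interpret metric_tree vertices dist
    by (rule list_tree) (use addr_inj addr_take in auto)
  have act_vert: "act g x \<in> vertices" if "g \<in> A" "x \<in> vertices" for g x
  proof -
    have "\<And>h. h \<in> A \<Longrightarrow> g + h \<in> A" using that(1) subgrp_add[OF subA] by blast
    then show ?thesis using that(2) unfolding vertices_def act_def by (fastforce simp: translate_coset)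
  qed
  have act_adj: "adjacent (act g x) (act g y)" if "g \<in> A" "adjacent x y" for g x y
    using that subgrp_add[OF subA] unfolding adjacent_def act_def by (fastforce simp: translate_coset)
  interpret tree_action vertices dist A act
  proof (rule tree_actionI)
    show "subgrp A" by (rule subA)
    show "act (g + h) x = act g (act h x)" for g h x by (simp add: act_def translate_coset image_image add.assoc)
    show "act 0 x = x" for x by (simp add: act_def)
    show "dist (act g x) (act g y) = 1" if "g \<in> A" "x \<in> vertices" "y \<in> vertices" "dist x y = 1" for g x y
      using that dist_adjacent act_vert act_adj by metis
  qed (use act_vert in auto)
  have stabC: "{h\<in>A. act h (None, (+) g ` C) = (None, (+) g ` C)} \<subseteq> conjg g ` C" for g
    using stabilizer[OF subC] by (auto simp: act_def)
  have tag: "fst x = None \<longleftrightarrow> fst y \<noteq> None" if "x \<in> vertices" "y \<in> vertices" "dist x y = 1" for x y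
    using that dist_adjacent unfolding adjacent_def by auto
  show ?thesis
  proof (rule tree_alternative)
    show False if "g \<in> A" "x \<in> vertices" "dist x (act g x) = 1" for g x
      using tag[OF that(2) act_vert[OF that(1,2)] that(3)] by (cases "fst x") (auto simp: act_def)
    have "normal []" by (simp add: normal_def)
    from vertices_None[OF this] show "vertices \<noteq> {}" by blast
    show "alternative {g\<in>A. act g x = x}" if "x \<in> vertices" for x
      using that
    proof (cases rule: vertex_cases)
      case (1 ws)
      obtain i where i: "i \<in> I" using I_ne by blast
      have "{g\<in>A. act g x = x} \<subseteq> conjg (val ws) ` G i" using stabC[of "val ws"] CG[OF i] 1 by blast
      then show ?thesis using alternative_mono[OF alternative_conjg[OF alt[OF i]]] by blast
    next
      case (2 i ws)
      have "{g\<in>A. act g x = x} \<subseteq> conjg (val ws) ` G i" using stabilizer[OF sub[OF 2(1)]] 2 by (auto simp: act_def)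
      then show ?thesis using alternative_mono[OF alternative_conjg[OF alt[OF 2(1)]]] by blast
    qed
    fix g assume g: "g \<in> A" "axis g \<noteq> {}"
    have "\<exists>x\<in>axis g. fst x = None"
    proof -
      obtain x where x: "x \<in> axis g" using g by blast
      then have xX: "x \<in> vertices" "act g x \<in> vertices" "0 < dist x (act g x)" using g unfolding axis_def by auto
      \<comment> \<open>The next vertex towards \<open>g x\<close> is on the axis as well, and one
        of two adjacent vertices has the tag \<open>None\<close>.\<close>
      obtain u where u: "u \<in> vertices" "btw x u (act g x)" "dist x u = 1"
        using btw_exists[OF xX(1,2), of 1] xX(3) by auto
      have "u \<in> axis g" using axis_seg[OF g(1) x u(1,2)] by blast
      then show ?thesis using tag[OF xX(1) u(1,3)] x by metis
    qed
    then obtain x where x: "x \<in> axis g" "fst x = None" by blast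
    then obtain h where "x = (None, (+) h ` C)" using axis_X[OF x(1)] unfolding vertices_def by auto
    then have "free_like {k\<in>A. act k x = x}" using free_like_mono[OF free_like_conjg[OF free] stabC] by simp
    then show "\<exists>x\<in>axis g. free_like {k\<in>A. act k x = x}" using x by blast
  qed
qed

end

section \<open>Existence of amalgamated products\<close>

text \<open>The full permutation group, written additively, serves as the ambient group in which
  presented groups and amalgams are realized.\<close>

typedef 'x bijection = "{f :: 'x \<Rightarrow> 'x. bij f}"
  morphisms ap Bijection
  by (intro exI[of _ id]) simp

instantiation bijection :: (type) group_add
begin

definition "a + b = Bijection (ap a \<circ> ap b)"
definition "0 = Bijection id"
definition "- a = Bijection (inv_into UNIV (ap a))"
definition "a - b = a + - (b :: 'a bijection)"

lemma bij_ap: "bij (ap a)"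
  using ap[of a] by simp

lemma ap_plus: "ap (a + b) = ap a \<circ> ap b"
  unfolding plus_bijection_def by (rule Bijection_inverse) (simp add: bij_comp bij_ap)

lemma ap_zero: "ap 0 = id"
  unfolding zero_bijection_def by (rule Bijection_inverse) simp

lemma ap_uminus: "ap (- a) = inv_into UNIV (ap a)"
  unfolding uminus_bijection_def by (rule Bijection_inverse) (simp add: bij_imp_bij_inv bij_ap)

instance
proof
  fix a b c :: "'a bijection"
  show "a + b + c = a + (b + c)" by (simp add: ap_inject[symmetric] ap_plus o_assoc)
  show "0 + a = a" "a + 0 = a" by (simp_all add: ap_inject[symmetric] ap_plus ap_zero)
  show "- a + a = 0" by (simp add: ap_inject[symmetric] ap_plus ap_zero ap_uminus bij_is_inj bij_ap)
  show "a + - b = a - b" by (simp add: minus_bijection_def)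
qed

end

lemma bijection_eqI: "(\<And>x. ap a x = ap b x) \<Longrightarrow> a = b"
  by (simp add: ap_inject[symmetric] fun_eq_iff)

lemma ap_Bijection:
  assumes "\<And>x. x \<in> W \<Longrightarrow> f x \<in> W" "\<And>x. x \<in> W \<Longrightarrow> g x \<in> W" "\<And>x. x \<in> W \<Longrightarrow> f (g x) = x" "\<And>x. x \<in> W \<Longrightarrow> g (f x) = x"
  shows "ap (Bijection (\<lambda>x. if x \<in> W then f x else x)) x = (if x \<in> W then f x else x)"
proof -
  have "bij (\<lambda>x. if x \<in> W then f x else x)"
    by (rule bij_betw_byWitness[of _ "\<lambda>x. if x \<in> W then g x else x"]) (use assms in auto)
  then show ?thesis using Bijection_inverse[of "\<lambda>x. if x \<in> W then f x else x"] by simp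
qed

text \<open>Van der Waerden's trick: the groups \<open>G i\<close> act compatibly on the normal forms of the amalgamated
  product over \<open>C\<close>, where a normal form is an element of \<open>C\<close> followed by right coset representatives.\<close>

locale amalgam_data =
  fixes G :: "'i \<Rightarrow> 'a::group_add set" and I :: "'i set" and C :: "'c::group_add set" and e :: "'i \<Rightarrow> 'c \<Rightarrow> 'a"
  assumes subG: "i \<in> I \<Longrightarrow> subgrp (G i)" and subC: "subgrp C"
    and e_in: "i \<in> I \<Longrightarrow> c \<in> C \<Longrightarrow> e i c \<in> G i"
    and e_add: "i \<in> I \<Longrightarrow> c \<in> C \<Longrightarrow> c' \<in> C \<Longrightarrow> e i (c + c') = e i c + e i c'"
    and e_inj: "i \<in> I \<Longrightarrow> inj_on (e i) C"
begin

lemma e_zero: "i \<in> I \<Longrightarrow> e i 0 = 0"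
  using e_add[of i 0 0] subgrp_zero[OF subC] by (metis add_0_right add_left_cancel)

lemma e_minus: "i \<in> I \<Longrightarrow> c \<in> C \<Longrightarrow> e i (- c) = - e i c"
  using e_add[of i c "- c"] e_zero[of i] subgrp_minus[OF subC] by (simp add: eq_neg_iff_add_eq_0 minus_unique)

lemma subE: "i \<in> I \<Longrightarrow> subgrp (e i ` C)"
proof (rule subgrpI)
  assume i: "i \<in> I"
  show "0 \<in> e i ` C" using e_zero[OF i] subgrp_zero[OF subC] by (metis imageI)
  show "a + b \<in> e i ` C" if "a \<in> e i ` C" "b \<in> e i ` C" for a b
    using that by (auto simp: e_add[OF i, symmetric] intro!: imageI subgrp_add[OF subC])
  show "- a \<in> e i ` C" if "a \<in> e i ` C" for a
    using that by (auto simp: e_minus[OF i, symmetric] intro!: imageI subgrp_minus[OF subC])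
qed

text \<open>The edge group itself gets the representative 0, so that its elements contribute no
  syllable to a normal form.\<close>

definition rrep :: "'i \<Rightarrow> 'a \<Rightarrow> 'a" where
  "rrep i g = (if g \<in> e i ` C then 0 else SOME h. \<exists>c\<in>C. g = e i c + h)"

definition cpart :: "'i \<Rightarrow> 'a \<Rightarrow> 'c" where
  "cpart i g = (SOME c. c \<in> C \<and> g = e i c + rrep i g)"

lemma cpart: assumes i: "i \<in> I" shows "cpart i g \<in> C" "e i (cpart i g) + rrep i g = g"
proof -
  have "\<exists>c\<in>C. g = e i c + rrep i g"
  proof (cases "g \<in> e i ` C")
    case True
    then show ?thesis by (auto simp: rrep_def)
  next
    case False
    have "\<exists>h. \<exists>c\<in>C. g = e i c + h"
      using subgrp_zero[OF subC] e_zero[OF i] by (intro exI[of _ g] bexI[of _ 0]) auto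
    from someI_ex[OF this] show ?thesis using False by (simp add: rrep_def)
  qed
  then have "\<exists>c. c \<in> C \<and> g = e i c + rrep i g" by blast
  from someI_ex[OF this] show "cpart i g \<in> C" "e i (cpart i g) + rrep i g = g" unfolding cpart_def by auto
qed

lemma rrep_translate: assumes i: "i \<in> I" and c: "c \<in> C" shows "rrep i (e i c + g) = rrep i g"
proof (cases "g \<in> e i ` C")
  case True
  then have "e i c + g \<in> e i ` C" using subgrp_add[OF subE[OF i]] c by blast
  then show ?thesis using True by (simp add: rrep_def)
next
  case False
  then have "e i c + g \<notin> e i ` C" using subgrp_add_left[OF subE[OF i], of "e i c" g] c by blast
  moreover have "(\<exists>k\<in>C. e i c + g = e i k + h) \<longleftrightarrow> (\<exists>k\<in>C. g = e i k + h)" for h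
  proof
    assume "\<exists>k\<in>C. e i c + g = e i k + h"
    then obtain k where k: "k \<in> C" "e i c + g = e i k + h" by blast
    then have "g = - e i c + (e i k + h)" by (metis minus_add_cancel)
    then have "g = e i (- c + k) + h" using e_add[OF i subgrp_minus[OF subC c] k(1)] e_minus[OF i c] by (simp add: add.assoc)
    then show "\<exists>k\<in>C. g = e i k + h" using subgrp_add[OF subC subgrp_minus[OF subC c] k(1)] by blast
  next
    assume "\<exists>k\<in>C. g = e i k + h"
    then obtain k where k: "k \<in> C" "g = e i k + h" by blast
    then have "e i c + g = e i (c + k) + h" using e_add[OF i c k(1)] by (simp add: add.assoc)
    then show "\<exists>k\<in>C. e i c + g = e i k + h" using subgrp_add[OF subC c k(1)] by blast
  qed
  ultimately show ?thesis using False by (simp add: rrep_def)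
qed

lemma e_eq: "i \<in> I \<Longrightarrow> c \<in> C \<Longrightarrow> c' \<in> C \<Longrightarrow> e i c = e i c' \<longleftrightarrow> c = c'"
  using e_inj by (auto simp: inj_on_def)

lemma rrep_rrep: "i \<in> I \<Longrightarrow> rrep i (rrep i g) = rrep i g"
  using rrep_translate[of i "cpart i g" "rrep i g"] cpart[of i g] by simp

lemma rrep_in: assumes i: "i \<in> I" and g: "g \<in> G i" shows "rrep i g \<in> G i"
proof -
  have "e i (cpart i g) + rrep i g \<in> G i" "e i (cpart i g) \<in> G i" using cpart[OF i, of g] g e_in[OF i] by auto
  then show ?thesis using subgrp_add_left[OF subG[OF i]] by blast
qed

lemma rrep_notin: assumes i: "i \<in> I" and g: "g \<notin> e i ` C" shows "rrep i g \<notin> e i ` C"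
proof
  assume "rrep i g \<in> e i ` C"
  then have "e i (cpart i g) + rrep i g \<in> e i ` C" using subgrp_add[OF subE[OF i]] cpart(1)[OF i] by blast
  then show False using g cpart(2)[OF i] by simp
qed

lemma cpart_unique:
  assumes i: "i \<in> I" and c: "c \<in> C" and t: "rrep i t = t" shows "cpart i (e i c + t) = c" "rrep i (e i c + t) = t"
proof -
  show r: "rrep i (e i c + t) = t" using rrep_translate[OF i c] t by simp
  have "e i (cpart i (e i c + t)) + t = e i c + t" using cpart(2)[OF i, of "e i c + t"] r by simp
  then show "cpart i (e i c + t) = c" using e_eq[OF i cpart(1)[OF i] c] by simp
qed

definition states :: "('c \<times> ('i \<times> 'a) list) set" where
  "states = {(c, ts). c \<in> C \<and> distinct_adj (map fst ts) \<and> (\<forall>(i, t)\<in>set ts. i \<in> I \<and> t \<in> G i - e i ` C \<and> rrep i t = t)}"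

text \<open>For each \<open>i\<close>, a state can be read as an element of \<open>G i\<close>
  followed by a list that does not begin with type \<open>i\<close>. \<open>split_off\<close> and
  \<open>glue\<close> convert between the two readings, and in the second one \<open>G i\<close>
  acts by translation.\<close>

definition split_off :: "'i \<Rightarrow> 'c \<times> ('i \<times> 'a) list \<Rightarrow> 'a \<times> ('i \<times> 'a) list" where
  "split_off i x = (case x of (c, []) \<Rightarrow> (e i c, []) | (c, (j, t) # r) \<Rightarrow> if j = i then (e i c + t, r) else (e i c, (j, t) # r))"

definition glue :: "'i \<Rightarrow> 'a \<times> ('i \<times> 'a) list \<Rightarrow> 'c \<times> ('i \<times> 'a) list" where
  "glue i y = (cpart i (fst y), if fst y \<in> e i ` C then snd y else (i, rrep i (fst y)) # snd y)"

definition splits :: "'i \<Rightarrow> ('a \<times> ('i \<times> 'a) list) set" where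
  "splits i = {(g, ts). g \<in> G i \<and> (0, ts) \<in> states \<and> (ts = [] \<or> fst (hd ts) \<noteq> i)}"

lemma split_off_in: "i \<in> I \<Longrightarrow> x \<in> states \<Longrightarrow> split_off i x \<in> splits i"
proof -
  assume i: "i \<in> I" and x: "x \<in> states"
  obtain c ts where [simp]: "x = (c, ts)" by fastforce
  show ?thesis
  proof (cases ts)
    case Nil
    then show ?thesis using i x e_in[OF i] subgrp_zero[OF subC] by (simp add: split_off_def splits_def states_def)
  next
    case (Cons p r)
    obtain j t where [simp]: "p = (j, t)" by fastforce
    show ?thesis using i x Cons e_in[OF i] subgrp_zero[OF subC] subgrp_add[OF subG[OF i]]
      by (cases r) (auto simp: split_off_def splits_def states_def)
  qed
qed

lemma glue_in: "i \<in> I \<Longrightarrow> y \<in> splits i \<Longrightarrow> glue i y \<in> states"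
proof -
  assume i: "i \<in> I" and y: "y \<in> splits i"
  obtain g ts where [simp]: "y = (g, ts)" by fastforce
  show ?thesis using i y cpart(1)[OF i] rrep_in[OF i] rrep_notin[OF i] rrep_rrep[OF i]
    by (cases ts) (auto simp: glue_def splits_def states_def)
qed

lemma glue_split: "i \<in> I \<Longrightarrow> x \<in> states \<Longrightarrow> glue i (split_off i x) = x"
proof -
  assume i: "i \<in> I" and x: "x \<in> states"
  obtain c ts where [simp]: "x = (c, ts)" by fastforce
  have c: "c \<in> C" using x by (simp add: states_def)
  have z: "rrep i 0 = 0" using subgrp_zero[OF subE[OF i]] by (simp add: rrep_def)
  have 0: "cpart i (e i c) = c" using cpart_unique[OF i c z] by simp
  show ?thesis
  proof (cases ts)
    case Nil
    then show ?thesis using c 0 by (simp add: split_off_def glue_def)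
  next
    case (Cons p r)
    obtain j t where [simp]: "p = (j, t)" by fastforce
    show ?thesis
    proof (cases "j = i")
      case True
      then have t: "rrep i t = t" "t \<notin> e i ` C" using x Cons by (auto simp: states_def)
      then have "e i c + t \<notin> e i ` C" using subgrp_add_left[OF subE[OF i], of "e i c" t] c by blast
      then show ?thesis using cpart_unique[OF i c t(1)] Cons True by (simp add: split_off_def glue_def)
    next
      case False
      then show ?thesis using c 0 Cons by (simp add: split_off_def glue_def)
    qed
  qed
qed

lemma split_glue: "i \<in> I \<Longrightarrow> y \<in> splits i \<Longrightarrow> split_off i (glue i y) = y"
proof -
  assume i: "i \<in> I" and y: "y \<in> splits i"
  obtain g ts where [simp]: "y = (g, ts)" by fastforce
  show ?thesis
  proof (cases "g \<in> e i ` C")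
    case True
    then have "e i (cpart i g) = g" using cpart(2)[OF i, of g] by (simp add: rrep_def)
    then show ?thesis using True y by (cases ts) (auto simp: glue_def split_off_def splits_def)
  next
    case False
    then show ?thesis using cpart(2)[OF i, of g] by (simp add: glue_def split_off_def)
  qed
qed

definition move :: "'i \<Rightarrow> 'a \<Rightarrow> 'c \<times> ('i \<times> 'a) list \<Rightarrow> 'c \<times> ('i \<times> 'a) list" where
  "move i g x = glue i (g + fst (split_off i x), snd (split_off i x))"

lemma move_splits: "i \<in> I \<Longrightarrow> g \<in> G i \<Longrightarrow> x \<in> states \<Longrightarrow> (g + fst (split_off i x), snd (split_off i x)) \<in> splits i"
  using split_off_in[of i x] subgrp_add[OF subG] by (auto simp: splits_def)

lemma move_in: "i \<in> I \<Longrightarrow> g \<in> G i \<Longrightarrow> x \<in> states \<Longrightarrow> move i g x \<in> states"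
  unfolding move_def by (intro glue_in move_splits)

lemma move_add: "i \<in> I \<Longrightarrow> g \<in> G i \<Longrightarrow> h \<in> G i \<Longrightarrow> x \<in> states \<Longrightarrow> move i (g + h) x = move i g (move i h x)"
  using split_glue[OF _ move_splits[of i h x]] by (simp add: move_def add.assoc)

lemma move_zero: "i \<in> I \<Longrightarrow> x \<in> states \<Longrightarrow> move i 0 x = x"
  using glue_split by (simp add: move_def)

definition am :: "'i \<Rightarrow> 'a \<Rightarrow> ('c \<times> ('i \<times> 'a) list) bijection" where
  "am i g = Bijection (\<lambda>x. if x \<in> states then move i g x else x)"

lemma ap_am: assumes i: "i \<in> I" and g: "g \<in> G i" shows "ap (am i g) x = (if x \<in> states then move i g x else x)"
proof -
  have m: "- g \<in> G i" using subgrp_minus[OF subG[OF i] g] .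
  show ?thesis unfolding am_def
    by (rule ap_Bijection[of _ _ "move i (- g)"])
      (use i g m move_in move_add[of i g "- g", symmetric] move_add[of i "- g" g, symmetric] move_zero in auto)
qed

lemma am_add: assumes i: "i \<in> I" and g: "g \<in> G i" and h: "h \<in> G i" shows "am i (g + h) = am i g + am i h"
  using subgrp_add[OF subG[OF i] g h] i g h move_in move_add
  by (intro bijection_eqI) (auto simp: ap_am ap_plus)

text \<open>The result does not mention \<open>i\<close>: on the edge group the actions of all
  factors coincide.\<close>

lemma move_e: assumes i: "i \<in> I" and c: "c \<in> C" and x: "x \<in> states" shows "move i (e i c) x = (c + fst x, snd x)"
proof -
  obtain k ts where [simp]: "x = (k, ts)" by fastforce
  have k: "k \<in> C" using x by (simp add: states_def)
  have ck: "(c + k, ts) \<in> states" using x subgrp_add[OF subC c] by (simp add: states_def)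
  have "(e i c + fst (split_off i x), snd (split_off i x)) = split_off i (c + k, ts)"
    using e_add[OF i c k] by (cases ts) (auto simp: split_off_def add.assoc)
  then show ?thesis using glue_split[OF i ck] by (simp add: move_def)
qed

lemma am_agree: "i \<in> I \<Longrightarrow> j \<in> I \<Longrightarrow> c \<in> C \<Longrightarrow> am i (e i c) = am j (e j c)"
  by (intro bijection_eqI) (simp add: ap_am e_in move_e)

lemma base: "(0, []) \<in> states"
  using subgrp_zero[OF subC] by (simp add: states_def)

lemma ap_am_e_base: "i \<in> I \<Longrightarrow> c \<in> C \<Longrightarrow> ap (am i (e i c)) (0, []) = (c, [])"
  using base by (simp add: ap_am e_in move_e)

lemma am_inj: assumes i: "i \<in> I" and g: "g \<in> G i" and h: "h \<in> G i" and eq: "am i g = am i h" shows "g = h"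
proof -
  have "move i g (0, []) = move i h (0, [])" using ap_am[OF i g, of "(0, [])"] ap_am[OF i h, of "(0, [])"] eq base by simp
  then have "split_off i (move i g (0, [])) = split_off i (move i h (0, []))" by simp
  moreover have "split_off i (move i k (0, [])) = (k, [])" if "k \<in> G i" for k
    using split_glue[OF i move_splits[OF i that base]] e_zero[OF i] by (simp add: move_def split_off_def)
  ultimately show ?thesis using g h by simp
qed

text \<open>An alternating product applied to the base state writes its own sequence of types into
  the state. Elements of the edge group leave the list empty, which separates the two.\<close>

lemma alternating_states:
  assumes "distinct_adj (map fst ws)" "\<forall>(i, g)\<in>set ws. i \<in> I \<and> g \<in> G i - e i ` C"
  shows "ap (sum_list (map (\<lambda>(i, g). am i g) ws)) (0, []) \<in> states \<and>
    map fst (snd (ap (sum_list (map (\<lambda>(i, g). am i g) ws)) (0, []))) = map fst ws"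
  using assms
proof (induction ws)
  case Nil
  show ?case using base by (simp add: ap_zero)
next
  case (Cons p ws)
  obtain i g where [simp]: "p = (i, g)" by fastforce
  have i: "i \<in> I" and g: "g \<in> G i" "g \<notin> e i ` C" using Cons.prems by auto
  let ?x = "ap (sum_list (map (\<lambda>(i, g). am i g) ws)) (0, [])"
  have IH: "?x \<in> states" "map fst (snd ?x) = map fst ws" using Cons by (auto dest: distinct_adj_ConsD)
  obtain c ts where x: "?x = (c, ts)" by fastforce
  have c: "c \<in> C" using IH(1) x by (simp add: states_def)
  have hd: "ts = [] \<or> fst (hd ts) \<noteq> i"
    using IH(2) x Cons.prems(1) by (cases ts; cases ws) auto
  have "split_off i (c, ts) = (e i c, ts)" using hd by (cases ts) (auto simp: split_off_def)
  moreover have "g + e i c \<notin> e i ` C" using g c subgrp_add_right[OF subE[OF i], of "e i c" g] by blast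
  ultimately have "move i g (c, ts) = (cpart i (g + e i c), (i, rrep i (g + e i c)) # ts)"
    by (simp add: move_def glue_def)
  moreover have "ap (sum_list (map (\<lambda>(i, g). am i g) (p # ws))) (0, []) = move i g (c, ts)"
    using ap_am[OF i g(1), of ?x] IH(1) x by (simp add: ap_plus)
  moreover have "move i g (c, ts) \<in> states" using move_in[OF i g(1) IH(1)] x by simp
  ultimately show ?case using IH(2) x by simp
qed

lemma am_alternating:
  assumes "ws \<noteq> []" "distinct_adj (map fst ws)" "\<forall>(i, g)\<in>set ws. i \<in> I \<and> g \<in> G i - e i ` C" "j \<in> I" "c \<in> C"
  shows "sum_list (map (\<lambda>(i, g). am i g) ws) \<noteq> am j (e j c)"
  using alternating_states[OF assms(2,3)] ap_am_e_base[OF assms(4,5)] assms(1) by fastforce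

end

section \<open>Presentations and amalgams\<close>

lemma evalw_pres_cong:
  assumes R: "\<And>u v. (u, v) \<in> R \<Longrightarrow> u \<in> words_on X \<Longrightarrow> v \<in> words_on X \<Longrightarrow> evalw \<psi> u = evalw \<psi> v"
    and "(u, v) \<in> pres_cong X R"
  shows "evalw \<psi> u = evalw \<psi> v"
  using assms(2)
proof (induction rule: pres_cong.induct)
  case (cancel p q l)
  then show ?case by (simp add: evalw_Cons[of \<psi> l "inv_letter l # q"] evalw_Cons[of \<psi> "inv_letter l" q] evalw_inv_letter)
qed (use R in simp_all)

lemma words_on_mono: "w \<in> words_on U \<Longrightarrow> U \<subseteq> X \<Longrightarrow> w \<in> words_on X"
  by (induction w) auto

lemma pres_cong_mono:
  assumes "(u, v) \<in> pres_cong X R" "X \<subseteq> Y"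
  shows "(u, v) \<in> pres_cong Y R"
  using assms(1)
proof (induction rule: pres_cong.induct)
  case (refl u)
  then show ?case using words_on_mono assms(2) pres_cong.refl by blast
next
  case (sym u v)
  then show ?case using pres_cong.sym by blast
next
  case (trans u v w)
  show ?case using trans.IH by (rule pres_cong.trans)
next
  case (cancel p q l)
  then show ?case using words_on_mono assms(2) by (intro pres_cong.cancel) auto
next
  case (rel p q u v)
  then show ?case using words_on_mono assms(2) by (intro pres_cong.rel) auto
qed

text \<open>\<open>f\<close> identifies the presented group with the span of its generators in an
  arbitrary additive group. Subgroups then come from restricting \<open>f\<close> to fewer
  generators, without forming new quotients.\<close>

definition realizes :: "'v set \<Rightarrow> ('v word \<times> 'v word) set \<Rightarrow> ('v \<Rightarrow> 'g::group_add) \<Rightarrow> bool" where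
  "realizes X R f \<longleftrightarrow> (\<forall>u\<in>words_on X. \<forall>v\<in>words_on X. evalw f u = evalw f v \<longleftrightarrow> (u, v) \<in> pres_cong X R)"

text \<open>Injectivity of the natural map between two presented groups. The same \<open>R\<close>
  serves both, since \<open>pres_cong\<close> applies a relation only if its two sides are words
  over the given generators.\<close>

definition embeds :: "('v word \<times> 'v word) set \<Rightarrow> 'v set \<Rightarrow> 'v set \<Rightarrow> bool" where
  "embeds R U X \<longleftrightarrow> (\<forall>u\<in>words_on U. \<forall>v\<in>words_on U. (u, v) \<in> pres_cong X R \<longrightarrow> (u, v) \<in> pres_cong U R)"

lemma realizesD: "realizes X R f \<Longrightarrow> u \<in> words_on X \<Longrightarrow> v \<in> words_on X \<Longrightarrow> evalw f u = evalw f v \<longleftrightarrow> (u, v) \<in> pres_cong X R"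
  unfolding realizes_def by blast

lemma realizes_restrict: "realizes X R f \<Longrightarrow> embeds R U X \<Longrightarrow> U \<subseteq> X \<Longrightarrow> realizes U R f"
  unfolding realizes_def embeds_def using words_on_mono pres_cong_mono by blast

lemma embeds_refl: "embeds R X X"
  by (simp add: embeds_def)

lemma embeds_trans: "embeds R U Y \<Longrightarrow> embeds R Y X \<Longrightarrow> U \<subseteq> Y \<Longrightarrow> embeds R U X"
  unfolding embeds_def using words_on_mono by blast

lemma realizes_hom:
  assumes f: "realizes X R f"
    and R: "\<And>u v. (u, v) \<in> R \<Longrightarrow> u \<in> words_on X \<Longrightarrow> v \<in> words_on X \<Longrightarrow> evalw \<psi> u = evalw \<psi> v"
  obtains \<theta> where "\<And>w. w \<in> words_on X \<Longrightarrow> \<theta> (evalw f w) = evalw \<psi> w"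
    "\<And>a b. a \<in> gspan (f ` X) \<Longrightarrow> b \<in> gspan (f ` X) \<Longrightarrow> \<theta> (a + b) = \<theta> a + \<theta> b"
proof
  define \<theta> where "\<theta> g = evalw \<psi> (SOME w. w \<in> words_on X \<and> evalw f w = g)" for g
  show *: "\<theta> (evalw f w) = evalw \<psi> w" if w: "w \<in> words_on X" for w
  proof -
    have "\<exists>u. u \<in> words_on X \<and> evalw f u = evalw f w" using w by blast
    from someI_ex[OF this] show ?thesis unfolding \<theta>_def 
      using realizesD[OF f _ w] evalw_pres_cong[of R X \<psi>] R by blast
  qed
  fix a b assume "a \<in> gspan (f ` X)" "b \<in> gspan (f ` X)"
  then obtain u v where "u \<in> words_on X" "a = evalw f u" "v \<in> words_on X" "b = evalw f v" unfolding gspan_evalw by blast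
  then show "\<theta> (a + b) = \<theta> a + \<theta> b" using *[of u] *[of v] *[of "u @ v"] by simp
qed

text \<open>The left regular representation, extended by the identity outside the carrier.\<close>

definition cayley :: "('a, 'b) monoid_scheme \<Rightarrow> 'a \<Rightarrow> 'a bijection" where
  "cayley Q g = Bijection (\<lambda>x. if x \<in> carrier Q then g \<otimes>\<^bsub>Q\<^esub> x else x)"

context group
begin

lemma ap_cayley: "g \<in> carrier G \<Longrightarrow> ap (cayley G g) x = (if x \<in> carrier G then g \<otimes> x else x)"
  unfolding cayley_def
  by (rule ap_Bijection[of _ _ "\<lambda>x. inv g \<otimes> x"]) (auto simp: m_assoc[symmetric])

lemma cayley_mult: "g \<in> carrier G \<Longrightarrow> h \<in> carrier G \<Longrightarrow> cayley G (g \<otimes> h) = cayley G g + cayley G h"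
  by (rule bijection_eqI) (auto simp: ap_cayley ap_plus m_assoc)

lemma cayley_one: "cayley G \<one> = 0"
  by (rule bijection_eqI) (auto simp: ap_cayley ap_zero)

lemma cayley_inj: "g \<in> carrier G \<Longrightarrow> h \<in> carrier G \<Longrightarrow> cayley G g = cayley G h \<longleftrightarrow> g = h"
  using ap_cayley[of g \<one>] ap_cayley[of h \<one>] by (metis one_closed r_one)

end

definition pres_gen :: "'v set \<Rightarrow> ('v word \<times> 'v word) set \<Rightarrow> 'v \<Rightarrow> 'v word set bijection" where
  "pres_gen X R v = cayley (presented_group X R) (pres_cong X R `` {[(v, True)]})"

lemma evalw_pres_gen: "w \<in> words_on X \<Longrightarrow> evalw (pres_gen X R) w = cayley (presented_group X R) (pres_cong X R `` {w})"
proof (induction w)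
  case Nil
  show ?case using group.cayley_one[OF group_presented_group, of X R] by (simp add: presented_group_one)
next
  case (Cons l w)
  interpret group "presented_group X R" by (rule group_presented_group)
  obtain v b where l: "l = (v, b)" by fastforce
  have lw: "[(v, c)] \<in> words_on X" for c using Cons.prems l by simp
  let ?T = "pres_cong X R `` {[(v, True)]}" and ?F = "pres_cong X R `` {[(v, False)]}"
  have in': "?T \<in> carrier (presented_group X R)" "?F \<in> carrier (presented_group X R)"
    using presented_group_carrierI lw by blast+
  have "?T \<otimes>\<^bsub>presented_group X R\<^esub> ?F = pres_cong X R `` {[(v, True)] @ [(v, False)]}"
    using presented_group_mult lw by blast
  also have "\<dots> = \<one>\<^bsub>presented_group X R\<^esub>"
    unfolding presented_group_one
    using pres_cong.cancel[of "[]" X "[]" "(v, True)" R] lw[of True]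
    by (intro equiv_class_eq[OF equiv_pres_cong]) (simp add: inv_letter_def)
  finally have "cayley (presented_group X R) ?T + cayley (presented_group X R) ?F = 0"
    using cayley_mult[OF in'] cayley_one by simp
  then have "cayley (presented_group X R) ?F = - cayley (presented_group X R) ?T" by (metis minus_unique)
  then have "evalw (pres_gen X R) [l] = cayley (presented_group X R) (pres_cong X R `` {[l]})"
    using l by (cases b) (auto simp: evalw_def pres_gen_def)
  moreover have "pres_cong X R `` {[l]} \<otimes>\<^bsub>presented_group X R\<^esub> pres_cong X R `` {w} = pres_cong X R `` {[l] @ w}"
    using presented_group_mult[of "[l]" X w R] Cons.prems by simp
  moreover have "pres_cong X R `` {[l]} \<in> carrier (presented_group X R)" "pres_cong X R `` {w} \<in> carrier (presented_group X R)"
    using Cons.prems by (auto intro!: presented_group_carrierI)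
  ultimately show ?case using Cons cayley_mult[of "pres_cong X R `` {[l]}" "pres_cong X R `` {w}"]
    by (simp add: evalw_Cons[of _ l w])
qed

lemma realizes_pres_gen: "realizes X R (pres_gen X R)"
  unfolding realizes_def
proof (intro ballI)
  interpret group "presented_group X R" by (rule group_presented_group)
  fix u v assume uv: "u \<in> words_on X" "v \<in> words_on X"
  have "evalw (pres_gen X R) u = evalw (pres_gen X R) v \<longleftrightarrow> pres_cong X R `` {u} = pres_cong X R `` {v}"
    using uv cayley_inj presented_group_carrierI evalw_pres_gen by metis
  also have "\<dots> \<longleftrightarrow> (u, v) \<in> pres_cong X R"
    using eq_equiv_class_iff[OF equiv_pres_cong uv] .
  finally show "evalw (pres_gen X R) u = evalw (pres_gen X R) v \<longleftrightarrow> (u, v) \<in> pres_cong X R" .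
qed

text \<open>Again van der Waerden's trick: free generators act on reduced words by left multiplication.\<close>

definition push :: "'v \<times> bool \<Rightarrow> 'v word \<Rightarrow> 'v word" where
  "push l u = (case u of [] \<Rightarrow> [l] | k # r \<Rightarrow> if k = inv_letter l then r else l # u)"

lemma push_reduced: "reduced u \<Longrightarrow> reduced (push l u)"
  by (cases u rule: reduced.cases) (auto simp: push_def)

lemma push_push: "reduced u \<Longrightarrow> push (inv_letter l) (push l u) = u"
  by (cases u rule: reduced.cases) (auto simp: push_def)

lemma push_Cons: "reduced (l # w) \<Longrightarrow> push l w = l # w"
  by (cases w) (auto simp: push_def)

definition free_gen :: "'v \<Rightarrow> 'v word bijection" where
  "free_gen v = Bijection (\<lambda>u. if u \<in> {u. reduced u} then push (v, True) u else u)"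

lemma ap_free_letter: "reduced u \<Longrightarrow> ap (evalw free_gen [l]) u = push l u"
proof -
  assume u: "reduced u"
  obtain v b where l: "l = (v, b)" by fastforce
  have inv: "inv_letter (v, True) = (v, False)" "inv_letter (v, False) = (v, True)" by (simp_all add: inv_letter_def)
  have T: "ap (free_gen v) x = (if x \<in> {u. reduced u} then push (v, True) x else x)" for x
    unfolding free_gen_def
    by (rule ap_Bijection[of _ _ "push (v, False)"]) (use push_reduced push_push[of _ "(v, True)"] push_push[of _ "(v, False)"] inv in auto)
  have "ap (- free_gen v) u = push (v, False) u"
  proof -
    have "ap (free_gen v) (push (v, False) u) = u" using T push_reduced[OF u] push_push[OF u, of "(v, False)"] inv by simp
    then show ?thesis unfolding ap_uminus using inv_f_f[OF bij_is_inj[OF bij_ap]] by metis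
  qed
  then show ?thesis using T u l by (cases b) (auto simp: evalw_def)
qed

lemma ap_free_word: "reduced w \<Longrightarrow> ap (evalw free_gen w) [] = w"
proof (induction w)
  case (Cons l w)
  have "reduced w" using Cons.prems by (cases w) auto
  then show ?case using Cons ap_free_letter[of w l] push_Cons[OF Cons.prems] by (simp add: evalw_Cons[of _ l w] ap_plus)
qed (simp add: ap_zero)

lemma free_presentation_reduced:
  assumes "realizes L R f" and R: "\<And>u v. (u, v) \<in> R \<Longrightarrow> u \<in> words_on L \<Longrightarrow> v \<in> words_on L \<Longrightarrow> False"
    and w: "w \<in> words_on L" "reduced w" "w \<noteq> []"
  shows "evalw f w \<noteq> 0"
proof
  assume "evalw f w = 0"
  then have "(w, []) \<in> pres_cong L R" using realizesD[OF assms(1) w(1), of "[]"] by simp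
  then have "evalw free_gen w = evalw free_gen []" using evalw_pres_cong[of R L free_gen w "[]"] R by blast
  then show False using ap_free_word[OF w(2)] w(3) by (simp add: ap_zero)
qed

lemma free_presentation_free_like:
  assumes "realizes L R f" and "\<And>u v. (u, v) \<in> R \<Longrightarrow> u \<in> words_on L \<Longrightarrow> v \<in> words_on L \<Longrightarrow> False"
  shows "free_like (gspan (f ` L))"
proof (rule free_group_free_like)
  show "evalw f w \<noteq> 0" if "w \<in> words_on L" "reduced w" "w \<noteq> []" for w
    by (rule free_presentation_reduced[OF assms(1) _ that]) (rule assms(2))
qed

text \<open>The property \<open>alternating\<close> is pulled back along \<open>\<theta>\<close>:
  syllables outside \<open>C\<close> go to syllables outside the edge group of the model, so their
  product goes to something outside it, whereas \<open>C\<close> goes into it.\<close>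

lemma amalgam_from_data:
  fixes \<theta> :: "'g::group_add \<Rightarrow> ('c::group_add \<times> ('i \<times> 'a::group_add) list) bijection"
  assumes D: "amalgam_data G' I C' e" and sub: "\<And>i. i \<in> I \<Longrightarrow> subgrp (G i)" "subgrp C" "\<And>i. i \<in> I \<Longrightarrow> C \<subseteq> G i" "I \<noteq> {}"
    and \<theta>: "subgrp A" "\<And>i. i \<in> I \<Longrightarrow> G i \<subseteq> A" "\<And>a b. a \<in> A \<Longrightarrow> b \<in> A \<Longrightarrow> \<theta> (a + b) = \<theta> a + \<theta> b"
    and lift: "\<And>i g. i \<in> I \<Longrightarrow> g \<in> G i - C \<Longrightarrow> \<exists>h\<in>G' i - e i ` C'. \<theta> g = amalgam_data.am G' I C' e i h"
    and edge: "\<And>c. c \<in> C \<Longrightarrow> \<exists>i\<in>I. \<exists>k\<in>C'. \<theta> c = amalgam_data.am G' I C' e i (e i k)"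
  shows "amalgam G I C"
proof
  interpret amalgam_data G' I C' e by (rule D)
  fix ws :: "('i \<times> 'g) list"
  assume ne: "ws \<noteq> []" and alt: "distinct_adj (map fst ws)" and ws: "\<forall>(i, g)\<in>set ws. i \<in> I \<and> g \<in> G i - C"
  define l where "l i g = (SOME h. h \<in> G' i - e i ` C' \<and> \<theta> g = am i h)" for i g
  have l: "l i g \<in> G' i - e i ` C' \<and> \<theta> g = am i (l i g)" if "i \<in> I" "g \<in> G i - C" for i g
    unfolding l_def using someI_ex[of "\<lambda>h. h \<in> G' i - e i ` C' \<and> \<theta> g = am i h"] lift[OF that] by blast
  let ?ws = "map (\<lambda>(i, g). (i, l i g)) ws"
  have val: "sum_list (map snd ws) \<in> A \<and> \<theta> (sum_list (map snd ws)) = sum_list (map (\<lambda>(i, g). am i g) ?ws)"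
    using ws
  proof (induction ws)
    case Nil
    have "\<theta> 0 = 0" using \<theta>(3)[of 0 0] subgrp_zero[OF \<theta>(1)] by (metis add_0_right add_left_cancel)
    then show ?case using subgrp_zero[OF \<theta>(1)] by simp
  next
    case (Cons p ws)
    obtain i g where p: "p = (i, g)" by fastforce
    have ig: "i \<in> I" "g \<in> G i - C" using Cons.prems p by auto
    then have "g \<in> A" using \<theta>(2) by blast
    moreover have IH: "sum_list (map snd ws) \<in> A" "\<theta> (sum_list (map snd ws)) = sum_list (map (\<lambda>(i, g). am i g) (map (\<lambda>(i, g). (i, l i g)) ws))"
      using Cons by simp_all
    ultimately show ?case using \<theta>(3)[of g "sum_list (map snd ws)"] subgrp_add[OF \<theta>(1)] l[OF ig] p by simp
  qed
  have ne': "sum_list (map (\<lambda>(i, g). am i g) ?ws) \<noteq> am j (e j c)" if "j \<in> I" "c \<in> C'" for j c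
  proof (rule am_alternating[OF _ _ _ that])
    show "?ws \<noteq> []" using ne by simp
    show "distinct_adj (map fst ?ws)" using alt by (simp add: o_def split_beta)
    show "\<forall>(i, g)\<in>set ?ws. i \<in> I \<and> g \<in> G' i - e i ` C'"
    proof
      fix p assume "p \<in> set ?ws"
      then obtain i g where ig: "(i, g) \<in> set ws" "p = (i, l i g)" by auto
      then have "i \<in> I" "g \<in> G i - C" using ws by auto
      then show "case p of (i, g) \<Rightarrow> i \<in> I \<and> g \<in> G' i - e i ` C'" using l[of i g] ig(2) by simp
    qed
  qed
  show "sum_list (map snd ws) \<notin> C"
  proof
    assume "sum_list (map snd ws) \<in> C"
    then obtain j k where "j \<in> I" "k \<in> C'" "\<theta> (sum_list (map snd ws)) = am j (e j k)" using edge by blast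
    then show False using ne'[of j k] val by simp
  qed
qed (use sub in auto)

text \<open>Under the injectivity hypotheses on \<open>L\<close>, the group presented on \<open>\<Union>\<V>\<close> is the
  amalgamated product of the groups presented on the members of \<open>\<V>\<close>.\<close>

locale amalgam_presentation =
  fixes \<V> :: "'v set set" and L :: "'v set" and R :: "('v word \<times> 'v word) set" and f :: "'v \<Rightarrow> 'g::group_add"
  assumes V_ne: "\<V> \<noteq> {}" and LV: "U \<in> \<V> \<Longrightarrow> L \<subseteq> U"
    and inter: "U \<in> \<V> \<Longrightarrow> W \<in> \<V> \<Longrightarrow> U \<noteq> W \<Longrightarrow> U \<inter> W \<subseteq> L"
    and rels: "(u, v) \<in> R \<Longrightarrow> u \<in> words_on (\<Union>\<V>) \<Longrightarrow> v \<in> words_on (\<Union>\<V>) \<Longrightarrow>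
      \<exists>U\<in>\<V>. u \<in> words_on U \<and> v \<in> words_on U"
    and emb: "U \<in> \<V> \<Longrightarrow> embeds R L U"
    and f: "realizes (\<Union>\<V>) R f"
begin

abbreviation F :: "'v set \<Rightarrow> 'v \<Rightarrow> 'v word set bijection" where "F U \<equiv> pres_gen U R"

definition GG :: "'v set \<Rightarrow> 'v word set bijection set" where "GG U = gspan (F U ` U)"
definition CC :: "'v word set bijection set" where "CC = gspan (F L ` L)"
text \<open>The natural map of the edge group into the factor. The choice of the word is immaterial
  by \<open>ee_evalw\<close>, and injectivity is the hypothesis \<open>emb\<close>.\<close>

definition ee :: "'v set \<Rightarrow> 'v word set bijection \<Rightarrow> 'v word set bijection" where
  "ee U c = evalw (F U) (SOME w. w \<in> words_on L \<and> evalw (F L) w = c)"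

lemma ee_evalw: "U \<in> \<V> \<Longrightarrow> w \<in> words_on L \<Longrightarrow> ee U (evalw (F L) w) = evalw (F U) w"
proof -
  assume U: "U \<in> \<V>" and w: "w \<in> words_on L"
  let ?u = "SOME u. u \<in> words_on L \<and> evalw (F L) u = evalw (F L) w"
  have "\<exists>u. u \<in> words_on L \<and> evalw (F L) u = evalw (F L) w" using w by blast
  from someI_ex[OF this] have u: "?u \<in> words_on L" "evalw (F L) ?u = evalw (F L) w" by auto
  then have "(?u, w) \<in> pres_cong L R" using realizesD[OF realizes_pres_gen u(1) w] by blast
  then have "(?u, w) \<in> pres_cong U R" using pres_cong_mono LV[OF U] by blast
  then show ?thesis unfolding ee_def
    using realizesD[OF realizes_pres_gen[of U R], of ?u w] u(1) w LV[OF U] words_on_mono by blast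
qed

lemma CC_cases: "c \<in> CC \<Longrightarrow> \<exists>w\<in>words_on L. c = evalw (F L) w"
  unfolding CC_def gspan_evalw by blast

lemma data: "amalgam_data GG \<V> CC ee"
proof
  fix U assume U: "U \<in> \<V>"
  show "subgrp (GG U)" unfolding GG_def by (rule subgrp_gspan)
  show "ee U c \<in> GG U" if "c \<in> CC" for c
    using CC_cases[OF that] ee_evalw[OF U] words_on_mono[OF _ LV[OF U]] unfolding GG_def gspan_evalw by force
  show "ee U (c + c') = ee U c + ee U c'" if "c \<in> CC" "c' \<in> CC" for c c'
  proof -
    obtain w w' where w: "w \<in> words_on L" "c = evalw (F L) w" "w' \<in> words_on L" "c' = evalw (F L) w'"
      using CC_cases[OF \<open>c \<in> CC\<close>] CC_cases[OF \<open>c' \<in> CC\<close>] by blast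
    then show ?thesis using ee_evalw[OF U, of "w @ w'"] ee_evalw[OF U, of w] ee_evalw[OF U, of w'] by simp
  qed
  show "inj_on (ee U) CC"
  proof (rule inj_onI)
    fix c c' assume "c \<in> CC" "c' \<in> CC" and eq: "ee U c = ee U c'"
    then obtain w w' where w: "w \<in> words_on L" "c = evalw (F L) w" "w' \<in> words_on L" "c' = evalw (F L) w'"
      using CC_cases[OF \<open>c \<in> CC\<close>] CC_cases[OF \<open>c' \<in> CC\<close>] by blast
    then have "(w, w') \<in> pres_cong U R"
      using eq ee_evalw[OF U] realizesD[OF realizes_pres_gen[of U R]] words_on_mono[OF _ LV[OF U]] by metis
    then have "(w, w') \<in> pres_cong L R" using emb[OF U] w unfolding embeds_def by blast
    then show "c = c'" using realizesD[OF realizes_pres_gen[of L R]] w by blast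
  qed
qed (simp add: CC_def subgrp_gspan)

sublocale D: amalgam_data GG \<V> CC ee by (rule data)

definition \<psi> :: "'v \<Rightarrow> ('v word set bijection \<times> ('v set \<times> 'v word set bijection) list) bijection" where
  "\<psi> v = (let U = SOME U. U \<in> \<V> \<and> v \<in> U in D.am U (F U v))"

lemma F_in: "v \<in> U \<Longrightarrow> F U v \<in> GG U"
  unfolding GG_def by (intro gspan_base) simp

text \<open>A generator in two members lies in \<open>L\<close>, where the two actions on normal
  forms agree.\<close>

lemma psi_gen: assumes U: "U \<in> \<V>" "v \<in> U" shows "\<psi> v = D.am U (F U v)"
proof -
  let ?W = "SOME U. U \<in> \<V> \<and> v \<in> U"
  have "\<exists>U. U \<in> \<V> \<and> v \<in> U" using U by blast
  from someI_ex[OF this] have W: "?W \<in> \<V>" "v \<in> ?W" by auto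
  have "D.am ?W (F ?W v) = D.am U (F U v)"
  proof (cases "?W = U")
    case False
    then have vL: "v \<in> L" using inter[OF W(1) U(1)] W U by blast
    have "ee T (F L v) = F T v" if "T \<in> \<V>" for T
      using ee_evalw[OF that, of "[(v, True)]"] vL by (simp add: evalw_def)
    moreover have "F L v \<in> CC" unfolding CC_def using vL by (intro gspan_base) simp
    ultimately show ?thesis using D.am_agree[OF W(1) U(1), of "F L v"] W(1) U(1) by simp
  qed simp
  then show ?thesis by (simp add: \<psi>_def Let_def)
qed

lemma evalw_in: "w \<in> words_on U \<Longrightarrow> evalw (F U) w \<in> GG U"
  unfolding GG_def gspan_evalw by blast

lemma am_zero: "U \<in> \<V> \<Longrightarrow> D.am U 0 = 0"
  using D.am_add[of U 0 0] subgrp_zero[OF D.subG] by (metis add_0_right add_left_cancel)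

lemma psi_word: "U \<in> \<V> \<Longrightarrow> w \<in> words_on U \<Longrightarrow> evalw \<psi> w = D.am U (evalw (F U) w)"
proof (induction w)
  case Nil
  then show ?case using am_zero by simp
next
  case (Cons l w)
  obtain v b where l: "l = (v, b)" by fastforce
  have v: "v \<in> U" and w: "w \<in> words_on U" using Cons.prems l by auto
  have m: "D.am U (- F U v) = - D.am U (F U v)"
    using D.am_add[OF Cons.prems(1) subgrp_minus[OF D.subG[OF Cons.prems(1)] F_in[OF v]] F_in[OF v]] am_zero[OF Cons.prems(1)]
    by (simp add: eq_neg_iff_add_eq_0)
  have "evalw \<psi> [l] = D.am U (evalw (F U) [l])"
    using psi_gen[OF Cons.prems(1) v] m l by (cases b) (auto simp: evalw_def)
  moreover have "evalw (F U) [l] \<in> GG U" using v l by (intro evalw_in) simp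
  ultimately show ?case using Cons.IH[OF Cons.prems(1) w] D.am_add[OF Cons.prems(1) _ evalw_in[OF w]]
    by (simp add: evalw_Cons[of _ l w])
qed

lemma psi_rel: "(u, v) \<in> R \<Longrightarrow> u \<in> words_on (\<Union>\<V>) \<Longrightarrow> v \<in> words_on (\<Union>\<V>) \<Longrightarrow> evalw \<psi> u = evalw \<psi> v"
proof -
  assume uv: "(u, v) \<in> R" "u \<in> words_on (\<Union>\<V>)" "v \<in> words_on (\<Union>\<V>)"
  then obtain U where U: "U \<in> \<V>" "u \<in> words_on U" "v \<in> words_on U" using rels by blast
  have "(u, v) \<in> pres_cong U R" using pres_cong.rel[of "[]" U "[]" u v R] uv(1) U by simp
  then show ?thesis using psi_word U realizesD[OF realizes_pres_gen[of U R]] by metis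
qed

text \<open>The generators satisfy all relations in the model, so words equal over the whole set act
  equally there. The factor of \<open>U\<close> acts faithfully.\<close>

lemma embeds_part: "U \<in> \<V> \<Longrightarrow> embeds R U (\<Union>\<V>)"
  unfolding embeds_def
proof (intro ballI impI)
  fix u v assume U: "U \<in> \<V>" and uv: "u \<in> words_on U" "v \<in> words_on U" "(u, v) \<in> pres_cong (\<Union>\<V>) R"
  have "evalw \<psi> u = evalw \<psi> v" using evalw_pres_cong[OF psi_rel uv(3)] by blast
  then have "evalw (F U) u = evalw (F U) v" using psi_word[OF U] uv D.am_inj[OF U] evalw_in by metis
  then show "(u, v) \<in> pres_cong U R" using realizesD[OF realizes_pres_gen] uv by blast
qed

lemma realizes_part: "U \<in> \<V> \<Longrightarrow> realizes U R f"
  using realizes_restrict[OF f embeds_part] by blast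

lemma realizes_edge: "realizes L R f"
proof -
  obtain U where "U \<in> \<V>" using V_ne by blast
  then show ?thesis using realizes_restrict[OF realizes_part emb LV] by blast
qed

lemma amalgam: "amalgam (\<lambda>U. gspan (f ` U)) \<V> (gspan (f ` L))"
proof -
  obtain \<theta> where \<theta>: "\<And>w. w \<in> words_on (\<Union>\<V>) \<Longrightarrow> \<theta> (evalw f w) = evalw \<psi> w"
    "\<And>a b. a \<in> gspan (f ` (\<Union>\<V>)) \<Longrightarrow> b \<in> gspan (f ` (\<Union>\<V>)) \<Longrightarrow> \<theta> (a + b) = \<theta> a + \<theta> b"
    using realizes_hom[OF f psi_rel] by blast
  have mono: "w \<in> words_on (\<Union>\<V>)" if "U \<in> \<V>" "w \<in> words_on U" for U w using that words_on_mono by blast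
  show ?thesis
  proof (rule amalgam_from_data[OF data _ _ _ V_ne, where \<theta> = \<theta> and A = "gspan (f ` (\<Union>\<V>))"])
    show "gspan (f ` L) \<subseteq> gspan (f ` U)" if "U \<in> \<V>" for U using LV[OF that] by (intro gspan_mono) blast
    show "gspan (f ` U) \<subseteq> gspan (f ` (\<Union>\<V>))" if "U \<in> \<V>" for U using that by (intro gspan_mono) blast
    show "\<theta> (a + b) = \<theta> a + \<theta> b" if "a \<in> gspan (f ` (\<Union>\<V>))" "b \<in> gspan (f ` (\<Union>\<V>))" for a b using \<theta>(2) that .
  next
    fix U g assume U: "U \<in> \<V>" and g: "g \<in> gspan (f ` U) - gspan (f ` L)"
    then obtain w where w: "w \<in> words_on U" "g = evalw f w" unfolding gspan_evalw by blast
    \<comment> \<open>Otherwise \<open>w\<close> equals a word over \<open>L\<close> already in the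
      group of \<open>U\<close>, and hence also under \<open>f\<close>.\<close>
    have "evalw (F U) w \<notin> ee U ` CC"
    proof
      assume "evalw (F U) w \<in> ee U ` CC"
      then obtain l where l: "l \<in> words_on L" "evalw (F U) w = evalw (F U) l" using CC_cases ee_evalw[OF U] by force
      then have "(w, l) \<in> pres_cong U R" using realizesD[OF realizes_pres_gen] w words_on_mono LV[OF U] by blast
      then have "evalw f w = evalw f l" using realizesD[OF realizes_part[OF U]] w l words_on_mono LV[OF U] by blast
      moreover have "evalw f l \<in> gspan (f ` L)" unfolding gspan_evalw using l(1) by (rule imageI)
      ultimately show False using g w(2) by simp
    qed
    then show "\<exists>h\<in>GG U - ee U ` CC. \<theta> g = D.am U h"
      using \<theta>(1)[OF mono[OF U w(1)]] psi_word[OF U w(1)] w(2) evalw_in[OF w(1)] by auto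
  next
    fix c assume "c \<in> gspan (f ` L)"
    then obtain l where l: "l \<in> words_on L" "c = evalw f l" unfolding gspan_evalw by blast
    obtain U where U: "U \<in> \<V>" using V_ne by blast
    have lU: "l \<in> words_on U" using words_on_mono l LV[OF U] by blast
    have "\<theta> c = D.am U (ee U (evalw (F L) l))"
      using \<theta>(1)[OF mono[OF U lU]] psi_word[OF U lU] ee_evalw[OF U l(1)] l(2) by simp
    moreover have "evalw (F L) l \<in> CC" unfolding CC_def gspan_evalw using l by blast
    ultimately show "\<exists>U\<in>\<V>. \<exists>k\<in>CC. \<theta> c = D.am U (ee U k)" using U by blast
  qed (simp_all add: subgrp_gspan)
qed

lemma gspan_Union: "gspan (\<Union>U\<in>\<V>. gspan (f ` U)) = gspan (f ` (\<Union>\<V>))"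
proof
  have "gspan (f ` U) \<subseteq> gspan (f ` (\<Union>\<V>))" if "U \<in> \<V>" for U using that by (intro gspan_mono) blast
  then show "gspan (\<Union>U\<in>\<V>. gspan (f ` U)) \<subseteq> gspan (f ` (\<Union>\<V>))" by (intro gspan_least[OF subgrp_gspan]) blast
  show "gspan (f ` (\<Union>\<V>)) \<subseteq> gspan (\<Union>U\<in>\<V>. gspan (f ` U))" by (intro gspan_mono) (auto intro: gspan_base)
qed

lemma alternative_Union:
  assumes "free_like (gspan (f ` L))" "\<And>U. U \<in> \<V> \<Longrightarrow> alternative (gspan (f ` U))"
  shows "alternative (gspan (f ` (\<Union>\<V>)))"
  using amalgam.amalgam_alternative[OF amalgam assms] gspan_Union amalgam.A_def[OF amalgam] by simp

end

section \<open>Dihedral Artin groups\<close>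

definition nmul :: "nat \<Rightarrow> 'g::group_add \<Rightarrow> 'g" where
  "nmul n g = sum_list (replicate n g)"

definition zmul :: "int \<Rightarrow> 'g::group_add \<Rightarrow> 'g" where
  "zmul k g = (if 0 \<le> k then nmul (nat k) g else - nmul (nat (- k)) g)"

lemma nmul_simps [simp]: "nmul 0 g = 0" "nmul (Suc n) g = g + nmul n g"
  by (simp_all add: nmul_def)

lemma nmul_add: "nmul (m + n) g = nmul m g + nmul n g"
  by (induction m) (simp_all add: add.assoc)

lemma nmul_Suc2: "nmul (Suc n) g = nmul n g + g"
  using nmul_add[of n 1 g] by simp

lemma zmul_int [simp]: "zmul (int n) g = nmul n g"
  by (simp add: zmul_def)

lemma zmul_simps [simp]: "zmul 0 g = 0" "zmul 1 g = g"
  using zmul_int[of 1 g] by (simp_all add: zmul_def del: zmul_int)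

lemma zmul_minus: "zmul (- k) g = - zmul k g"
  by (auto simp: zmul_def)

lemma zmul_succ: "zmul (k + 1) g = zmul k g + g"
proof (cases "0 \<le> k")
  case True
  then have "nat (k + 1) = Suc (nat k)" by simp
  then show ?thesis using True nmul_Suc2[of "nat k" g] by (simp add: zmul_def del: nmul_simps)
next
  case False
  then obtain n where "k = - int (Suc n)" by (cases k rule: int_cases) auto
  then have "k = - int (Suc n)" "k + 1 = - int n" by simp_all
  then show ?thesis by (simp only: zmul_minus zmul_int nmul_simps minus_add) (simp add: add.assoc)
qed

lemma zmul_pred: "zmul (k - 1) g = zmul k g - g"
  using zmul_succ[of "k - 1" g] by simp

lemma zmul_add: "zmul (j + k) g = zmul j g + zmul k g"
proof (induction k rule: int_induct[where k = 0])
  case (step1 k)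
  have "zmul (j + (k + 1)) g = zmul (j + k) g + g" using zmul_succ[of "j + k" g] by (simp add: add.assoc)
  then show ?case using step1 zmul_succ[of k g] by (simp add: add.assoc)
next
  case (step2 k)
  have "zmul (j + (k - 1)) g = zmul (j + k) g - g" using zmul_pred[of "j + k" g] by (simp add: algebra_simps)
  then show ?case using step2 zmul_pred[of k g] by (simp add: group_norm del: add_uminus_conv_diff)
qed simp

lemma zmul_in: "subgrp H \<Longrightarrow> g \<in> H \<Longrightarrow> zmul k g \<in> H"
proof -
  assume H: "subgrp H" "g \<in> H"
  have "nmul n g \<in> H" for n by (induction n) (use H in \<open>auto intro: subgrp_zero subgrp_add\<close>)
  then show ?thesis using H subgrp_minus by (auto simp: zmul_def)
qed

lemma gspan_singleton: "gspan {g} = range (\<lambda>k. zmul k g)"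
proof
  show "gspan {g} \<subseteq> range (\<lambda>k. zmul k g)"
  proof
    fix x assume "x \<in> gspan {g}"
    then show "x \<in> range (\<lambda>k. zmul k g)"
    proof (induction rule: gspan_right_induct)
      case zero
      show ?case by (rule range_eqI[of _ _ 0]) simp
    next
      case (add x s)
      then obtain k where "x = zmul k g" "s = g" by blast
      then show ?case by (intro range_eqI[of _ _ "k + 1"]) (simp add: zmul_succ)
    next
      case (diff x s)
      then obtain k where "x = zmul k g" "s = g" by blast
      then show ?case by (intro range_eqI[of _ _ "k - 1"]) (simp add: zmul_pred)
    qed
  qed
  have "g \<in> gspan {g}" by (rule gspan_base) simp
  then show "range (\<lambda>k. zmul k g) \<subseteq> gspan {g}" using zmul_in[OF subgrp_gspan] by blast
qed

lemma zmul_mult: "zmul (j * k) g = zmul j (zmul k g)"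
proof (induction j rule: int_induct[where k = 0])
  case (step1 j)
  then show ?case using zmul_succ[of j "zmul k g"] zmul_add[of "j * k" k g] by (simp add: distrib_right)
next
  case (step2 j)
  have "zmul ((j - 1) * k) g = zmul (j * k) g - zmul k g"
    using zmul_add[of "j * k" "- k" g] zmul_minus[of k g] by (simp add: algebra_simps)
  then show ?case using step2 zmul_pred[of j "zmul k g"] by simp
qed simp

lemma zmul_hom:
  assumes "subgrp H" "\<And>a b. a \<in> H \<Longrightarrow> b \<in> H \<Longrightarrow> \<theta> (a + b) = \<theta> a + \<theta> b" "g \<in> H"
  shows "\<theta> (zmul k g) = zmul k (\<theta> g)"
proof -
  have z: "\<theta> 0 = 0" using assms(2)[of 0 0] subgrp_zero[OF assms(1)] by (metis add_0_right add_left_cancel)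
  have n: "\<theta> (nmul n g) = nmul n (\<theta> g) \<and> nmul n g \<in> H" for n
    by (induction n) (use assms z subgrp_zero subgrp_add in auto)
  have m: "\<theta> (- a) = - \<theta> a" if "a \<in> H" for a
    using assms(2)[OF that subgrp_minus[OF assms(1) that]] z by (metis add.right_inverse minus_unique)
  show ?thesis using n m by (simp add: zmul_def)
qed

lemma zmul_of_int [simp]: "zmul k (x :: int) = k * x"
proof (induction k rule: int_induct[where k = 0])
  case (step1 k)
  then show ?case using zmul_succ[of k x] by (simp add: algebra_simps)
next
  case (step2 k)
  then show ?case using zmul_pred[of k x] by (simp add: algebra_simps)
qed simp

lemma comm_zmul: "comm a b \<Longrightarrow> comm (zmul k a) b"
  using comm_gspan[of "{a}" b "zmul k a"] zmul_in[OF subgrp_gspan, of a "{a}"] gspan_base by blast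

lemma nmul_swap: "s + nmul n (t + s) = nmul n (s + t) + s"
  by (induction n) (simp_all add: add.assoc)

lemma free_like_cyclic:
  fixes \<tau> :: "'g::group_add \<Rightarrow> int"
  assumes "\<And>a b. a \<in> gspan {z} \<Longrightarrow> b \<in> gspan {z} \<Longrightarrow> \<tau> (a + b) = \<tau> a + \<tau> b" "\<tau> z \<noteq> 0"
  shows "free_like (gspan {z})"
proof (rule free_like_abelian[where \<tau> = \<tau>])
  show "comm a b" if "a \<in> gspan {z}" "b \<in> gspan {z}" for a b
    by (rule gspan_comm[OF _ that]) auto
  have z: "z \<in> gspan {z}" by (rule gspan_base) simp
  have "\<tau> (zmul k z) = k * \<tau> z" for k
    using zmul_hom[where H = "gspan {z}" and \<theta> = \<tau>, OF subgrp_gspan assms(1) z] by simp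
  then show "inj_on \<tau> (gspan {z})" using assms(2) unfolding gspan_singleton by (auto simp: inj_on_def)
qed (use assms in auto)

lemma alt_word_val:
  "evalw f (alt_word a b (2 * k)) = nmul k (f a + f b)"
  "evalw f (alt_word a b (2 * k + 1)) = nmul k (f a + f b) + f a"
proof -
  have T: "evalw f ((v, True) # w) = f v + evalw f w" for v w by (simp add: evalw_def)
  show "evalw f (alt_word a b (2 * k)) = nmul k (f a + f b)"
    by (induction k) (simp_all add: T add.assoc)
  show "evalw f (alt_word a b (2 * k + 1)) = nmul k (f a + f b) + f a"
    by (induction k) (simp_all add: T add.assoc)
qed

lemma alt_word_letters: "2 \<le> n \<Longrightarrow> alt_word a b n \<in> words_on X \<longleftrightarrow> a \<in> X \<and> b \<in> X"
proof -
  have 1: "alt_word a b n \<in> words_on X" if "a \<in> X" "b \<in> X" for a b n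
    using that by (induction n arbitrary: a b) auto
  assume "2 \<le> n"
  then obtain k where "n = Suc (Suc k)" using add_2_eq_Suc le_Suc_ex by blast
  then show ?thesis using 1 by auto
qed

lemma edge_distinct: "defining_graph V E m \<Longrightarrow> {a, b} \<in> E \<Longrightarrow> a \<noteq> b \<and> a \<in> V \<and> b \<in> V \<and> 2 \<le> m {a, b}"
  unfolding defining_graph_def by fastforce

lemma artin_relation_cases:
  assumes "defining_graph V E m" "(u, v) \<in> artin_relations E m" "u \<in> words_on X"
  obtains a b where "{a, b} \<in> E" "a \<in> X" "b \<in> X" "u = alt_word a b (m {a, b})" "v = alt_word b a (m {a, b})"
proof -
  obtain a b where ab: "{a, b} \<in> E" "u = alt_word a b (m {a, b})" "v = alt_word b a (m {a, b})"
    using assms(2) unfolding artin_relations_def by blast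
  have "2 \<le> m {a, b}" using edge_distinct[OF assms(1) ab(1)] by blast
  then have "a \<in> X" "b \<in> X" using alt_word_letters[of "m {a, b}" a b X] ab assms(3) by auto
  then show ?thesis using that ab by blast
qed

lemma artin_relation_val:
  assumes "defining_graph V E m" "\<And>a b. {a, b} \<in> E \<Longrightarrow> a \<in> X \<Longrightarrow> b \<in> X \<Longrightarrow>
      evalw \<psi> (alt_word a b (m {a, b})) = evalw \<psi> (alt_word b a (m {a, b}))"
    "(u, v) \<in> artin_relations E m" "u \<in> words_on X"
  shows "evalw \<psi> u = evalw \<psi> v"
proof -
  obtain a b where "{a, b} \<in> E" "a \<in> X" "b \<in> X" "u = alt_word a b (m {a, b})" "v = alt_word b a (m {a, b})"
    by (rule artin_relation_cases[OF assms(1,3,4)])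
  then show ?thesis using assms(2) by simp
qed

lemma edgeless_no_relation:
  assumes "defining_graph V E m" "\<And>a b. a \<in> L \<Longrightarrow> b \<in> L \<Longrightarrow> {a, b} \<notin> E" "(u, v) \<in> artin_relations E m" "u \<in> words_on L"
  shows False
  by (rule artin_relation_cases[OF assms(1,3,4)]) (use assms(2) in simp)

lemma evalw_one: "evalw (\<lambda>_. 1 :: int) (alt_word a b n) = int n"
  by (induction n arbitrary: a b) (simp_all add: evalw_Cons evalw_def)

locale dihedral =
  fixes V :: "'v set" and E m and a b :: 'v and f :: "'v \<Rightarrow> 'g::group_add"
  assumes graph: "defining_graph V E m" and edge: "{a, b} \<in> E" and f: "realizes {a, b} (artin_relations E m) f"
begin

abbreviation "M \<equiv> m {a, b}"
text \<open>With \<open>y = a b\<close> in multiplicative notation the relation simplifies. If the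
  label is \<open>2 k + 1\<close>, the element \<open>D = y^k a\<close> satisfies
  \<open>D^2 = y^M\<close>; if it is \<open>2 k\<close>, the power \<open>y^k\<close> commutes with
  \<open>a\<close>. These are the two amalgams used below.\<close>

definition y :: 'g where "y = f a + f b"
abbreviation AA :: "'g set" where "AA \<equiv> gspan {f a, f b}"

lemma ab: "a \<noteq> b" "2 \<le> M" using edge_distinct[OF graph edge] by auto

lemma subAA: "subgrp AA" by (rule subgrp_gspan)

lemma gens: "f a \<in> AA" "f b \<in> AA" "y \<in> AA"
  unfolding y_def by (auto intro: gspan_base subgrp_add[OF subAA])

lemma hom:
  assumes "evalw \<psi> (alt_word a b M) = evalw \<psi> (alt_word b a M)"
  shows "\<exists>\<theta>. (\<forall>g\<in>AA. \<forall>h\<in>AA. \<theta> (g + h) = \<theta> g + \<theta> h) \<and> \<theta> (f a) = \<psi> a \<and> \<theta> (f b) = \<psi> b \<and> \<theta> y = \<psi> a + \<psi> b"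
proof -
  have "evalw \<psi> u = evalw \<psi> v" if uv: "(u, v) \<in> artin_relations E m" "u \<in> words_on {a, b}" "v \<in> words_on {a, b}" for u v
  proof (rule artin_relation_val[OF graph _ uv(1,2)])
    fix c e assume ce: "{c, e} \<in> E" "c \<in> {a, b}" "e \<in> {a, b}"
    then have "c \<noteq> e" using edge_distinct[OF graph] by blast
    then have "c = a \<and> e = b \<or> c = b \<and> e = a" using ce by auto
    then show "evalw \<psi> (alt_word c e (m {c, e})) = evalw \<psi> (alt_word e c (m {c, e}))"
      using assms insert_commute[of a b "{}"] by auto
  qed
  from realizes_hom[OF f this]
  obtain \<theta> where 1: "\<And>w. w \<in> words_on {a, b} \<Longrightarrow> \<theta> (evalw f w) = evalw \<psi> w"
    and 2: "\<And>g h. g \<in> gspan (f ` {a, b}) \<Longrightarrow> h \<in> gspan (f ` {a, b}) \<Longrightarrow> \<theta> (g + h) = \<theta> g + \<theta> h" by blast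
  have 3: "\<theta> (f a) = \<psi> a" "\<theta> (f b) = \<psi> b"
    using 1[of "[(a, True)]"] 1[of "[(b, True)]"] by (simp_all add: evalw_def)
  have 4: "\<theta> (g + h) = \<theta> g + \<theta> h" if "g \<in> AA" "h \<in> AA" for g h using 2[of g h] that by simp
  have "\<theta> y = \<psi> a + \<psi> b" using 3 4[OF gens(1,2)] by (simp add: y_def)
  then show ?thesis using 3 4 by blast
qed

lemma rel: "evalw f (alt_word a b M) = evalw f (alt_word b a M)"
proof -
  have w: "alt_word a b M \<in> words_on {a, b}" "alt_word b a M \<in> words_on {a, b}" 
    by (simp_all add: alt_word_letters[OF ab(2)])
  have "(alt_word a b M, alt_word b a M) \<in> artin_relations E m" using edge unfolding artin_relations_def by blast
  then have "(alt_word a b M, alt_word b a M) \<in> pres_cong {a, b} (artin_relations E m)"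
    using pres_cong.rel[of "[]" "{a, b}" "[]" "alt_word a b M" "alt_word b a M"] w by simp
  then show ?thesis using realizesD[OF f w] by simp
qed

lemma exponent: "\<exists>\<theta> :: 'g \<Rightarrow> int. (\<forall>g\<in>AA. \<forall>h\<in>AA. \<theta> (g + h) = \<theta> g + \<theta> h) \<and> \<theta> (f a) = 1 \<and> \<theta> (f b) = 1 \<and> \<theta> y = 2"
  using hom[of "\<lambda>_. 1 :: int"] by (simp add: evalw_one)

lemma zmul_AA: "g \<in> AA \<Longrightarrow> zmul k g \<in> AA"
  using zmul_in[OF subAA] by blast

lemma gspan_AA: "S \<subseteq> AA \<Longrightarrow> gspan S \<subseteq> AA"
  using gspan_least[OF subAA] by blast

lemma AA_gen: "y \<in> H \<Longrightarrow> f a \<in> H \<Longrightarrow> subgrp H \<Longrightarrow> AA \<subseteq> H"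
proof (rule gspan_least)
  assume H: "y \<in> H" "f a \<in> H" "subgrp H"
  have "f b = - f a + y" by (simp add: y_def)
  then show "{f a, f b} \<subseteq> H" using H(2) subgrp_add[OF H(3) subgrp_minus[OF H(3,2)] H(1)] by simp
qed

text \<open>The exponent sum of \<open>z\<close> is \<open>2 * k\<close>, which is nonzero, so the
  edge group is infinite cyclic. The two factors are indexed by \<open>bool\<close>.\<close>

lemma alternative_from_amalgam:
  assumes am: "amalgam Gi (UNIV :: bool set) (gspan {z})"
    and z2: "z = zmul k y" "k \<noteq> 0"
    and ab: "\<And>i g h. g \<in> Gi i \<Longrightarrow> h \<in> Gi i \<Longrightarrow> comm g h"
    and gen: "AA \<subseteq> gspan (\<Union>i. Gi i)"
  shows "alternative AA"
proof -
  interpret amalgam Gi "UNIV :: bool set" "gspan {z}" by (rule am)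
  obtain \<theta> :: "'g \<Rightarrow> int" where \<theta>: "\<forall>g\<in>AA. \<forall>h\<in>AA. \<theta> (g + h) = \<theta> g + \<theta> h" "\<theta> y = 2"
    using exponent by blast
  have z: "z \<in> AA" unfolding z2(1) using zmul_AA gens(3) by blast
  have sub: "gspan {z} \<subseteq> AA" using gspan_AA z by blast
  have "\<theta> z = k * 2" unfolding z2(1) using zmul_hom[OF subAA _ gens(3), of \<theta> k] \<theta> by simp
  then have "free_like (gspan {z})" by (intro free_like_cyclic[of z \<theta>]) (use \<theta> sub z2(2) in auto)
  then have "alternative A"
    by (rule amalgam_alternative) (use alternative_abelian[OF subG] ab in blast)
  then show ?thesis using alternative_mono gen unfolding A_def by blast
qed

end

declare zmul_int [simp del]

lemma nmul_conj: "nmul k (- x + g + x) = - x + nmul k g + x"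
  by (induction k) (simp_all add: add.assoc)

lemma nmul_minus: "nmul k (- g) = - nmul k g"
proof (induction k)
  case (Suc k)
  have "- nmul (Suc k) g = - (nmul k g + g)" by (simp only: nmul_Suc2)
  then show ?case using Suc by (simp add: minus_add)
qed simp

lemma zmul_prod: "zmul p (x, y) = (zmul p x, zmul p y)"
proof -
  have "subgrp UNIV" by (simp add: subgrp_def)
  then have "fst (zmul p (x, y)) = zmul p (fst (x, y))" "snd (zmul p (x, y)) = zmul p (snd (x, y))"
    by (rule zmul_hom; simp)+
  then show ?thesis by (simp add: prod_eq_iff)
qed

lemma gspan_superset: "S \<subseteq> gspan S"
  using gspan_base by blast

context dihedral
begin

section \<open>Odd label\<close>

context
  fixes k :: nat
  assumes k: "M = 2 * k + 1"
begin

lemma k_pos: "1 \<le> k" using ab(2) k by simp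

text \<open>The alternating product of all \<open>M\<close> letters, known as the Garside
  element.\<close>

definition D :: 'g where "D = zmul (int k) y + f a"

lemma D_AA: "D \<in> AA"
  unfolding D_def using zmul_AA gens subgrp_add[OF subAA] by blast

lemma D_D: "D + D = zmul (int M) y"
proof -
  have D1: "D = nmul k y + f a" by (simp add: D_def zmul_int)
  \<comment> \<open>The relation permits spelling the same element beginning with \<open>b\<close>;
    the square combines both spellings.\<close>
  have D2: "D = nmul k (f b + f a) + f b"
    using rel alt_word_val(2)[of f a b k] alt_word_val(2)[of f b a k] k D1 by (simp add: y_def)
  have "D + D = (nmul k y + f a) + (nmul k (f b + f a) + f b)" using D1 D2 by metis
  also have "\<dots> = nmul k y + (f a + nmul k (f b + f a)) + f b" by (simp add: add.assoc)
  also have "\<dots> = nmul k y + (nmul k y + f a) + f b" unfolding nmul_swap[of "f a" k "f b"] y_def ..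
  also have "\<dots> = nmul (k + k) y + y" by (simp add: nmul_add add.assoc y_def)
  also have "\<dots> = nmul (Suc (k + k)) y" by (rule nmul_Suc2[symmetric])
  also have "Suc (k + k) = M" using k by simp
  finally show ?thesis by (simp only: zmul_int)
qed

text \<open>The model is a product of two infinite cyclic groups amalgamated along the multiples of
  2 and of \<open>M\<close>. The factor \<open>True\<close> stands for \<open>D\<close>, the factor
  \<open>False\<close> for \<open>y\<close>.\<close>

abbreviation eo :: "bool \<Rightarrow> int \<Rightarrow> int" where "eo i c \<equiv> (if i then 2 * c else int M * c)"

interpretation O: amalgam_data "\<lambda>_ :: bool. UNIV :: int set" UNIV "UNIV :: int set" eo
  by unfold_locales (use k in \<open>auto simp: subgrp_def distrib_left inj_on_def\<close>)

definition X where "X = O.am True 1"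
definition Y where "Y = O.am False 1"

lemma am_zmul: "O.am True n = zmul n X" "O.am False n = zmul n Y"
proof -
  have s: "subgrp (UNIV :: int set)" by (simp add: subgrp_def)
  have "O.am i (zmul n 1) = zmul n (O.am i 1)" for i by (rule zmul_hom[OF s]) (use O.am_add in auto)
  then show "O.am True n = zmul n X" "O.am False n = zmul n Y" by (simp_all add: X_def Y_def)
qed

lemma X_X: "X + X = zmul (int M) Y"
proof -
  have "O.am True (eo True 1) = O.am False (eo False 1)" by (rule O.am_agree) auto
  then have "zmul (1 + 1) X = zmul (int M) Y" by (simp add: am_zmul)
  then show ?thesis unfolding zmul_add by simp
qed

text \<open>The equations \<open>D = y^k a\<close> and \<open>y = a b\<close>, solved for
  \<open>a\<close> and \<open>b\<close>.\<close>

definition \<psi>o where "\<psi>o v = (if v = a then zmul (- int k) Y + X else - X + zmul (int k + 1) Y)"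

lemma psio_rel: "evalw \<psi>o (alt_word a b M) = evalw \<psi>o (alt_word b a M)"
proof -
  have ps: "\<psi>o a = - zmul (int k) Y + X" "\<psi>o b = - X + (zmul (int k) Y + Y)"
    using ab by (simp_all add: \<psi>o_def zmul_minus zmul_succ)
  have s: "zmul (int k) Y + Y = Y + zmul (int k) Y" using zmul_add[of 1 "int k" Y] zmul_succ[of "int k" Y] by (simp add: add.commute del: zmul_int)
  have 1: "\<psi>o a + \<psi>o b = Y" unfolding ps by (simp add: add.assoc)
  have 2: "\<psi>o b + \<psi>o a = - X + Y + X" unfolding ps s by (simp add: add.assoc)
  have M2: "zmul (int M) Y = zmul (int k) Y + (zmul (int k) Y + Y)"
  proof -
    have "int M = int k + (int k + 1)" using k by simp
    then show ?thesis by (simp only: zmul_add zmul_simps)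
  qed
  have "evalw \<psi>o (alt_word a b M) = nmul k Y + \<psi>o a" unfolding k alt_word_val 1 ..
  also have "\<dots> = X" unfolding ps by (simp add: zmul_int)
  also have "\<dots> = - X + (X + X)" by simp
  also have "\<dots> = - X + nmul k Y + X + \<psi>o b" unfolding X_X M2 ps by (simp add: add.assoc zmul_int)
  also have "\<dots> = evalw \<psi>o (alt_word b a M)" unfolding k alt_word_val 2 nmul_conj ..
  finally show ?thesis .
qed

lemma theta_odd: "\<exists>\<theta>. (\<forall>g\<in>AA. \<forall>h\<in>AA. \<theta> (g + h) = \<theta> g + \<theta> h) \<and> \<theta> (f a) = \<psi>o a \<and> \<theta> (f b) = \<psi>o b \<and> \<theta> y = Y \<and> \<theta> D = X"
proof -
  obtain \<theta> where \<theta>: "\<forall>g\<in>AA. \<forall>h\<in>AA. \<theta> (g + h) = \<theta> g + \<theta> h" "\<theta> (f a) = \<psi>o a" "\<theta> (f b) = \<psi>o b" "\<theta> y = \<psi>o a + \<psi>o b"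
    using hom[OF psio_rel] by blast
  have "\<psi>o a + \<psi>o b = Y" using ab by (simp add: \<psi>o_def zmul_minus zmul_succ add.assoc)
  then have y: "\<theta> y = Y" using \<theta> by simp
  have "\<theta> D = \<theta> (zmul (int k) y) + \<theta> (f a)" unfolding D_def using \<theta>(1) zmul_AA gens by blast
  also have "\<theta> (zmul (int k) y) = zmul (int k) Y" using zmul_hom[OF subAA _ gens(3), of \<theta> "int k"] \<theta>(1) y by simp
  finally have "\<theta> D = X" using \<theta>(2) by (simp add: \<psi>o_def zmul_minus)
  then show ?thesis using \<theta> y by blast
qed

lemma alternative_odd: "alternative AA"
proof -
  obtain \<theta> where \<theta>: "\<forall>g\<in>AA. \<forall>h\<in>AA. \<theta> (g + h) = \<theta> g + \<theta> h" "\<theta> y = Y" "\<theta> D = X" using theta_odd by blast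
  let ?z = "zmul (int M) y"
  let ?G = "\<lambda>i :: bool. if i then gspan {D} else gspan {y}"
  have zm: "\<theta> (zmul n g) = zmul n (\<theta> g)" if "g \<in> AA" for n g
    using zmul_hom[OF subAA _ that, of \<theta> n] \<theta>(1) by blast
  have z2: "?z = zmul 2 D" using D_D zmul_add[of 1 1 D] by simp
  have "amalgam ?G UNIV (gspan {?z})"
  proof (rule amalgam_from_data[OF O.amalgam_data_axioms, where \<theta> = \<theta> and A = AA])
    show "subgrp (?G i)" for i by (simp add: subgrp_gspan)
    have "?z \<in> gspan {D}" unfolding z2 gspan_singleton by blast
    moreover have "?z \<in> gspan {y}" unfolding gspan_singleton by blast
    ultimately show "gspan {?z} \<subseteq> ?G i" for i
      using gspan_least[OF subgrp_gspan, of "{?z}" "{D}"] gspan_least[OF subgrp_gspan, of "{?z}" "{y}"] by (cases i) auto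
    show "?G i \<subseteq> AA" for i using gspan_AA D_AA gens by simp
    show "\<theta> (g + h) = \<theta> g + \<theta> h" if "g \<in> AA" "h \<in> AA" for g h using \<theta>(1) that by blast
    show "\<exists>h\<in>UNIV - range (eo i). \<theta> g = O.am i h" if g: "g \<in> ?G i - gspan {?z}" for i g
    proof (cases i)
      case True
      then obtain n where n: "g = zmul n D" using g unfolding gspan_singleton[of D] by auto
      have "n \<notin> range (eo True)"
      proof
        assume "n \<in> range (eo True)"
        then obtain j where "n = j * 2" by auto
        then have "g = zmul j ?z" using n z2 by (simp add: zmul_mult)
        then show False using g unfolding gspan_singleton[of ?z] by blast
      qed
      moreover have "\<theta> g = O.am True n" using n zm[OF D_AA] \<theta>(3) by (simp add: am_zmul)
      ultimately show ?thesis using True by (intro bexI[of _ n]) simp_all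
    next
      case False
      then obtain n where n: "g = zmul n y" using g unfolding gspan_singleton[of y] by auto
      have "n \<notin> range (eo False)"
      proof
        assume "n \<in> range (eo False)"
        then obtain j where "n = int M * j" by (auto simp del: mult_cancel_left)
        then have "n = j * int M" by simp
        then have "g = zmul j ?z" using n by (simp add: zmul_mult)
        then show False using g unfolding gspan_singleton[of ?z] by blast
      qed
      moreover have "\<theta> g = O.am False n" using n zm[OF gens(3)] \<theta>(2) by (simp add: am_zmul)
      ultimately show ?thesis using False by (intro bexI[of _ n]) simp_all
    qed
    show "\<exists>i\<in>UNIV. \<exists>j\<in>UNIV. \<theta> c = O.am i (eo i j)" if c: "c \<in> gspan {?z}" for c
    proof -
      obtain j where "c = zmul j ?z" using c unfolding gspan_singleton[of ?z] by blast
      then have "c = zmul (j * int M) y" by (simp only: zmul_mult)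
      then have "\<theta> c = O.am False (eo False j)" using zm[OF gens(3)] \<theta>(2) by (simp add: am_zmul mult.commute)
      then show ?thesis by blast
    qed
  qed (auto simp: subgrp_gspan)
  then show ?thesis
  proof (rule alternative_from_amalgam)
    show "?z = zmul (int M) y" "int M \<noteq> 0" using k by simp_all
    show "comm g h" if "g \<in> ?G i" "h \<in> ?G i" for i g h
      using that gspan_comm[of "{D}" g h] gspan_comm[of "{y}" g h] by (cases i) auto
    have sub: "?G i \<subseteq> gspan (\<Union>i. ?G i)" for i
      by (rule subset_trans[OF UN_upper gspan_superset]) simp
    have s: "gspan {D} \<subseteq> gspan (\<Union>i. ?G i)" "gspan {y} \<subseteq> gspan (\<Union>i. ?G i)"
      using sub[of True] sub[of False] by simp_all
    have D: "D \<in> gspan (\<Union>i. ?G i)" by (rule subsetD[OF s(1) gspan_base]) simp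
    have y: "y \<in> gspan (\<Union>i. ?G i)" by (rule subsetD[OF s(2) gspan_base]) simp
    have "f a = - zmul (int k) y + D" by (simp add: D_def)
    then have "f a \<in> gspan (\<Union>i. ?G i)"
      using subgrp_add[OF subgrp_gspan subgrp_minus[OF subgrp_gspan zmul_in[OF subgrp_gspan y, of "int k"]] D] by simp
    then show "AA \<subseteq> gspan (\<Union>i. ?G i)" by (rule AA_gen[OF y _ subgrp_gspan])
  qed
qed

text \<open>In the model, inverse powers of \<open>a\<close> followed by powers of \<open>b\<close>
  multiply out to an alternating product with syllables \<open>- X\<close> and multiples
  \<open>k\<close> or \<open>k + 1\<close> of \<open>Y\<close>. None of these is in the edge group,
  because 1 is odd and \<open>0 < k < k + 1 < M\<close>.\<close>

lemma leaf_odd: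
  assumes "nmul n (f b) = nmul n (f a)" shows "n = 0"
proof (rule ccontr)
  assume n: "n \<noteq> 0"
  obtain \<theta> where \<theta>: "\<forall>g\<in>AA. \<forall>h\<in>AA. \<theta> (g + h) = \<theta> g + \<theta> h" "\<theta> (f a) = \<psi>o a" "\<theta> (f b) = \<psi>o b" using theta_odd by blast
  have zm: "\<theta> (zmul (int n) g) = zmul (int n) (\<theta> g)" if "g \<in> AA" for g
    using zmul_hom[OF subAA _ that, of \<theta> "int n"] \<theta>(1) by blast
  have e: "nmul n (\<psi>o b) = nmul n (\<psi>o a)" using zm[OF gens(1)] zm[OF gens(2)] \<theta> assms by (simp add: zmul_int)
  \<comment> \<open>The inverse of \<open>a\<close> is \<open>- X\<close> followed by the multiple
    \<open>k\<close> of \<open>Y\<close>, and \<open>b\<close> is the same with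
    \<open>k + 1\<close>.\<close>
  let ?js = "replicate n (int k) @ replicate n (int k + 1)"
  let ?ws = "\<lambda>js. concat (map (\<lambda>j. [(True, -1), (False, j)]) js)"
  have adj: "distinct_adj (map fst (?ws js))" for js :: "int list"
  proof (induction js)
    case (Cons j js)
    then show ?case by (cases js) auto
  qed simp
  have val: "sum_list (map (\<lambda>(i, g). O.am i g) (?ws js)) = sum_list (map (\<lambda>j. - X + zmul j Y) js)" for js
    by (induction js) (simp_all add: am_zmul zmul_minus add.assoc)
  have na: "- X + zmul (int k) Y = - \<psi>o a" by (simp add: \<psi>o_def zmul_minus minus_add del: zmul_int)
  have nb: "- X + zmul (int k + 1) Y = \<psi>o b" using ab by (simp add: \<psi>o_def)
  have "sum_list (map (\<lambda>j. - X + zmul j Y) ?js) = nmul n (- \<psi>o a) + nmul n (\<psi>o b)"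
    by (simp only: map_append sum_list_append map_replicate na nb nmul_def)
  also have "\<dots> = O.am True (eo True 0)" using e by (simp add: nmul_minus am_zmul)
  finally have "sum_list (map (\<lambda>(i, g). O.am i g) (?ws ?js)) = O.am True (eo True 0)" unfolding val .
  moreover have "sum_list (map (\<lambda>(i, g). O.am i g) (?ws ?js)) \<noteq> O.am True (eo True 0)"
  proof (rule O.am_alternating[OF _ adj])
    show "?ws ?js \<noteq> []" using n by simp
    have nd: "int k \<noteq> int M * c" "int k + 1 \<noteq> int M * c" for c
    proof -
      have "\<not> int M dvd int k" "\<not> int M dvd int k + 1" using k k_pos zdvd_imp_le[of "int M" "int k"] zdvd_imp_le[of "int M" "int k + 1"] by auto
      then show "int k \<noteq> int M * c" "int k + 1 \<noteq> int M * c" by (metis dvd_triv_left)+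
    qed
    have "-1 \<noteq> 2 * (c :: int)" for c by presburger
    then show "\<forall>(i, g)\<in>set (?ws ?js). i \<in> UNIV \<and> g \<in> UNIV - eo i ` UNIV" using nd by auto
  qed auto
  ultimately show False by blast
qed

end

section \<open>Even label\<close>

context
  fixes k :: nat
  assumes k: "M = 2 * k"
begin

lemma k_pos_even: "1 \<le> k" using ab(2) k by simp

text \<open>Again the alternating product of all \<open>M\<close> letters. For even \<open>M\<close>
  it commutes with \<open>a\<close>, so it spans an abelian factor together with
  \<open>a\<close>.\<close>

definition z :: 'g where "z = zmul (int k) y"

lemma z_AA: "z \<in> AA"
  unfolding z_def using zmul_AA gens by blast

lemma z_comm: "comm (f a) z"
proof -
  have "nmul k (f a + f b) = nmul k (f b + f a)"
    using rel alt_word_val(1)[of f a b k] alt_word_val(1)[of f b a k] k by simp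
  then show ?thesis using nmul_swap[of "f a" k "f b"] unfolding comm_def z_def y_def by (simp add: zmul_int)
qed

lemma gspan_az: "gspan {f a, z} = {zmul p (f a) + zmul q z | p q. True}"
proof
  have c: "zmul q z + zmul p (f a) = zmul p (f a) + zmul q z" for p q
    using comm_zmul[of z "zmul p (f a)" q] comm_zmul[of "f a" z p] z_comm comm_sym unfolding comm_def by metis
  show "gspan {f a, z} \<subseteq> {zmul p (f a) + zmul q z | p q. True}"
  proof (rule gspan_least)
    show "subgrp {zmul p (f a) + zmul q z | p q. True}"
    proof (rule subgrpI)
      show "0 \<in> {zmul p (f a) + zmul q z | p q. True}" by (intro CollectI exI[of _ 0]) simp
      fix g assume "g \<in> {zmul p (f a) + zmul q z | p q. True}"
      then obtain p q where g: "g = zmul p (f a) + zmul q z" by blast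
      have "- g = zmul (- p) (f a) + zmul (- q) z" unfolding g using c[of "- q" "- p"] by (simp add: minus_add zmul_minus)
      then show "- g \<in> {zmul p (f a) + zmul q z | p q. True}" by blast
      fix h assume "h \<in> {zmul p (f a) + zmul q z | p q. True}"
      then obtain p' q' where h: "h = zmul p' (f a) + zmul q' z" by blast
      have "g + h = zmul p (f a) + (zmul q z + zmul p' (f a)) + zmul q' z" unfolding g h by (simp add: add.assoc)
      also have "\<dots> = zmul (p + p') (f a) + zmul (q + q') z" unfolding c zmul_add by (simp add: add.assoc)
      finally show "g + h \<in> {zmul p (f a) + zmul q z | p q. True}" by blast
    qed
    have "f a = zmul 1 (f a) + zmul 0 z" "z = zmul 0 (f a) + zmul 1 z" by simp_all
    then show "{f a, z} \<subseteq> {zmul p (f a) + zmul q z | p q. True}" by blast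
  qed
  show "{zmul p (f a) + zmul q z | p q. True} \<subseteq> gspan {f a, z}"
  proof
    fix x assume "x \<in> {zmul p (f a) + zmul q z | p q. True}"
    then obtain p q where x: "x = zmul p (f a) + zmul q z" by blast
    have "f a \<in> gspan {f a, z}" "z \<in> gspan {f a, z}" by (rule gspan_base, simp)+
    then show "x \<in> gspan {f a, z}" unfolding x by (intro subgrp_add[OF subgrp_gspan] zmul_in[OF subgrp_gspan])
  qed
qed

text \<open>Both factors have to live in one type. In the factor \<open>True\<close> the pair
  \<open>(p, q)\<close> stands for \<open>a^p z^q\<close>; in the factor \<open>False\<close> the
  pair \<open>(p, 0)\<close> stands for \<open>y^p\<close>, and \<open>z\<close> is
  \<open>(k, 0)\<close>.\<close>

abbreviation ee :: "bool \<Rightarrow> int \<Rightarrow> int \<times> int" where "ee i c \<equiv> (if i then (0, c) else (int k * c, 0))"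
abbreviation GE :: "bool \<Rightarrow> (int \<times> int) set" where "GE i \<equiv> (if i then UNIV else UNIV \<times> {0})"

interpretation O: amalgam_data GE UNIV "UNIV :: int set" ee
  by unfold_locales (use k_pos_even in \<open>auto simp: subgrp_def distrib_left inj_on_def zero_prod_def\<close>)

definition XE where "XE = O.am True (1, 0)"
definition YE where "YE = O.am False (1, 0)"
definition ZE where "ZE = O.am True (0, 1)"

lemma am_True: "O.am True (p, q) = zmul p XE + zmul q ZE"
proof -
  have s: "subgrp (UNIV :: (int \<times> int) set)" by (simp add: subgrp_def)
  have h: "O.am True (zmul n g) = zmul n (O.am True g)" for n g by (rule zmul_hom[OF s]) (use O.am_add in auto)
  have "O.am True (p, q) = O.am True (zmul p (1, 0) + zmul q (0, 1))" by (simp add: zmul_prod)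
  also have "\<dots> = O.am True (zmul p (1, 0)) + O.am True (zmul q (0, 1))" by (rule O.am_add) auto
  finally show ?thesis by (simp add: h XE_def ZE_def)
qed

lemma am_False: "O.am False (p, 0) = zmul p YE"
proof -
  have s: "subgrp (UNIV \<times> {0} :: (int \<times> int) set)" by (auto simp: subgrp_def zero_prod_def)
  have "O.am False (zmul p (1, 0)) = zmul p (O.am False (1, 0))" by (rule zmul_hom[OF s]) (use O.am_add in auto)
  then show ?thesis by (simp add: YE_def zmul_prod)
qed

lemma Z_Y: "ZE = zmul (int k) YE"
proof -
  have "O.am True (ee True 1) = O.am False (ee False 1)" by (rule O.am_agree) auto
  then show ?thesis by (simp add: am_False ZE_def)
qed

lemma X_Z: "XE + ZE = ZE + XE"
proof -
  have "O.am True ((1, 0) + (0, 1)) = O.am True ((0, 1) + (1, 0))" by simp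
  moreover have "O.am True ((1, 0) + (0, 1)) = XE + ZE" "O.am True ((0, 1) + (1, 0)) = ZE + XE"
    unfolding XE_def ZE_def by (rule O.am_add; simp)+
  ultimately show ?thesis by simp
qed

text \<open>Here \<open>b\<close> is recovered from \<open>y = a b\<close>.\<close>

definition \<psi>e where "\<psi>e v = (if v = a then XE else - XE + YE)"

lemma psie_rel: "evalw \<psi>e (alt_word a b M) = evalw \<psi>e (alt_word b a M)"
proof -
  have 1: "\<psi>e a + \<psi>e b = YE" using ab by (simp add: \<psi>e_def)
  have 2: "\<psi>e b + \<psi>e a = - XE + YE + XE" using ab by (simp add: \<psi>e_def)
  have "evalw \<psi>e (alt_word a b M) = ZE" unfolding k alt_word_val 1 using Z_Y by (simp add: zmul_int)
  moreover have "evalw \<psi>e (alt_word b a M) = - XE + ZE + XE" unfolding k alt_word_val 2 nmul_conj using Z_Y by (simp add: zmul_int)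
  moreover have "- XE + ZE + XE = ZE" using X_Z by (simp add: add.assoc flip: X_Z)
  ultimately show ?thesis by simp
qed

lemma alternative_even: "alternative AA"
proof -
  obtain \<theta> where \<theta>: "\<forall>g\<in>AA. \<forall>h\<in>AA. \<theta> (g + h) = \<theta> g + \<theta> h" "\<theta> (f a) = \<psi>e a" "\<theta> y = \<psi>e a + \<psi>e b"
    using hom[OF psie_rel] by blast
  have ty: "\<theta> y = YE" and ta: "\<theta> (f a) = XE" using \<theta> ab by (simp_all add: \<psi>e_def)
  let ?G = "\<lambda>i :: bool. if i then gspan {f a, z} else gspan {y}"
  have zm: "\<theta> (zmul n g) = zmul n (\<theta> g)" if "g \<in> AA" for n g
    using zmul_hom[OF subAA _ that, of \<theta> n] \<theta>(1) by blast
  have tz: "\<theta> z = ZE" unfolding z_def Z_Y using zm[OF gens(3)] ty by simp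
  have "amalgam ?G UNIV (gspan {z})"
  proof (rule amalgam_from_data[OF O.amalgam_data_axioms, where \<theta> = \<theta> and A = AA])
    show "subgrp (?G i)" for i by (simp add: subgrp_gspan)
    have "z \<in> gspan {y}" unfolding z_def gspan_singleton by blast
    then show "gspan {z} \<subseteq> ?G i" for i
      using gspan_least[OF subgrp_gspan, of "{z}" "{y}"] gspan_mono[of "{z}" "{f a, z}"] by (cases i) auto
    show "?G i \<subseteq> AA" for i using gspan_AA z_AA gens by simp
    show "\<theta> (g + h) = \<theta> g + \<theta> h" if "g \<in> AA" "h \<in> AA" for g h using \<theta>(1) that by blast
    show "\<exists>h\<in>GE i - range (ee i). \<theta> g = O.am i h" if g: "g \<in> ?G i - gspan {z}" for i g
    proof (cases i)
      case True
      then obtain p q where n: "g = zmul p (f a) + zmul q z" using g unfolding gspan_az by auto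
      have "p \<noteq> 0" using g n unfolding gspan_singleton[of z] by auto
      then have "(p, q) \<notin> range (ee True)" by auto
      moreover have "\<theta> g = O.am True (p, q)"
        using n \<theta>(1) zmul_AA[OF gens(1)] zmul_AA[OF z_AA] zm[OF gens(1)] zm[OF z_AA] ta tz by (simp add: am_True)
      ultimately show ?thesis using True by (intro bexI[of _ "(p, q)"]) simp_all
    next
      case False
      then obtain n where n: "g = zmul n y" using g unfolding gspan_singleton[of y] by auto
      have "(n, 0) \<notin> range (ee False)"
      proof
        assume "(n, 0) \<in> range (ee False)"
        then obtain j where "n = int k * j" by (auto simp del: mult_cancel_left)
        then have "n = j * int k" by simp
        then have "g = zmul j z" using n by (simp add: zmul_mult z_def del: zmul_int)
        then show False using g unfolding gspan_singleton[of z] by blast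
      qed
      moreover have "\<theta> g = O.am False (n, 0)" using n zm[OF gens(3)] ty by (simp add: am_False)
      ultimately show ?thesis using False by (intro bexI[of _ "(n, 0)"]) simp_all
    qed
    show "\<exists>i\<in>UNIV. \<exists>j\<in>UNIV. \<theta> c = O.am i (ee i j)" if c: "c \<in> gspan {z}" for c
    proof -
      obtain j where "c = zmul j z" using c unfolding gspan_singleton[of z] by blast
      then have "\<theta> c = O.am True (ee True j)" using zm[OF z_AA] tz by (simp add: am_True)
      then show ?thesis by blast
    qed
  qed (auto simp: subgrp_gspan)
  then show ?thesis
  proof (rule alternative_from_amalgam)
    show "z = zmul (int k) y" "int k \<noteq> 0" using k_pos_even by (simp_all add: z_def)
    have "comm s t" if "s \<in> {f a, z}" "t \<in> {f a, z}" for s t using that z_comm comm_sym[of "f a" z] by auto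
    then show "comm g h" if "g \<in> ?G i" "h \<in> ?G i" for i g h
      using that gspan_comm[of "{f a, z}" g h] gspan_comm[of "{y}" g h] by (cases i) auto
    have sub: "?G i \<subseteq> gspan (\<Union>i. ?G i)" for i
      by (rule subset_trans[OF UN_upper gspan_superset]) simp
    have s: "gspan {f a, z} \<subseteq> gspan (\<Union>i. ?G i)" "gspan {y} \<subseteq> gspan (\<Union>i. ?G i)"
      using sub[of True] sub[of False] by simp_all
    have "f a \<in> gspan (\<Union>i. ?G i)" by (rule subsetD[OF s(1) gspan_base]) simp
    moreover have y: "y \<in> gspan (\<Union>i. ?G i)" by (rule subsetD[OF s(2) gspan_base]) simp
    ultimately show "AA \<subseteq> gspan (\<Union>i. ?G i)" by (intro AA_gen[OF y _ subgrp_gspan])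
  qed
qed

text \<open>For an even label both sides of the relation contain \<open>b\<close> equally often, so
  counting \<open>b\<close> alone is a homomorphism.\<close>

lemma leaf_even:
  assumes "zmul n (f b) = zmul j (f a)" shows "n = 0"
proof -
  have "evalw (\<lambda>v. if v = a then 0 else 1 :: int) (alt_word a b M) = evalw (\<lambda>v. if v = a then 0 else 1) (alt_word b a M)"
    unfolding k alt_word_val using ab by simp
  from hom[OF this] obtain \<theta> :: "'g \<Rightarrow> int" where \<theta>: "\<forall>g\<in>AA. \<forall>h\<in>AA. \<theta> (g + h) = \<theta> g + \<theta> h" "\<theta> (f a) = 0" "\<theta> (f b) = 1"
    using ab by auto
  have "\<theta> (zmul n g) = zmul n (\<theta> g)" if "g \<in> AA" for n g
    using zmul_hom[OF subAA _ that, of \<theta> n] \<theta>(1) by blast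
  then have "\<theta> (zmul n (f b)) = n" "\<theta> (zmul j (f a)) = 0" using gens \<theta> by simp_all
  then show ?thesis using assms by simp
qed

end

lemma dihedral_alternative: "alternative AA"
  using alternative_odd alternative_even by (metis evenE oddE)

text \<open>Needed for stars: it places nonzero powers of a leaf outside the cyclic group of the
  center. For odd labels the exponent sum first forces the two exponents to agree.\<close>

lemma leaf: "zmul n (f b) \<in> gspan {f a} \<Longrightarrow> n = 0"
proof -
  assume "zmul n (f b) \<in> gspan {f a}"
  then obtain j where j: "zmul n (f b) = zmul j (f a)" unfolding gspan_singleton by blast
  show ?thesis
  proof (cases "even M")
    case True
    then show ?thesis using leaf_even j by (metis evenE)
  next
    case False
    then obtain k where k: "M = 2 * k + 1" by (metis oddE)
    obtain \<theta> :: "'g \<Rightarrow> int" where \<theta>: "\<forall>g\<in>AA. \<forall>h\<in>AA. \<theta> (g + h) = \<theta> g + \<theta> h" "\<theta> (f a) = 1" "\<theta> (f b) = 1"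
      using exponent by blast
    have "\<theta> (zmul n g) = zmul n (\<theta> g)" if "g \<in> AA" for n g
      using zmul_hom[OF subAA _ that, of \<theta> n] \<theta>(1) by blast
    then have "\<theta> (zmul n (f b)) = n" "\<theta> (zmul j (f a)) = j" using gens \<theta> by simp_all
    then have "n = j" using j by simp
    then have "nmul (nat \<bar>n\<bar>) (f b) = nmul (nat \<bar>n\<bar>) (f a)" using j by (auto simp: zmul_def abs_if split: if_splits)
    then show ?thesis using leaf_odd[OF k] by fastforce
  qed
qed

end

section \<open>Triangle-free Artin groups\<close>

text \<open>The sign of the leading exponent is carried along so that merging a further equal letter
  cannot make it vanish.\<close>

lemma reduced_syllables:
  fixes f :: "'v \<Rightarrow> 'g::group_add"
  assumes "reduced (l # r)" "l # r \<in> words_on W"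
  shows "\<exists>n ws. evalw f (l # r) = zmul n (f (fst l)) + sum_list (map snd ws) \<and> (if snd l then 0 < n else n < 0) \<and>
    distinct_adj (fst l # map fst ws) \<and> (\<forall>(w, g)\<in>set ws. w \<in> W \<and> (\<exists>k. k \<noteq> 0 \<and> g = zmul k (f w)))"
  using assms
proof (induction r arbitrary: l)
  case Nil
  show ?case
  proof (cases "snd l")
    case True
    then have "evalw f [l] = zmul 1 (f (fst l))" by (cases l) (simp add: evalw_def)
    then show ?thesis using True by (intro exI[of _ 1] exI[of _ "[]"]) simp
  next
    case False
    then have "evalw f [l] = zmul (- 1) (f (fst l))" by (cases l) (simp add: evalw_def zmul_minus)
    then show ?thesis using False by (intro exI[of _ "- 1"] exI[of _ "[]"]) simp
  qed
next
  case (Cons k r)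
  have "reduced (k # r)" "k # r \<in> words_on W" "k \<noteq> inv_letter l" "fst k \<in> W" using Cons.prems by auto
  then obtain n ws where IH: "evalw f (k # r) = zmul n (f (fst k)) + sum_list (map snd ws)" "if snd k then 0 < n else n < 0"
    "distinct_adj (fst k # map fst ws)" "\<forall>(w, g)\<in>set ws. w \<in> W \<and> (\<exists>k. k \<noteq> 0 \<and> g = zmul k (f w))"
    using Cons.IH[of k] by blast
  define e :: int where "e = (if snd l then 1 else - 1)"
  have l: "evalw f [l] = zmul e (f (fst l))" by (cases l) (simp add: evalw_def e_def zmul_minus)
  have ev: "evalw f (l # k # r) = zmul e (f (fst l)) + (zmul n (f (fst k)) + sum_list (map snd ws))"
    using l IH(1) by (simp add: evalw_Cons[of f l "k # r"])
  show ?case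
  proof (cases "fst k = fst l")
    case True
    then have s: "snd k = snd l" using \<open>k \<noteq> inv_letter l\<close> by (auto simp: inv_letter_def prod_eq_iff)
    show ?thesis
      by (rule exI[of _ "e + n"], rule exI[of _ ws]) (use ev IH True s in \<open>auto simp: zmul_add add.assoc e_def\<close>)
  next
    case False
    have "n \<noteq> 0" using IH(2) by (auto split: if_splits)
    then show ?thesis using ev IH False \<open>fst k \<in> W\<close>
      by (intro exI[of _ e] exI[of _ "(fst k, zmul n (f (fst k))) # ws"]) (auto simp: e_def)
  qed
qed

lemma evalw_single: "w \<in> words_on {v} \<Longrightarrow> evalw f w = zmul (evalw (\<lambda>_. 1 :: int) w) (f v)"
proof (induction w)
  case (Cons l w)
  have "evalw f [l] = zmul (evalw (\<lambda>_. 1 :: int) [l]) (f v)"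
    using Cons.prems by (cases l) (auto simp: evalw_def zmul_minus)
  then show ?case using Cons by (simp add: evalw_Cons[of _ l w] zmul_add)
qed simp

locale artin_graph =
  fixes V0 :: "'v set" and E m
  assumes graph: "defining_graph V0 E m"
begin

abbreviation "R \<equiv> artin_relations E m"

definition edgeless :: "'v set \<Rightarrow> bool" where
  "edgeless L \<longleftrightarrow> (\<forall>a\<in>L. \<forall>b\<in>L. {a, b} \<notin> E)"

lemma edgeless_free_like: "edgeless L \<Longrightarrow> realizes L R f \<Longrightarrow> free_like (gspan (f ` L))"
proof (rule free_presentation_free_like)
  assume L: "edgeless L"
  show False if "(u, v) \<in> R" "u \<in> words_on L" for u v
    by (rule edgeless_no_relation[OF graph _ that]) (use L in \<open>simp add: edgeless_def\<close>)
qed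

lemma no_loop: "{v, v} \<notin> E"
  using edge_distinct[OF graph] by blast

lemma edgeless_single: "edgeless {v}"
  using no_loop by (simp add: edgeless_def)

text \<open>The exponent sum respects every Artin relation, and it determines the value of a word in
  \<open>v\<close> alone.\<close>

lemma embeds_single: "embeds R {v} X"
  unfolding embeds_def
proof (intro ballI impI)
  fix u w assume u: "u \<in> words_on {v}" and w: "w \<in> words_on {v}" and uw: "(u, w) \<in> pres_cong X R"
  have "evalw (\<lambda>_. 1 :: int) u = evalw (\<lambda>_. 1) w"
  proof (rule evalw_pres_cong[OF _ uw])
    fix p q assume pq: "(p, q) \<in> R" "p \<in> words_on X"
    show "evalw (\<lambda>_. 1 :: int) p = evalw (\<lambda>_. 1) q"
      by (rule artin_relation_val[OF graph _ pq]) (simp add: evalw_one insert_commute)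
  qed
  then have "evalw (pres_gen {v} R) u = evalw (pres_gen {v} R) w" using evalw_single[OF u] evalw_single[OF w] by metis
  then show "(u, w) \<in> pres_cong {v} R" using realizesD[OF realizes_pres_gen u w] by blast
qed

lemma relation_letters: "{a, b} \<in> E \<Longrightarrow> {a, b} \<subseteq> U \<Longrightarrow> alt_word a b (m {a, b}) \<in> words_on U \<and> alt_word b a (m {a, b}) \<in> words_on U"
  using alt_word_letters edge_distinct[OF graph] by (metis insert_subset)

lemma rels_cover:
  assumes "\<And>a b. {a, b} \<in> E \<Longrightarrow> a \<in> \<Union>\<V> \<Longrightarrow> b \<in> \<Union>\<V> \<Longrightarrow> \<exists>U\<in>\<V>. {a, b} \<subseteq> U"
    and "(u, v) \<in> R" "u \<in> words_on (\<Union>\<V>)"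
  shows "\<exists>U\<in>\<V>. u \<in> words_on U \<and> v \<in> words_on U"
proof -
  obtain a b where ab: "{a, b} \<in> E" "a \<in> \<Union>\<V>" "b \<in> \<Union>\<V>" "u = alt_word a b (m {a, b})" "v = alt_word b a (m {a, b})"
    by (rule artin_relation_cases[OF graph assms(2,3)])
  then obtain U where "U \<in> \<V>" "{a, b} \<subseteq> U" using assms(1) by blast
  then show ?thesis using relation_letters ab by blast
qed

section \<open>The group of a star\<close>

context
  fixes v W
  assumes star: "\<And>w. w \<in> W \<Longrightarrow> {v, w} \<in> E" and W: "edgeless W"
begin

text \<open>The member \<open>{v}\<close> keeps the family nonempty, with the right union, when
  \<open>v\<close> has no neighbours.\<close>

abbreviation "spokes \<equiv> insert {v} ((\<lambda>w. {v, w}) ` W)"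

lemma spokes_Union: "\<Union>spokes = insert v W"
  by auto

lemma v_W: "v \<notin> W"
  using star no_loop by blast

lemma spokes_amalgam: "realizes (insert v W) R f \<Longrightarrow> amalgam_presentation spokes {v} R f"
proof
  assume f: "realizes (insert v W) R f"
  show "realizes (\<Union>spokes) R f" using f spokes_Union by simp
  fix u w assume uw: "(u, w) \<in> R" "u \<in> words_on (\<Union>spokes)"
  show "\<exists>U\<in>spokes. u \<in> words_on U \<and> w \<in> words_on U"
  proof (rule rels_cover[OF _ uw])
    fix a b assume ab: "{a, b} \<in> E" "a \<in> \<Union>spokes" "b \<in> \<Union>spokes"
    then have "\<not> (a \<in> W \<and> b \<in> W)" "a \<noteq> b" using W no_loop by (auto simp: edgeless_def)
    moreover have "a \<in> insert v W" "b \<in> insert v W" using ab(2,3) unfolding spokes_Union .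
    ultimately have "(a = v \<and> b \<in> W) \<or> (b = v \<and> a \<in> W)" by blast
    then show "\<exists>U\<in>spokes. {a, b} \<subseteq> U" by auto
  qed
qed (use embeds_single in auto)

lemma spoke_dihedral: "w \<in> W \<Longrightarrow> realizes (insert v W) R f \<Longrightarrow> dihedral V0 E m v w f"
  using amalgam_presentation.realizes_part[OF spokes_amalgam, of f "{v, w}"] graph star by (simp add: dihedral_def)

lemma star_alternative:
  assumes rf: "realizes (insert v W) R f"
  shows "alternative (gspan (f ` insert v W))"
proof -
  interpret amalgam_presentation spokes "{v}" R f by (rule spokes_amalgam[OF rf])
  have "alternative (gspan (f ` \<Union>spokes))"
  proof (rule alternative_Union)
    show "free_like (gspan (f ` {v}))" by (rule edgeless_free_like[OF edgeless_single realizes_edge])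
    fix U assume "U \<in> spokes"
    then consider "U = {v}" | w where "w \<in> W" "U = {v, w}" by blast
    then show "alternative (gspan (f ` U))"
    proof cases
      case 1
      show ?thesis unfolding 1 by (rule alternative_abelian[OF subgrp_gspan], rule gspan_comm) auto
    next
      case 2
      show ?thesis using dihedral.dihedral_alternative[OF spoke_dihedral[OF 2(1) rf]] 2(2) by simp
    qed
  qed
  then show ?thesis unfolding spokes_Union .
qed

text \<open>The leaves generate a free group: a nonempty reduced word in them is an alternating
  product of nonzero powers of leaves, each outside the group of the center by \<open>leaf\<close>.
  So it is nontrivial in the amalgam of the spokes.\<close>

lemma embeds_star: "embeds R W (insert v W)"
  unfolding embeds_def
proof (intro ballI impI)
  fix u u' assume u: "u \<in> words_on W" "u' \<in> words_on W" "(u, u') \<in> pres_cong (insert v W) R"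
  let ?f = "pres_gen (insert v W) R"
  have rf: "realizes (insert v W) R ?f" by (rule realizes_pres_gen)
  interpret amalgam_presentation spokes "{v}" R ?f by (rule spokes_amalgam[OF rf])
  let ?w = "u @ map inv_letter (rev u')"
  have w: "?w \<in> words_on W" using u words_on_inverse by simp
  have up: "u \<in> words_on (insert v W)" "u' \<in> words_on (insert v W)" using u words_on_mono by blast+
  have w0: "evalw ?f ?w = 0" using realizesD[OF rf up] u(3) by (simp add: evalw_inv_word)
  obtain r where r: "r \<in> words_on W" "reduced r" "\<And>g :: 'v \<Rightarrow> 'v word set bijection. evalw g r = evalw g ?w"
    using reduced_exists[OF w] by blast
  have "r = []"
  proof (rule ccontr)
    assume "r \<noteq> []"
    then obtain l s where ls: "r = l # s" by (cases r) auto
    have lW: "fst l \<in> W" using r(1) ls by simp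
    obtain n ws where nws: "evalw ?f r = zmul n (?f (fst l)) + sum_list (map snd ws)" "if snd l then 0 < n else n < 0"
      "distinct_adj (fst l # map fst ws)" "\<forall>(w, g)\<in>set ws. w \<in> W \<and> (\<exists>k. k \<noteq> 0 \<and> g = zmul k (?f w))"
      using reduced_syllables[of l s W ?f] r(1,2) ls by blast
    let ?ws = "(fst l, zmul n (?f (fst l))) # ws"
    have all: "\<forall>(w, g)\<in>set ?ws. w \<in> W \<and> (\<exists>k. k \<noteq> 0 \<and> g = zmul k (?f w))"
    proof -
      have "n \<noteq> 0" using nws(2) by (auto split: if_splits)
      then show ?thesis using nws(4) lW by auto
    qed
    have da: "distinct_adj (map fst ?ws)" using nws(3) by simp
    let ?us = "map (\<lambda>(w, g). ({v, w}, g)) ?ws"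
    have "map fst ?us = map (\<lambda>w. {v, w}) (map fst ?ws)" by (simp add: split_beta o_def)
    moreover have "inj_on (\<lambda>w. {v, w}) (set (map fst ?ws))"
      using all v_W by (intro inj_onI) (auto simp: doubleton_eq_iff)
    ultimately have d2: "distinct_adj (map fst ?us)" using distinct_adj_mapI[OF da] by metis
    have "\<forall>(U, g)\<in>set ?us. U \<in> spokes \<and> g \<in> gspan (?f ` U) - gspan (?f ` {v})"
    proof
      fix p assume "p \<in> set ?us"
      then obtain w g where p: "(w, g) \<in> set ?ws" "p = ({v, w}, g)" by auto
      then have wW: "w \<in> W" using all by blast
      obtain k where k: "k \<noteq> 0" "g = zmul k (?f w)" using all p(1) by blast
      have "g \<notin> gspan {?f v}" using dihedral.leaf[OF spoke_dihedral[OF wW rf]] k by blast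
      moreover have "g \<in> gspan (?f ` {v, w})" unfolding k(2) by (intro zmul_in[OF subgrp_gspan] gspan_base) simp
      ultimately show "case p of (U, g) \<Rightarrow> U \<in> spokes \<and> g \<in> gspan (?f ` U) - gspan (?f ` {v})"
        using p(2) wW by simp
    qed
    then have "sum_list (map snd ?us) \<notin> gspan (?f ` {v})"
      using amalgam.alternating[OF amalgam, of ?us] d2 by blast
    moreover have "sum_list (map snd ?us) = evalw ?f r" using nws(1) by (simp add: split_beta o_def)
    ultimately show False using r(3) w0 subgrp_zero[OF subgrp_gspan] by metis
  qed
  \<comment> \<open>The reduced form of \<open>?w\<close> is empty, so \<open>?w\<close> is trivial
    under every assignment, also the one for the presentation over \<open>W\<close>.\<close>
  then have "evalw (pres_gen W R) ?w = 0" using r(3)[of "pres_gen W R"] by simp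
  then have "evalw (pres_gen W R) u = evalw (pres_gen W R) u'" unfolding evalw_append evalw_inv_word
    by (simp add: eq_neg_iff_add_eq_0)
  then show "(u, u') \<in> pres_cong W R" using realizesD[OF realizes_pres_gen u(1,2)] by blast
qed

end

section \<open>Splitting a triangle-free graph at a vertex\<close>

context
  assumes tf: "triangle_free E"
begin

lemma link_edgeless: "edgeless {w\<in>X. {v, w} \<in> E}"
proof -
  have False if "{v, a} \<in> E" "{v, b} \<in> E" "{a, b} \<in> E" for a b
  proof -
    have "v \<noteq> a" "v \<noteq> b" "a \<noteq> b" using that edge_distinct[OF graph] by auto
    then show False using tf that unfolding triangle_free_def by blast
  qed
  then show ?thesis by (auto simp: edgeless_def)
qed

lemma vertex_amalgam:
  assumes v: "v \<in> X" and W: "W = {w\<in>X. {v, w} \<in> E}" and emb: "embeds R W (X - {v})" and f: "realizes X R f"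
  shows "amalgam_presentation {X - {v}, insert v W} W R f"
proof
  have vW: "v \<notin> W" using W no_loop by blast
  have U: "\<Union>{X - {v}, insert v W} = X" using v W by auto
  show "realizes (\<Union>{X - {v}, insert v W}) R f" using f U by simp
  show "W \<subseteq> U" if "U \<in> {X - {v}, insert v W}" for U using that vW W by auto
  show "embeds R W U" if "U \<in> {X - {v}, insert v W}" for U
    using that emb embeds_star[of W v] link_edgeless[of X v] W by auto
  fix u w assume uw: "(u, w) \<in> R" "u \<in> words_on (\<Union>{X - {v}, insert v W})"
  show "\<exists>U\<in>{X - {v}, insert v W}. u \<in> words_on U \<and> w \<in> words_on U"
  proof (rule rels_cover[OF _ uw])
    fix a b assume ab: "{a, b} \<in> E" "a \<in> \<Union>{X - {v}, insert v W}" "b \<in> \<Union>{X - {v}, insert v W}"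
    have "{b, a} \<in> E" using ab(1) by (simp add: insert_commute)
    then have "{a, b} \<subseteq> X - {v} \<or> {a, b} \<subseteq> insert v W" using ab(1,2,3) W unfolding U by auto
    then show "\<exists>U\<in>{X - {v}, insert v W}. {a, b} \<subseteq> U" by blast
  qed
qed auto

text \<open>Remove a vertex \<open>v\<close> outside \<open>L\<close>. The induction hypothesis for
  \<open>X - {v}\<close> is used twice: for the link of \<open>v\<close>, which makes the splitting
  at \<open>v\<close> available, and for \<open>L\<close> itself.\<close>

lemma embeds_edgeless: "finite X \<Longrightarrow> L \<subseteq> X \<Longrightarrow> edgeless L \<Longrightarrow> embeds R L X"
proof (induction X arbitrary: L rule: finite_psubset_induct)
  case (psubset X)
  show ?case
  proof (cases "L = X")
    case True
    then show ?thesis using embeds_refl by simp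
  next
    case False
    then obtain v where v: "v \<in> X" "v \<notin> L" using psubset.prems by blast
    define W where "W = {w\<in>X. {v, w} \<in> E}"
    have ss: "X - {v} \<subset> X" using v by blast
    have "v \<notin> W" using no_loop by (simp add: W_def)
    then have "embeds R W (X - {v})" using link_edgeless[of X v] by (intro psubset.IH[OF ss]) (auto simp: W_def)
    then interpret amalgam_presentation "{X - {v}, insert v W}" W R "pres_gen X R"
      by (rule vertex_amalgam[OF v(1) W_def _ realizes_pres_gen])
    have "\<Union>{X - {v}, insert v W} = X" using v by (auto simp: W_def)
    then have "embeds R (X - {v}) X" using embeds_part[of "X - {v}"] by simp
    moreover have "L \<subseteq> X - {v}" using v psubset.prems by blast
    moreover from this have "embeds R L (X - {v})" using psubset.IH[OF ss] psubset.prems by blast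
    ultimately show ?thesis using embeds_trans by blast
  qed
qed

theorem artin_alternative: "finite X \<Longrightarrow> realizes X R f \<Longrightarrow> alternative (gspan (f ` X))"
proof (induction X rule: finite_psubset_induct)
  case (psubset X)
  show ?case
  proof (cases "X = {}")
    case True
    show ?thesis unfolding True by (rule alternative_abelian[OF subgrp_gspan], rule gspan_comm) auto
  next
    case False
    then obtain v where v: "v \<in> X" by blast
    define W where "W = {w\<in>X. {v, w} \<in> E}"
    have ss: "X - {v} \<subset> X" using v by blast
    have "v \<notin> W" using no_loop by (simp add: W_def)
    have eW: "edgeless W" unfolding W_def by (rule link_edgeless)
    have "embeds R W (X - {v})" using eW psubset.hyps \<open>v \<notin> W\<close> by (intro embeds_edgeless) (auto simp: W_def)
    then interpret amalgam_presentation "{X - {v}, insert v W}" W R f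
      by (rule vertex_amalgam[OF v(1) W_def _ psubset.prems])
    have "alternative (gspan (f ` \<Union>{X - {v}, insert v W}))"
    proof (rule alternative_Union)
      show "free_like (gspan (f ` W))" using edgeless_free_like[OF eW realizes_edge] .
      fix U assume "U \<in> {X - {v}, insert v W}"
      then consider "U = X - {v}" | "U = insert v W" by blast
      then show "alternative (gspan (f ` U))"
      proof cases
        case 1
        then show ?thesis using psubset.IH[OF ss] realizes_part[of "X - {v}"] by simp
      next
        case 2
        show ?thesis unfolding 2
        proof (rule star_alternative)
          show "{v, w} \<in> E" if "w \<in> W" for w using that by (simp add: W_def)
          show "edgeless W" by (rule eW)
          show "realizes (insert v W) R f" by (rule realizes_part) simp
        qed
      qed
    qed
    moreover have "\<Union>{X - {v}, insert v W} = X" using v by (auto simp: W_def)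
    ultimately show ?thesis by (simp only:)
  qed
qed

end

end

section \<open>Growth\<close>

text \<open>The limit is the infimum of the quotients. For a nearly optimal \<open>m\<close>,
  division of \<open>n\<close> by \<open>m\<close> leaves a remainder whose cost is bounded
  independently of \<open>n\<close>.\<close>

lemma fekete:
  fixes x :: "nat \<Rightarrow> real"
  assumes pos: "\<And>n. 0 \<le> x n" and zero: "x 0 = 0" and sub: "\<And>m n. x (m + n) \<le> x m + x n"
  shows "convergent (\<lambda>n. x n / real n)"
proof -
  let ?A = "(\<lambda>n. x n / real n) ` {1..}"
  define L where "L = Inf ?A"
  have bdd: "bdd_below ?A" using pos by (intro bdd_belowI[of _ 0]) auto
  have low: "L \<le> x n / real n" if "1 \<le> n" for n
    unfolding L_def using bdd that by (intro cInf_lower) auto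
  have mult: "x (q * m + r) \<le> real q * x m + x r" for q m r
  proof (induction q)
    case (Suc q)
    have "x (Suc q * m + r) = x (m + (q * m + r))" by (simp add: add.assoc)
    also have "\<dots> \<le> x m + x (q * m + r)" by (rule sub)
    finally show ?case using Suc by (simp add: algebra_simps)
  qed simp
  have "(\<lambda>n. x n / real n) \<longlonglongrightarrow> L"
  proof (rule LIMSEQ_I)
    fix e :: real assume e: "0 < e"
    have "\<exists>y\<in>?A. y < L + e / 2"
      unfolding L_def using e by (intro cInf_lessD) auto
    then obtain m where m: "1 \<le> m" "x m / real m < L + e / 2" by auto
    obtain N where N: "real m * x 1 / (e / 2) < real N" using reals_Archimedean2 by blast
    show "\<exists>no. \<forall>n\<ge>no. norm (x n / real n - L) < e"
    proof (intro exI[of _ "max N 1"] allI impI)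
      fix n assume n: "max N 1 \<le> n"
      then have n1: "1 \<le> n" and nN: "N \<le> n" by auto
      have "x n \<le> real (n div m) * x m + x (n mod m)" using mult[of "n div m" m "n mod m"] by simp
      moreover have "x (n mod m) \<le> real (n mod m) * x 1" using mult[of "n mod m" 1 0] zero by simp
      moreover have "real (n mod m) * x 1 \<le> real m * x 1" using m pos by (intro mult_right_mono) auto
      moreover have "real (n div m) * x m \<le> real n / real m * x m"
        using pos by (intro mult_right_mono of_nat_div_le_of_nat)
      ultimately have "x n \<le> real n / real m * x m + real m * x 1" by linarith
      then have "x n / real n \<le> (real n / real m * x m + real m * x 1) / real n" by (intro divide_right_mono) auto
      also have "\<dots> = x m / real m + real m * x 1 / real n" using n1 by (simp add: field_simps)
      finally have 1: "x n / real n \<le> x m / real m + real m * x 1 / real n" .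
      have "real m * x 1 / (e / 2) < real n" using N nN by linarith
      then have "real m * x 1 / real n < e / 2" using e n1 by (simp add: field_simps)
      then have "x n / real n < L + e" using 1 m(2) by linarith
      then show "norm (x n / real n - L) < e" using low[OF n1] by simp
    qed
  qed
  then show ?thesis by (rule convergentI)
qed

text \<open>\<open>growth_rate\<close> is defined through \<open>lim\<close>, which says nothing
  without convergence; so convergence is proved although only a lower bound is wanted. Taking
  logarithms turns submultiplicativity into subadditivity.\<close>

lemma root_convergent:
  fixes a :: "nat \<Rightarrow> nat"
  assumes pos: "\<And>n. 1 \<le> a n" and zero: "a 0 = 1" and sub: "\<And>m n. a (m + n) \<le> a m * a n"
  shows "convergent (\<lambda>n. root n (real (a n)))"
proof -
  define x where "x n = ln (real (a n))" for n
  have a1: "1 \<le> real (a n)" for n using pos[of n] by simp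
  have ap: "0 < real (a n)" for n using a1[of n] by linarith
  have "convergent (\<lambda>n. x n / real n)"
  proof (rule fekete)
    show "0 \<le> x n" for n using a1[of n] by (simp add: x_def)
    show "x 0 = 0" by (simp add: x_def zero)
    show "x (m + n) \<le> x m + x n" for m n
    proof -
      have "real (a (m + n)) \<le> real (a m) * real (a n)" using sub[of m n] by (metis of_nat_le_iff of_nat_mult)
      then have "ln (real (a (m + n))) \<le> ln (real (a m) * real (a n))" using ap[of "m + n"] by (intro ln_mono) auto
      then show ?thesis using ap[of m] ap[of n] by (simp add: x_def ln_mult)
    qed
  qed
  then obtain l where "(\<lambda>n. x n / real n) \<longlonglongrightarrow> l" unfolding convergent_def by blast
  then have "(\<lambda>n. exp (x n / real n)) \<longlonglongrightarrow> exp l" by (rule tendsto_exp)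
  moreover have "exp (x n / real n) = root n (real (a n))" if "1 \<le> n" for n
    using that ap[of n] by (simp add: x_def root_powr_inverse powr_def)
  then have "\<forall>\<^sub>F n in sequentially. exp (x n / real n) = root n (real (a n))"
    unfolding eventually_sequentially by blast
  ultimately have "(\<lambda>n. root n (real (a n))) \<longlonglongrightarrow> exp l" by (rule Lim_transform_eventually)
  then show ?thesis by (rule convergentI)
qed

lemma root_lim_ge:
  fixes a :: "nat \<Rightarrow> nat"
  assumes conv: "convergent (\<lambda>n. root n (real (a n)))" and N: "0 < N" and big: "\<And>j. 2 ^ j \<le> a (N * j)"
  shows "root N 2 \<le> lim (\<lambda>n. root n (real (a n)))"
proof -
  let ?r = "\<lambda>n. root n (real (a n))"
  have l: "?r \<longlonglongrightarrow> lim ?r" using conv by (simp add: convergent_LIMSEQ_iff)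
  \<comment> \<open>\<open>Suc j\<close> avoids the index 0, where \<open>root 0\<close> takes the
    value 0.\<close>
  have sm: "strict_mono (\<lambda>j. N * Suc j)" using N by (intro strict_monoI) simp
  have "(?r \<circ> (\<lambda>j. N * Suc j)) \<longlonglongrightarrow> lim ?r" by (rule LIMSEQ_subseq_LIMSEQ[OF l sm])
  moreover have "root N 2 \<le> (?r \<circ> (\<lambda>j. N * Suc j)) j" for j
  proof -
    have "root (Suc j) (2 ^ Suc j) = (2 :: real)" by (rule real_root_power_cancel) auto
    then have "root N 2 = root (N * Suc j) (2 ^ Suc j)" by (simp only: real_root_mult_exp)
    also have "\<dots> \<le> root (N * Suc j) (real (a (N * Suc j)))"
    proof -
      have "real (2 ^ Suc j) \<le> real (a (N * Suc j))" using big[of "Suc j"] by (simp only: of_nat_le_iff)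
      then show ?thesis using N by (intro real_root_le_mono) (auto simp del: power_Suc)
    qed
    finally show ?thesis by simp
  qed
  ultimately show ?thesis by (intro LIMSEQ_le_const) auto
qed

section \<open>Sizes of balls\<close>

lemma wball_card_zero: "card (wball S 0) = 1"
proof -
  have "wball S 0 = {0}" by (auto simp: wball_def)
  then show ?thesis by simp
qed

lemma wball_card_add:
  assumes "finite S" shows "card (wball S (m + n)) \<le> card (wball S m) * card (wball S n)"
proof -
  have "wball S (m + n) \<subseteq> (\<lambda>(a, b). a + b) ` (wball S m \<times> wball S n)"
  proof
    fix x assume "x \<in> wball S (m + n)"
    then obtain xs where xs: "x = sum_list xs" "set xs \<subseteq> S \<union> uminus ` S" "length xs \<le> m + n" by (auto simp: wball_def)
    have "sum_list (take m xs) \<in> wball S m"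
      unfolding wball_def using xs set_take_subset[of m xs] by (intro CollectI exI[of _ "take m xs"]) auto
    moreover have "sum_list (drop m xs) \<in> wball S n"
      unfolding wball_def using xs set_drop_subset[of m xs] by (intro CollectI exI[of _ "drop m xs"]) auto
    moreover have "x = sum_list (take m xs) + sum_list (drop m xs)"
      unfolding xs(1) sum_list_append[symmetric] by simp
    ultimately show "x \<in> (\<lambda>(a, b). a + b) ` (wball S m \<times> wball S n)" by (auto intro!: image_eqI)
  qed
  then have "card (wball S (m + n)) \<le> card ((\<lambda>(a, b). a + b) ` (wball S m \<times> wball S n))"
    using wball_finite[OF assms] by (intro card_mono) auto
  also have "\<dots> \<le> card (wball S m \<times> wball S n)" using wball_finite[OF assms] by (intro card_image_le) auto
  finally show ?thesis by (simp add: card_cartesian_product)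
qed

text \<open>The words of length \<open>j\<close> in a free pair have distinct values, all within
  radius \<open>N * j\<close>.\<close>

lemma wball_card_exp:
  assumes fin: "finite S" and "short_free S N" shows "2 ^ j \<le> card (wball S (N * j))"
proof -
  obtain u v where uv: "u \<in> wball S N" "v \<in> wball S N" "free_pair u v" using assms(2) unfolding short_free_def by blast
  let ?W = "{w :: bool list. set w \<subseteq> UNIV \<and> length w = j}"
  have "word_val u v w \<in> wball S (N * length w)" for w
  proof (induction w)
    case (Cons c w)
    have "(if c then u else v) \<in> wball S N" using uv by simp
    then show ?case using wball_add[OF _ Cons.IH, of "if c then u else v" N] by simp
  qed (simp add: wball_zero)
  then have "word_val u v ` ?W \<subseteq> wball S (N * j)" by auto
  then have "card (word_val u v ` ?W) \<le> card (wball S (N * j))" using wball_finite[OF fin] by (intro card_mono) auto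
  moreover have "card (word_val u v ` ?W) = card ?W"
    using uv(3) unfolding free_pair_def by (intro card_image) (auto intro: inj_on_subset)
  moreover have "card ?W = 2 ^ j" using card_lists_length_eq[of "UNIV :: bool set" j] by simp
  ultimately show ?thesis by simp
qed

section \<open>Transfer to groups with a carrier\<close>

locale additive_embedding = group Q for Q (structure) +
  fixes \<Phi> :: "'a \<Rightarrow> 'g::group_add"
  assumes \<Phi>_mult: "x \<in> carrier Q \<Longrightarrow> y \<in> carrier Q \<Longrightarrow> \<Phi> (x \<otimes> y) = \<Phi> x + \<Phi> y"
    and \<Phi>_inj: "inj_on \<Phi> (carrier Q)"
begin

lemma \<Phi>_one: "\<Phi> \<one> = 0"
  using \<Phi>_mult[of \<one> \<one>] by (metis add_0_right add_left_cancel one_closed r_one)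

lemma \<Phi>_inv: "x \<in> carrier Q \<Longrightarrow> \<Phi> (inv x) = - \<Phi> x"
  using \<Phi>_mult[of "inv x" x] \<Phi>_one by (simp add: eq_neg_iff_add_eq_0)

lemma \<Phi>_eq: "x \<in> carrier Q \<Longrightarrow> y \<in> carrier Q \<Longrightarrow> \<Phi> x = \<Phi> y \<longleftrightarrow> x = y"
  using \<Phi>_inj by (auto simp: inj_on_def)

lemma \<Phi>_generate: assumes S: "S \<subseteq> carrier Q" shows "\<Phi> ` generate Q S = gspan (\<Phi> ` S)"
proof (intro equalityI subsetI)
  fix y assume "y \<in> \<Phi> ` generate Q S"
  then obtain x where x: "x \<in> generate Q S" "y = \<Phi> x" by blast
  from x(1) have "x \<in> carrier Q \<and> \<Phi> x \<in> gspan (\<Phi> ` S)"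
  proof (induction rule: generate.induct)
    case one
    then show ?case using subgrp_zero[OF subgrp_gspan] \<Phi>_one by simp
  next
    case (incl h)
    then show ?case using S by (auto intro: gspan_base)
  next
    case (inv h)
    then have "h \<in> carrier Q" "\<Phi> h \<in> gspan (\<Phi> ` S)" using S by (auto intro: gspan_base)
    then show ?case using \<Phi>_inv subgrp_minus[OF subgrp_gspan] by simp
  next
    case (eng h1 h2)
    then show ?case using \<Phi>_mult subgrp_add[OF subgrp_gspan] by auto
  qed
  then show "y \<in> gspan (\<Phi> ` S)" using x by simp
next
  fix y assume "y \<in> gspan (\<Phi> ` S)"
  then show "y \<in> \<Phi> ` generate Q S"
  proof (induction rule: gspan_right_induct)
    case zero
    show ?case using generate.one \<Phi>_one by (metis image_eqI)
  next
    case (add x s)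
    then obtain g t where g: "g \<in> generate Q S" "x = \<Phi> g" "t \<in> S" "s = \<Phi> t" by blast
    then have "g \<in> carrier Q" "t \<in> carrier Q" using S generate_in_carrier by auto
    then have "x + s = \<Phi> (g \<otimes> t)" using \<Phi>_mult g by simp
    moreover have "g \<otimes> t \<in> generate Q S" by (rule generate.eng[OF g(1) generate.incl[OF g(3)]])
    ultimately show ?case by (rule image_eqI)
  next
    case (diff x s)
    then obtain g t where g: "g \<in> generate Q S" "x = \<Phi> g" "t \<in> S" "s = \<Phi> t" by blast
    then have "g \<in> carrier Q" "t \<in> carrier Q" using S generate_in_carrier by auto
    then have "x - s = \<Phi> (g \<otimes> inv t)" using \<Phi>_mult \<Phi>_inv g by simp
    moreover have "g \<otimes> inv t \<in> generate Q S" by (rule generate.eng[OF g(1) generate.inv[OF g(3)]])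
    ultimately show ?case by (rule image_eqI)
  qed
qed

lemma \<Phi>_ball: assumes S: "S \<subseteq> carrier Q" shows "\<Phi> ` cayley_ball Q S n = wball (\<Phi> ` S) n" "cayley_ball Q S n \<subseteq> carrier Q"
proof -
  let ?T = "\<Phi> ` S \<union> uminus ` \<Phi> ` S"
  have fwd: "g \<in> carrier Q \<and> (\<exists>xs. \<Phi> g = sum_list xs \<and> set xs \<subseteq> ?T \<and> length xs = k)"
    if "(\<one>, g) \<in> cayley_edges Q S ^^ k" for k g
    using that
  proof (induction k arbitrary: g)
    case 0
    then have "g = \<one>" by simp
    then show ?case using \<Phi>_one by simp
  next
    case (Suc k)
    then obtain h where h: "(\<one>, h) \<in> cayley_edges Q S ^^ k" "(h, g) \<in> cayley_edges Q S" by auto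
    obtain xs where xs: "h \<in> carrier Q" "\<Phi> h = sum_list xs" "set xs \<subseteq> ?T" "length xs = k" using Suc.IH[OF h(1)] by blast
    obtain s where s: "s \<in> S" "g \<in> carrier Q" "g = h \<otimes> s \<or> h = g \<otimes> s" using h(2) unfolding cayley_edges_def by blast
    then have sQ: "s \<in> carrier Q" using S by blast
    from s(3) have "\<Phi> g = \<Phi> h + \<Phi> s \<or> \<Phi> g = \<Phi> h + - \<Phi> s"
      using \<Phi>_mult[OF xs(1) sQ] \<Phi>_mult[OF s(2) sQ] by auto
    then obtain t where "t \<in> ?T" "\<Phi> g = \<Phi> h + t" using s(1) by blast
    then show ?case using xs s(2) by (intro conjI exI[of _ "xs @ [t]"]) auto
  qed
  have bwd: "\<exists>g. (\<one>, g) \<in> cayley_edges Q S ^^ length xs \<and> g \<in> carrier Q \<and> \<Phi> g = sum_list xs" if "set xs \<subseteq> ?T" for xs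
    using that
  proof (induction xs rule: rev_induct)
    case Nil
    show ?case using \<Phi>_one by (intro exI[of _ \<one>]) simp
  next
    case (snoc t xs)
    then obtain h where h: "(\<one>, h) \<in> cayley_edges Q S ^^ length xs" "h \<in> carrier Q" "\<Phi> h = sum_list xs" by auto
    have "t \<in> ?T" using snoc.prems by simp
    then obtain s where s: "s \<in> S" "t = \<Phi> s \<or> t = - \<Phi> s" by blast
    then have sQ: "s \<in> carrier Q" using S by blast
    have "\<exists>g. (h, g) \<in> cayley_edges Q S \<and> g \<in> carrier Q \<and> \<Phi> g = \<Phi> h + t"
      using s(2)
    proof
      assume "t = \<Phi> s"
      then show ?thesis using h(2) sQ s(1) \<Phi>_mult by (intro exI[of _ "h \<otimes> s"]) (auto simp: cayley_edges_def)
    next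
      assume t: "t = - \<Phi> s"
      have "h = h \<otimes> inv s \<otimes> s" using h(2) sQ by (simp add: m_assoc)
      then show ?thesis using h(2) sQ s(1) t \<Phi>_mult \<Phi>_inv by (intro exI[of _ "h \<otimes> inv s"]) (auto simp: cayley_edges_def)
    qed
    then show ?case using h(1,3) by auto
  qed
  show "cayley_ball Q S n \<subseteq> carrier Q" using fwd unfolding cayley_ball_def by blast
  show "\<Phi> ` cayley_ball Q S n = wball (\<Phi> ` S) n"
  proof (intro equalityI subsetI)
    fix y assume "y \<in> \<Phi> ` cayley_ball Q S n"
    then obtain g k where g: "k \<le> n" "(\<one>, g) \<in> cayley_edges Q S ^^ k" "y = \<Phi> g" unfolding cayley_ball_def by blast
    then show "y \<in> wball (\<Phi> ` S) n" using fwd[OF g(2)] unfolding wball_def by auto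
  next
    fix y assume "y \<in> wball (\<Phi> ` S) n"
    then obtain xs where xs: "y = sum_list xs" "set xs \<subseteq> ?T" "length xs \<le> n" unfolding wball_def by blast
    then obtain g where "(\<one>, g) \<in> cayley_edges Q S ^^ length xs" "\<Phi> g = y" using bwd[of xs] by blast
    then show "y \<in> \<Phi> ` cayley_ball Q S n" using xs(3) unfolding cayley_ball_def by blast
  qed
qed

lemma growth_rate_ge:
  assumes S: "finite S" "S \<subseteq> carrier Q" and free: "short_free (\<Phi> ` S) N" and N: "0 < N"
  shows "root N 2 \<le> growth_rate Q S"
proof -
  have c: "card (cayley_ball Q S n) = card (wball (\<Phi> ` S) n)" for n
    using card_image[OF inj_on_subset[OF \<Phi>_inj \<Phi>_ball(2)[OF S(2)]]] \<Phi>_ball(1)[OF S(2)] by metis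
  have fin: "finite (\<Phi> ` S)" using S by simp
  have one: "1 \<le> card (wball (\<Phi> ` S) n)" for n
    using wball_finite[OF fin, of n] wball_zero[of "\<Phi> ` S" n] by (metis Suc_leI One_nat_def card_gt_0_iff empty_iff)
  show ?thesis unfolding growth_rate_def c
    by (rule root_lim_ge[OF root_convergent[OF one wball_card_zero wball_card_add[OF fin]] N wball_card_exp[OF fin free]])
qed

lemma virtually_abelianI: assumes "virt_abelian (\<Phi> ` carrier Q)" shows "virtually_abelian Q"
proof -
  obtain K' F where K': "subgrp K'" "K' \<subseteq> \<Phi> ` carrier Q" "\<And>a b. a \<in> K' \<Longrightarrow> b \<in> K' \<Longrightarrow> comm a b"
    and F: "finite F" "\<And>h. h \<in> \<Phi> ` carrier Q \<Longrightarrow> \<exists>k\<in>K'. \<exists>x\<in>F. h = k + x"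
    using assms unfolding virt_abelian_def by metis
  define K where "K = {x\<in>carrier Q. \<Phi> x \<in> K'}"
  have sK: "subgroup K Q"
  proof
    show "K \<subseteq> carrier Q" by (auto simp: K_def)
    show "x \<otimes> y \<in> K" if "x \<in> K" "y \<in> K" for x y using that subgrp_add[OF K'(1)] \<Phi>_mult by (simp add: K_def)
    show "\<one> \<in> K" using subgrp_zero[OF K'(1)] \<Phi>_one by (simp add: K_def)
    show "inv x \<in> K" if "x \<in> K" for x using that subgrp_minus[OF K'(1)] \<Phi>_inv by (simp add: K_def)
  qed
  have "x \<otimes> y = y \<otimes> x" if "x \<in> K" "y \<in> K" for x y
  proof -
    have xy: "x \<in> carrier Q" "y \<in> carrier Q" "comm (\<Phi> x) (\<Phi> y)" using that K'(3) by (auto simp: K_def)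
    then have "\<Phi> (x \<otimes> y) = \<Phi> (y \<otimes> x)" using \<Phi>_mult by (simp add: comm_def)
    then show ?thesis using \<Phi>_eq xy by simp
  qed
  then have "comm_group (Q\<lparr>carrier := K\<rparr>)"
    using subgroup.subgroup_is_group[OF sK is_group] by (intro group.group_comm_groupI) auto
  \<comment> \<open>An element of \<open>F\<close> outside the image of the embedding contributes
    some arbitrary coset, which is harmless since only finiteness is at stake.\<close>
  moreover have "rcosets K \<subseteq> (\<lambda>y. K #> inv_into (carrier Q) \<Phi> y) ` F"
  proof
    fix c assume "c \<in> rcosets K"
    then obtain x where x: "x \<in> carrier Q" "c = K #> x" unfolding RCOSETS_def by blast
    then obtain k y where ky: "k \<in> K'" "y \<in> F" "\<Phi> x = k + y" using F(2) by blast
    then obtain k0 where k0: "k0 \<in> carrier Q" "k = \<Phi> k0" using K'(2) by blast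
    then have k0K: "k0 \<in> K" using ky by (simp add: K_def)
    have "y = - \<Phi> k0 + \<Phi> x" using ky(3) k0(2) by simp
    then have "y = \<Phi> (inv k0 \<otimes> x)" using \<Phi>_mult \<Phi>_inv k0(1) x(1) by simp
    then have "inv_into (carrier Q) \<Phi> y = inv k0 \<otimes> x" using inv_into_f_f[OF \<Phi>_inj] k0(1) x(1) by simp
    moreover have "K #> (inv k0 \<otimes> x) = K #> x"
    proof -
      have "inv k0 \<in> K" using subgroup.m_inv_closed[OF sK k0K] .
      then have "K #> inv k0 = K" using coset_join2[OF _ sK] k0(1) by simp
      then show ?thesis using coset_mult_assoc[of K "inv k0" x] k0(1) x(1) subgroup.subset[OF sK] by simp
    qed
    ultimately show "c \<in> (\<lambda>y. K #> inv_into (carrier Q) \<Phi> y) ` F" using x(2) ky(2) by (metis image_eqI)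
  qed
  then have "finite (rcosets K)" using F(1) finite_subset by blast
  ultimately show ?thesis unfolding virtually_abelian_def using sK by blast
qed

text \<open>Being virtually abelian does not depend on the generating set. If it fails, every finite
  generating set yields a free pair within the same radius, which bounds the infimum; finite
  generation makes that infimum one over a nonempty set.\<close>

lemma uniform_growth:
  assumes fg: "finitely_generated Q" and alt: "alternative (\<Phi> ` carrier Q)"
  shows "virtually_abelian Q \<or> (uniform_exponential_growth Q \<and> min_growth_rate Q \<ge> root 600 2)"
proof (cases "virt_abelian (\<Phi> ` carrier Q)")
  case True
  then show ?thesis using virtually_abelianI by blast
next
  case False
  have "root 600 2 \<le> growth_rate Q S" if "finite_generating_set Q S" for S
  proof -
    have S: "finite S" "S \<subseteq> carrier Q" "generate Q S = carrier Q" using that by (auto simp: finite_generating_set_def)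
    have "gspan (\<Phi> ` S) = \<Phi> ` carrier Q" using \<Phi>_generate[OF S(2)] S(3) by simp
    then have "short_free (\<Phi> ` S) 600" using alt[unfolded alternative_def, rule_format, of "\<Phi> ` S"] S False by auto
    then show ?thesis by (rule growth_rate_ge[OF S(1,2)]) simp
  qed
  then have "root 600 2 \<le> min_growth_rate Q"
    unfolding min_growth_rate_def using fg by (intro cINF_greatest) (auto simp: finitely_generated_def)
  moreover have "1 < root 600 (2 :: real)" by (simp add: real_root_gt_1_iff)
  ultimately show ?thesis unfolding uniform_exponential_growth_def by linarith
qed

end

theorem theorem6p4:
  fixes V :: "'v set" and E :: "'v set set" and m :: "'v set \<Rightarrow> nat"
    and H :: "'v word set set"
  assumes "defining_graph V E m"
    and "triangle_free E"
    and "subgroup H (artin_group V E m)"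
    and "finitely_generated ((artin_group V E m)\<lparr>carrier := H\<rparr>)"
  shows "virtually_abelian ((artin_group V E m)\<lparr>carrier := H\<rparr>) \<or>
    (uniform_exponential_growth ((artin_group V E m)\<lparr>carrier := H\<rparr>) \<and>
     min_growth_rate ((artin_group V E m)\<lparr>carrier := H\<rparr>) \<ge> root 600 2)"
proof -
  let ?R = "artin_relations E m"
  let ?A = "artin_group V E m"
  let ?f = "pres_gen V ?R"
  interpret A: group ?A unfolding artin_group_def by (rule group_presented_group)
  interpret artin_graph V E m by unfold_locales (rule assms(1))
  have "finite V" using assms(1) unfolding defining_graph_def by blast
  then have alt: "alternative (gspan (?f ` V))" by (rule artin_alternative[OF assms(2) _ realizes_pres_gen])
  have HA: "H \<subseteq> carrier ?A" by (rule subgroup.subset[OF assms(3)])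
  interpret Q: additive_embedding "?A\<lparr>carrier := H\<rparr>" "cayley ?A"
  proof (intro additive_embedding.intro additive_embedding_axioms.intro)
    show "group (?A\<lparr>carrier := H\<rparr>)" by (rule subgroup.subgroup_is_group[OF assms(3) A.is_group])
    show "inj_on (cayley ?A) (carrier (?A\<lparr>carrier := H\<rparr>))"
      using A.cayley_inj HA by (auto simp: inj_on_def)
    show "cayley ?A (x \<otimes>\<^bsub>?A\<lparr>carrier := H\<rparr>\<^esub> y) = cayley ?A x + cayley ?A y"
      if "x \<in> carrier (?A\<lparr>carrier := H\<rparr>)" "y \<in> carrier (?A\<lparr>carrier := H\<rparr>)" for x y
      using that A.cayley_mult HA by auto
  qed
  have "cayley ?A ` H \<subseteq> gspan (?f ` V)"
  proof
    fix x assume "x \<in> cayley ?A ` H"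
    then obtain g where g: "g \<in> carrier ?A" "x = cayley ?A g" using HA by blast
    then obtain w where "w \<in> words_on V" "g = pres_cong V ?R `` {w}"
      unfolding artin_group_def by (auto elim: presented_group_carrierE)
    then have "x = evalw ?f w" "w \<in> words_on V" using g(2) evalw_pres_gen[of w V ?R] by (simp_all add: artin_group_def)
    then show "x \<in> gspan (?f ` V)" unfolding gspan_evalw by blast
  qed
  \<comment> \<open>The alternative for the whole Artin group covers every subgroup, as it speaks of
    arbitrary finite subsets.\<close>
  then have "alternative (cayley ?A ` carrier (?A\<lparr>carrier := H\<rparr>))" using alternative_mono[OF alt] by simp
  then show ?thesis by (rule Q.uniform_growth[OF assms(4)])
qed

end
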